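(* Let $n$ be a positive integer, $A\in W^{n-1,q}(\mathbb{D},\mathbb{B})$ with $q>2$, and $\gamma_k\in C(\partial\mathbb{D},\mathbb{B})$ for $0\le k\le n-1$. The following three statements are equivalent. (1) The Dirichlet problem $$\begin{cases}(\bar\partial-A)^n w=0, & \text{in }\mathbb{D},\\ (\bar\partial-A)^k w=\gamma_k, & \text{on }\partial\mathbb{D},\quad 0\le k\le n-1,\end{cases}$$ is solvable, with solution $w=p^+w^++p^-w^-:\mathbb{D}\to\mathbb{B}$. (2) The Dirichlet problems $$\begin{cases}\left(\dfrac{\partial}{\partial z^*}-(A^+)^*\right)^n(w^+)^*=0, & \text{in }\mathbb{D},\\[2mm] \left(\dfrac{\partial}{\partial z^*}-(A^+)^*\right)^k(w^+)^*=(\gamma_k^+)^*, & \text{on }\partial\mathbb{D},\quad 0\le k\le n-1,\end{cases}$$ and $$\begin{cases}\left(\dfrac{\partial}{\partial z^*}-A^-\right)^n w^-=0, & \text{in }\mathbb{D},\\[2mm] \left(\dfrac{\partial}{\partial z^*}-A^-\right)^k w^-=\gamma_k^-, & \text{on }\partial\mathbb{D},\quad 0\le k\le n-1,\end{cases}$$ are solvable, with solutions $(w^+)^*$ and $w^-$, respectively. (3) For all $|z|<1$ and $0\le k\le n-1$, $$\sum_{\lambda=k}^{n-1}\frac{z^*}{2\pi i}\int_{|\zeta|=1}(-1)^{\lambda-k}\frac{(\gamma_\lambda^+)^*(\zeta)\,e^{-T_{\mathbb{D}}[(A^+)^*](\zeta)}}{1-z^*\zeta}\frac{[(\zeta-z)^*]^{\lambda-k}}{(\lambda-k)!}\,d\zeta=0$$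 and $$\sum_{\lambda=k}^{n-1}\frac{z^*}{2\pi i}\int_{|\zeta|=1}(-1)^{\lambda-k}\frac{\gamma_\lambda^-(\zeta)\,e^{-T_{\mathbb{D}}[A^-](\zeta)}}{1-z^*\zeta}\frac{[(\zeta-z)^*]^{\lambda-k}}{(\lambda-k)!}\,d\zeta=0.$$ Here the function $w=p^+w^++p^-w^-$ in (1) and (2) is the same; when it exists, it is $$w=p^+\left(e^{T_{\mathbb{D}}[(A^+)^*]}\varphi_+\right)^*+p^-e^{T_{\mathbb{D}}[A^-]}\varphi_-,$$ where $$\varphi_+(z)=\sum_{k=0}^{n-1}\frac{(-1)^k}{2\pi i}\int_{|\zeta|=1}\frac{(\gamma_k^+)^*(\zeta)\,e^{-T_{\mathbb{D}}[(A^+)^*](\zeta)}}{k!}\frac{[(\zeta-z)^*]^k}{\zeta-z}\,d\zeta$$ and $$\varphi_-(z)=\sum_{k=0}^{n-1}\frac{(-1)^k}{2\pi i}\int_{|\zeta|=1}\frac{\gamma_k^-(\zeta)\,e^{-T_{\mathbb{D}}[A^-](\zeta)}}{k!}\frac{[(\zeta-z)^*]^k}{\zeta-z}\,d\zeta.$$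
   Context: $\mathbb{D}$ is the open unit disk in $\mathbb{C}$. The bicomplex numbers $\mathbb{B}$ are the commutative algebra of elements $z_1+jz_2$ with $z_1,z_2\in\mathbb{C}$, $j^2=-1$, $ij=ji$. The idempotents are $p^\pm=\frac12(1\pm ji)$; every $w=z_1+jz_2\in\mathbb{B}$ is uniquely $w=p^+w^++p^-w^-$ with $w^\pm=z_1\mp iz_2\in\mathbb{C}$, and the same notation is used pointwise for $\mathbb{B}$-valued functions. The norm is $\|w\|_{\mathbb{B}}=\sqrt{(|w^+|^2+|w^-|^2)/2}$; $C(\partial\mathbb{D},\mathbb{B})$ is the space of $\mathbb{B}$-valued functions on $\partial\mathbb{D}$ continuous for this norm, and $W^{m,q}(\mathbb{D},\mathbb{B})$ is the Sobolev space of $\mathbb{B}$-valued functions on $\mathbb{D}$ that, together with their derivatives up to order $m$, have $\|\cdot\|_{\mathbb{B}}$ in $L^q(\mathbb{D})$. The complex conjugate of a complex number or complex-valued function is denoted by $(\cdot)^*$, so $z^*=x-iy$ for $z=x+iy$. The operators are $\frac{\partial}{\partial z^*}=\frac12\left(\frac{\partial}{\partial x}+i\frac{\partial}{\partial y}\right)$ and $\bar\partial=\frac12\left(\frac{\partial}{\partial x}+j\frac{\partial}{\partial y}\right)$, the latter acting on $\mathbb{B}$-valued functions of $z=x+iy$; powers such as $(\bar\partial-A)^k$ denote $k$-fold composition of $w\mapsto\bar\partial w-Aw$. For complex-valued $g$ on $\mathbb{D}$, $$T_{\mathbb{D}}[g](z)=-\frac1\pi\iint_{\mathbb{D}}\frac{g(\zeta)}{\zeta-z}\,d\xi\,d\eta,\qquad\zeta=\xi+i\eta.$$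 Boundary conditions prescribe boundary values in the usual sense of the Dirichlet problem. *)

theory Defs
  imports "HOL-Complex_Analysis.Complex_Analysis"
begin

section \<open>Bicomplex numbers\<close>

text \<open>\<open>Bicomplex z\<^sub>1 z\<^sub>2\<close> stands for \<open>z\<^sub>1 + j z\<^sub>2\<close>.\<close>

datatype bicomplex = Bicomplex (bfst: complex) (bsnd: complex)

lemma bicomplex_eq_iff: "w = v \<longleftrightarrow> bfst w = bfst v \<and> bsnd w = bsnd v"
  by (cases w; cases v) simp

definition plus_part :: "bicomplex \<Rightarrow> complex"
  where "plus_part w = bfst w - \<i> * bsnd w"

definition minus_part :: "bicomplex \<Rightarrow> complex"
  where "minus_part w = bfst w + \<i> * bsnd w"

instantiation bicomplex :: comm_ring_1
begin

definition "0 = Bicomplex 0 0"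
definition "1 = Bicomplex 1 0"
definition "w + v = Bicomplex (bfst w + bfst v) (bsnd w + bsnd v)"
definition "- w = Bicomplex (- bfst w) (- bsnd w)"
definition "w - v = Bicomplex (bfst w - bfst v) (bsnd w - bsnd v)"
definition "w * v = Bicomplex (bfst w * bfst v - bsnd w * bsnd v) (bfst w * bsnd v + bsnd w * bfst v)"

instance
  by standard
    (auto simp: zero_bicomplex_def one_bicomplex_def plus_bicomplex_def uminus_bicomplex_def
      minus_bicomplex_def times_bicomplex_def algebra_simps)

end

lemma bicomplex_sel [simp]:
  "bfst 0 = 0" "bsnd 0 = 0" "bfst 1 = 1" "bsnd 1 = 0"
  "bfst (w + v) = bfst w + bfst v" "bsnd (w + v) = bsnd w + bsnd v"
  "bfst (- w) = - bfst w" "bsnd (- w) = - bsnd w"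
  "bfst (w - v) = bfst w - bfst v" "bsnd (w - v) = bsnd w - bsnd v"
  "bfst (w * v) = bfst w * bfst v - bsnd w * bsnd v"
  "bsnd (w * v) = bfst w * bsnd v + bsnd w * bfst v"
  by (simp_all add: zero_bicomplex_def one_bicomplex_def plus_bicomplex_def uminus_bicomplex_def
      minus_bicomplex_def times_bicomplex_def)

instantiation bicomplex :: real_algebra_1
begin

definition "r *\<^sub>R w = Bicomplex (r *\<^sub>R bfst w) (r *\<^sub>R bsnd w)"

instance
  by standard (auto simp: bicomplex_eq_iff scaleR_bicomplex_def algebra_simps)

end

lemma bicomplex_sel_scaleR [simp]:
  "bfst (r *\<^sub>R w) = r *\<^sub>R bfst w" "bsnd (r *\<^sub>R w) = r *\<^sub>R bsnd w"
  by (simp_all add: scaleR_bicomplex_def)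

text \<open>
  This norm is not submultiplicative (\<open>\<parallel>p\<^sup>+\<parallel>\<^sup>2 = 1 / 2 < \<parallel>p\<^sup>+\<parallel>\<close>), so the
  type is not an instance of \<^class>\<open>real_normed_algebra\<close>.
\<close>

instantiation bicomplex :: real_inner
begin

definition "norm w = sqrt (((cmod (plus_part w))\<^sup>2 + (cmod (minus_part w))\<^sup>2) / 2)"
definition "w \<bullet> v = bfst w \<bullet> bfst v + bsnd w \<bullet> bsnd v"
definition "sgn (w :: bicomplex) = w /\<^sub>R norm w"
definition "dist (w :: bicomplex) v = norm (w - v)"
definition "(uniformity :: (bicomplex \<times> bicomplex) filter)
  = (INF e\<in>{0 <..}. principal {(x, y). dist x y < e})"
definition "open (U :: bicomplex set)
  \<longleftrightarrow> (\<forall>x\<in>U. \<forall>\<^sub>F (x', y) in uniformity. x' = x \<longrightarrow> y \<in> U)"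

instance
proof
  fix w v u :: bicomplex and r :: real and U :: "bicomplex set"
  show "dist w v = norm (w - v)" by (fact dist_bicomplex_def)
  show "sgn w = w /\<^sub>R norm w" by (fact sgn_bicomplex_def)
  show "(uniformity :: (bicomplex \<times> bicomplex) filter)
    = (INF e\<in>{0 <..}. principal {(x, y). dist x y < e})" by (fact uniformity_bicomplex_def)
  show "open U \<longleftrightarrow> (\<forall>x\<in>U. \<forall>\<^sub>F (x', y) in uniformity. x' = x \<longrightarrow> y \<in> U)"
    by (fact open_bicomplex_def)
  show "w \<bullet> v = v \<bullet> w" by (simp add: inner_bicomplex_def inner_commute)
  show "(w + v) \<bullet> u = w \<bullet> u + v \<bullet> u" by (simp add: inner_bicomplex_def inner_add_left)
  show "(r *\<^sub>R w) \<bullet> v = r * (w \<bullet> v)" by (simp add: inner_bicomplex_def algebra_simps)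
  show "0 \<le> w \<bullet> w" by (simp add: inner_bicomplex_def)
  show "w \<bullet> w = 0 \<longleftrightarrow> w = 0"
    by (simp add: inner_bicomplex_def bicomplex_eq_iff add_nonneg_eq_0_iff)
  have "(cmod (plus_part w))\<^sup>2 + (cmod (minus_part w))\<^sup>2 = 2 * (w \<bullet> w)"
    unfolding cmod_power2
    by (simp add: inner_bicomplex_def plus_part_def minus_part_def inner_complex_def
        power2_sum power2_diff power2_eq_square[symmetric])
  then show "norm w = sqrt (w \<bullet> w)" by (simp add: norm_bicomplex_def)
qed

end

instantiation bicomplex :: euclidean_space
begin

definition "Basis = {Bicomplex 1 0, Bicomplex \<i> 0, Bicomplex 0 1, Bicomplex 0 \<i>}"

instance
proof
  fix u v w :: bicomplex
  show "(Basis :: bicomplex set) \<noteq> {}" and "finite (Basis :: bicomplex set)"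
    by (simp_all add: Basis_bicomplex_def)
  show "u \<bullet> v = (if u = v then 1 else 0)" if "u \<in> Basis" "v \<in> Basis"
    using that unfolding Basis_bicomplex_def inner_bicomplex_def inner_complex_def
    by (elim insertE emptyE; hypsubst; simp add: complex_eq_iff)
  show "(\<forall>u\<in>Basis. w \<bullet> u = 0) \<longleftrightarrow> w = 0"
    unfolding bicomplex_eq_iff[of w] complex_eq_iff
    by (simp add: Basis_bicomplex_def inner_bicomplex_def inner_complex_def conj_assoc)
qed

end

definition bicomplex_of :: "complex \<Rightarrow> bicomplex"
  where "bicomplex_of z = Bicomplex z 0"

definition bj :: bicomplex
  where "bj = Bicomplex 0 1"

definition p_plus :: bicomplex
  where "p_plus = (1 / 2) *\<^sub>R (1 + bj * bicomplex_of \<i>)"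

definition p_minus :: bicomplex
  where "p_minus = (1 / 2) *\<^sub>R (1 - bj * bicomplex_of \<i>)"

lemma bj_square: "bj * bj = - 1"
  by (simp add: bicomplex_eq_iff bj_def)

lemma idempotent_parts:
  "plus_part (p_plus * bicomplex_of a + p_minus * bicomplex_of b) = a"
  "minus_part (p_plus * bicomplex_of a + p_minus * bicomplex_of b) = b"
  by (simp_all add: p_plus_def p_minus_def bicomplex_of_def bj_def plus_part_def minus_part_def
      complex_eq_iff)

lemma plus_minus_part_inject:
  assumes "plus_part w = plus_part v" "minus_part w = minus_part v"
  shows "w = v"
proof -
  have "2 * bfst w = 2 * bfst v" "2 * \<i> * bsnd w = 2 * \<i> * bsnd v"
    using arg_cong2[OF assms, of "(+)"] arg_cong2[OF assms(2,1), of "(-)"]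
    by (simp_all add: plus_part_def minus_part_def)
  then show ?thesis by (simp add: bicomplex_eq_iff)
qed

lemma idempotent_decomposition:
  "w = p_plus * bicomplex_of a + p_minus * bicomplex_of b
    \<longleftrightarrow> a = plus_part w \<and> b = minus_part w"
  using idempotent_parts plus_minus_part_inject by metis


section \<open>Weak derivatives and Sobolev spaces on the unit disk\<close>

abbreviation unit_disk :: "complex set"
  where "unit_disk \<equiv> ball 0 1"

text \<open>
  Test functions are the compactly supported \<open>C\<^sup>1\<close> functions.  By mollification they
  define the same weak derivatives as the compactly supported smooth ones.
\<close>

definition test_function :: "(complex \<Rightarrow> real) \<Rightarrow> bool"
  where "test_function \<phi> \<longleftrightarrow>
    (\<forall>z. \<phi> differentiable (at z)) \<and>
    (\<forall>v. continuous_on UNIV (\<lambda>z. frechet_derivative \<phi> (at z) v)) \<and>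
    (\<exists>K. compact K \<and> K \<subseteq> unit_disk \<and> (\<forall>z. z \<notin> K \<longrightarrow> \<phi> z = 0))"

definition locally_integrable :: "(complex \<Rightarrow> 'a::euclidean_space) \<Rightarrow> bool"
  where "locally_integrable u \<longleftrightarrow>
    (\<forall>K. compact K \<longrightarrow> K \<subseteq> unit_disk \<longrightarrow> set_integrable lebesgue K u)"

text \<open>
  \<open>g\<close> is the weak derivative of \<open>u\<close> in direction \<open>v\<close>: \<open>v = 1\<close> is
  \<open>\<partial>/\<partial>x\<close> and \<open>v = \<i>\<close> is \<open>\<partial>/\<partial>y\<close>.
\<close>

definition weak_derivative ::
    "complex \<Rightarrow> (complex \<Rightarrow> 'a::euclidean_space) \<Rightarrow> (complex \<Rightarrow> 'a) \<Rightarrow> bool"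
  where "weak_derivative v u g \<longleftrightarrow>
    locally_integrable u \<and> locally_integrable g \<and>
    (\<forall>\<phi>. test_function \<phi> \<longrightarrow>
      (LINT z:unit_disk|lebesgue. frechet_derivative \<phi> (at z) v *\<^sub>R u z)
        = - (LINT z:unit_disk|lebesgue. \<phi> z *\<^sub>R g z))"

definition Lq_disk :: "real \<Rightarrow> (complex \<Rightarrow> 'a::euclidean_space) \<Rightarrow> bool"
  where "Lq_disk q u \<longleftrightarrow>
    u \<in> borel_measurable (lebesgue_on unit_disk) \<and>
    set_integrable lebesgue unit_disk (\<lambda>z. norm (u z) powr q)"

text \<open>Membership in \<open>W\<^sup>m\<^sup>,\<^sup>q\<close> of the disk, for \<open>1 \<le> q < \<infinity>\<close>.\<close>

primrec sobolev :: "nat \<Rightarrow> real \<Rightarrow> (complex \<Rightarrow> 'a::euclidean_space) \<Rightarrow> bool"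
  where
    "sobolev 0 q u \<longleftrightarrow> Lq_disk q u"
  | "sobolev (Suc m) q u \<longleftrightarrow> Lq_disk q u \<and>
      (\<exists>ux uy. weak_derivative 1 u ux \<and> weak_derivative \<i> u uy \<and>
        sobolev m q ux \<and> sobolev m q uy)"


section \<open>Generalized Cauchy-Riemann operators and Dirichlet problems\<close>

text \<open>
  \<open>weak_dbar J u g\<close> says that \<open>1/2 (\<partial>/\<partial>x + J \<partial>/\<partial>y) u = g\<close> as distributions on
  the disk.  For \<open>J = \<i>\<close> in the complex numbers the operator is \<open>\<partial>/\<partial>z\<^sup>*\<close>,
  for \<open>J = j\<close> in the bicomplex numbers it is the bicomplex \<open>\<partial>\<close>-bar operator.
\<close>

definition weak_dbar ::
    "'a::{real_algebra_1, euclidean_space} \<Rightarrow> (complex \<Rightarrow> 'a) \<Rightarrow> (complex \<Rightarrow> 'a) \<Rightarrow> bool"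
  where "weak_dbar J u g \<longleftrightarrow>
    locally_integrable u \<and> locally_integrable g \<and>
    (\<forall>\<phi>. test_function \<phi> \<longrightarrow>
      (LINT z:unit_disk|lebesgue.
          (1 / 2) *\<^sub>R (frechet_derivative \<phi> (at z) 1 *\<^sub>R u z
                    + J * (frechet_derivative \<phi> (at z) \<i> *\<^sub>R u z)))
        = - (LINT z:unit_disk|lebesgue. \<phi> z *\<^sub>R g z))"

text \<open>
  \<open>vekua_op J A w v\<close> says that \<open>v\<close> is a version of \<open>1/2 (\<partial>/\<partial>x + J \<partial>/\<partial>y) w - A w\<close>.
  Weak derivatives are determined only almost everywhere, so the operator is a
  relation; its relational power \<open>(vekua_op J A ^^ k) w v\<close> says that \<open>v\<close> is a version of the
  \<open>k\<close>-fold composition applied to \<open>w\<close>.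
\<close>

definition vekua_op ::
    "'a::{real_algebra_1, euclidean_space} \<Rightarrow> (complex \<Rightarrow> 'a) \<Rightarrow> (complex \<Rightarrow> 'a) \<Rightarrow> (complex \<Rightarrow> 'a) \<Rightarrow> bool"
  where "vekua_op J A w v \<longleftrightarrow>
    (\<exists>g. weak_dbar J w g \<and>
      (AE z in lebesgue. z \<in> unit_disk \<longrightarrow> v z = g z - A z * w z))"

definition has_boundary_values ::
    "(complex \<Rightarrow> 'a::euclidean_space) \<Rightarrow> (complex \<Rightarrow> 'a) \<Rightarrow> bool"
  where "has_boundary_values v g \<longleftrightarrow>
    continuous_on unit_disk v \<and>
    (\<forall>\<zeta>\<in>sphere 0 1. (v \<longlongrightarrow> g \<zeta>) (at \<zeta> within unit_disk))"

text \<open>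
  For \<open>k = 0\<close> the boundary condition concerns \<open>w\<close> itself, since the relational power is then
  equality.  A solution is thus always given by its continuous representative.
\<close>

definition dirichlet_solution ::
    "'a::{real_algebra_1, euclidean_space} \<Rightarrow> nat \<Rightarrow> (complex \<Rightarrow> 'a) \<Rightarrow> (nat \<Rightarrow> complex \<Rightarrow> 'a)
      \<Rightarrow> (complex \<Rightarrow> 'a) \<Rightarrow> bool"
  where "dirichlet_solution J n A \<gamma> w \<longleftrightarrow>
    (vekua_op J A ^^ n) w (\<lambda>_. 0) \<and>
    (\<forall>k<n. \<exists>v. (vekua_op J A ^^ k) w v \<and> has_boundary_values v (\<gamma> k))"


section \<open>Integral operators\<close>

definition T_disk :: "(complex \<Rightarrow> complex) \<Rightarrow> complex \<Rightarrow> complex"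
  where "T_disk g z = - (1 / of_real pi) * (LINT \<zeta>:unit_disk|lebesgue. g \<zeta> / (\<zeta> - z))"

text \<open>
  In the next two definitions \<open>a\<close> is the coefficient and \<open>g k\<close> the boundary data of a
  complex Dirichlet problem.  \<open>circlepath 0 1\<close> is the positively oriented unit circle.
\<close>

definition solvability_sum ::
    "nat \<Rightarrow> (complex \<Rightarrow> complex) \<Rightarrow> (nat \<Rightarrow> complex \<Rightarrow> complex) \<Rightarrow> nat \<Rightarrow> complex \<Rightarrow> complex"
  where "solvability_sum n a g k z =
    (\<Sum>l=k..n-1. cnj z / (2 * of_real pi * \<i>) *
      contour_integral (circlepath 0 1)
        (\<lambda>\<zeta>. (-1) ^ (l - k) * (g l \<zeta> * exp (- T_disk a \<zeta>) / (1 - cnj z * \<zeta>))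
              * (cnj (\<zeta> - z) ^ (l - k) / fact (l - k))))"

definition polyanalytic_part ::
    "nat \<Rightarrow> (complex \<Rightarrow> complex) \<Rightarrow> (nat \<Rightarrow> complex \<Rightarrow> complex) \<Rightarrow> complex \<Rightarrow> complex"
  where "polyanalytic_part n a g z =
    (\<Sum>k=0..n-1. (-1) ^ k / (2 * of_real pi * \<i>) *
      contour_integral (circlepath 0 1)
        (\<lambda>\<zeta>. g k \<zeta> * exp (- T_disk a \<zeta>) / fact k * (cnj (\<zeta> - z) ^ k / (\<zeta> - z))))"

end

theory Submission
  imports Defs
begin

text \<open>
  The idempotents turn the bicomplex \<open>\<partial>\<close>-bar operator into \<open>\<partial>/\<partial>z\<close> on the plus and
  \<open>\<partial>/\<partial>z\<^sup>*\<close> on the minus component, so that everything reduces to the complex problem for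
  \<open>\<partial>/\<partial>z\<^sup>* - a\<close> with \<open>a\<close> in \<open>L\<^sup>q\<close>.  There \<open>T[a]\<close> is continuous with
  \<open>\<partial>T[a]/\<partial>z\<^sup>* = a\<close>, and the factor \<open>exp (- T[a])\<close> conjugates \<open>\<partial>/\<partial>z\<^sup>* - a\<close> to
  \<open>\<partial>/\<partial>z\<^sup>*\<close>.  A solution becomes a chain \<open>\<phi>\<^sub>0, \<dots>, \<phi>\<^sub>n = 0\<close> of continuous functions with
  \<open>\<partial>\<phi>\<^sub>k/\<partial>z\<^sup>* = \<phi>\<^sub>k\<^sub>+\<^sub>1\<close>.  For fixed \<open>z\<close> the sum of
  \<open>(-1)\<^sup>m \<phi>\<^sub>k\<^sub>+\<^sub>m(\<zeta>) ((\<zeta> - z)\<^sup>*)\<^sup>m / m!\<close> over \<open>m\<close> is then holomorphic in \<open>\<zeta>\<close>; Cauchy's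
  formula for it is the representation of \<open>\<phi>\<^sub>k(z)\<close>, and Cauchy's theorem for its product with
  \<open>z\<^sup>* / (1 - z\<^sup>* \<zeta>)\<close> is the solvability condition.  Conversely, the solvability condition turns
  the Cauchy kernel in the representation into the Poisson kernel, which yields the boundary values.
\<close>

section \<open>Complex test functions\<close>

text \<open>Below, d-bar is the derivative with respect to the conjugate variable. Conjugating the
  plus component lets one complex theory serve both: \<open>plus_conj\<close> and
  \<open>minus_part\<close> are ring homomorphisms that both send \<open>bj\<close> to
  \<open>\<i>\<close>. The condition \<open>q > 2\<close> puts the conjugate exponent
  \<open>q / (q - 1)\<close> below 2, the range of \<open>s\<close> for which
  \<open>norm w powr (- s)\<close> is locally integrable in the plane; this makes the Cauchy
  transform continuous up to the circle. The main obstacle is that its exponential is not a factor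
  for the \<open>C\<^sup>1\<close> product rule, since its d-bar derivative is only in
  \<open>L\<^sup>q\<close>. Another is that the operator is a relation: the versions that carry the
  boundary values need not be those along which the relational power was formed, and uniqueness of
  weak derivatives is needed to join them into a single chain. Finally, the definitions use real
  test functions while the factors are complex, so the weak equation is extended to complex test
  functions, which may be multiplied by any complex \<open>C\<^sup>1\<close> function on the
  disk.\<close>

text \<open>\<open>p\<close> and \<open>q\<close> are the Wirtinger derivatives \<open>\<partial>f/\<partial>z\<close> and \<open>\<partial>f/\<partial>z\<^sup>*\<close>.\<close>

definition wirtinger_C1 ::
    "complex set \<Rightarrow> (complex \<Rightarrow> complex) \<Rightarrow> (complex \<Rightarrow> complex) \<Rightarrow> (complex \<Rightarrow> complex) \<Rightarrow> bool"
  where "wirtinger_C1 S f p q \<longleftrightarrow> continuous_on S p \<and> continuous_on S q \<and>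
    (\<forall>z\<in>S. (f has_derivative (\<lambda>h. p z * h + q z * cnj h)) (at z))"

lemma wirtinger_C1_continuous: "wirtinger_C1 S f p q \<Longrightarrow> continuous_on S f"
  unfolding wirtinger_C1_def
  by (meson continuous_at_imp_continuous_on has_derivative_continuous)

lemma wirtinger_C1_subset: "wirtinger_C1 S f p q \<Longrightarrow> R \<subseteq> S \<Longrightarrow> wirtinger_C1 R f p q"
  unfolding wirtinger_C1_def by (meson continuous_on_subset subsetD)

lemma wirtinger_C1_mult:
  assumes "wirtinger_C1 S f p q" "wirtinger_C1 S g r s"
  shows "wirtinger_C1 S (\<lambda>z. f z * g z) (\<lambda>z. f z * r z + p z * g z) (\<lambda>z. f z * s z + q z * g z)"
  using assms wirtinger_C1_continuous[OF assms(1)] wirtinger_C1_continuous[OF assms(2)]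
  unfolding wirtinger_C1_def
  by (auto intro!: continuous_intros derivative_eq_intros simp: algebra_simps)

lemma wirtinger_C1_exp:
  assumes "wirtinger_C1 S f p q"
  shows "wirtinger_C1 S (\<lambda>z. exp (f z)) (\<lambda>z. exp (f z) * p z) (\<lambda>z. exp (f z) * q z)"
proof -
  have "((\<lambda>z. exp (f z)) has_derivative (\<lambda>h. exp (f z) * p z * h + exp (f z) * q z * cnj h)) (at z)"
    if "z \<in> S" for z
  proof -
    have 1: "(exp has_derivative (\<lambda>h. exp (f z) * h)) (at (f z))"
      using DERIV_exp[of "f z"] unfolding has_field_derivative_def .
    have 2: "(f has_derivative (\<lambda>h. p z * h + q z * cnj h)) (at z)"
      using assms that by (auto simp: wirtinger_C1_def)
    show ?thesis
      using has_derivative_compose[OF 2 1] by (simp add: algebra_simps)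
  qed
  then show ?thesis
    using assms wirtinger_C1_continuous[OF assms]
    unfolding wirtinger_C1_def by (auto intro!: continuous_intros)
qed

lemma wirtinger_C1_holomorphic:
  assumes "f holomorphic_on S" "open S"
  shows "wirtinger_C1 S f (deriv f) (\<lambda>_. 0)"
  unfolding wirtinger_C1_def
  using holomorphic_derivI[OF assms] holomorphic_on_imp_continuous_on[OF holomorphic_deriv[OF assms]]
  by (auto simp: has_field_derivative_def)

text \<open>Evaluation at the directions \<open>1\<close> and \<open>\<i>\<close> gives
  \<open>p + q = 0\<close> and \<open>p - q = 0\<close>. Applied wherever a function is known to be
  locally constant.\<close>

lemma wirtinger_zero_derivative:
  assumes "((\<lambda>_. 0) has_derivative (\<lambda>h. p * h + q * cnj h)) (at z)"
  shows "p = 0" "q = 0"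
proof -
  have "(\<lambda>h. p * h + q * cnj h) = (\<lambda>_. 0)"
    by (rule has_derivative_unique[OF assms has_derivative_const])
  from fun_cong[OF this, of 1] fun_cong[OF this, of \<i>] have "p + q = 0" "p - q = 0"
    by (auto simp: algebra_simps)
  then show "p = 0" "q = 0" by (auto simp: add_eq_0_iff2)
qed

lemma compact_continuous_bounded:
  fixes f :: "'a::topological_space \<Rightarrow> 'b::real_normed_vector"
  assumes "compact K" "continuous_on K f"
  obtains B where "B \<ge> 0" "\<And>z. z \<in> K \<Longrightarrow> norm (f z) \<le> B"
proof -
  have "bounded (f ` K)" using assms by (intro compact_imp_bounded compact_continuous_image)
  then obtain B where "\<And>z. z \<in> K \<Longrightarrow> norm (f z) \<le> B" by (auto simp: bounded_iff)
  then have "\<And>z. z \<in> K \<Longrightarrow> norm (f z) \<le> max B 0" by fastforce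
  then show ?thesis using that[of "max B 0"] by auto
qed

text \<open>A real-linear map is determined by its values at \<open>1\<close> and
  \<open>\<i>\<close>; expressing the real and imaginary parts of \<open>h\<close> through
  \<open>h\<close> and \<open>cnj h\<close> produces the two Wirtinger coefficients.\<close>

lemma has_derivative_real_wirtinger:
  fixes f :: "complex \<Rightarrow> real"
  assumes f: "(f has_derivative D) (at z)"
  shows "((\<lambda>z. complex_of_real (f z)) has_derivative
    (\<lambda>h. (of_real (D 1) - \<i> * of_real (D \<i>)) / 2 * h + (of_real (D 1) + \<i> * of_real (D \<i>)) / 2 * cnj h)) (at z)"
proof -
  interpret bounded_linear D using f by (rule has_derivative_bounded_linear)
  have D: "D h = Re h * D 1 + Im h * D \<i>" for h
  proof -
    have "h = Re h *\<^sub>R 1 + Im h *\<^sub>R \<i>" by (simp add: complex_eq_iff)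
    then have "D h = D (Re h *\<^sub>R 1 + Im h *\<^sub>R \<i>)" by simp
    then show ?thesis unfolding add scaleR by simp
  qed
  show ?thesis
    by (rule has_derivative_eq_rhs[OF has_derivative_of_real[OF f]])
      (subst D, auto simp: fun_eq_iff complex_eq_iff field_simps)
qed

text \<open>Complex values make the class closed under multiplication by complex
  \<open>C\<^sup>1\<close> functions, which the real-valued \<open>test_function\<close> is not.
  Keeping the derivatives as arguments lets the weak equation be written with \<open>q\<close>
  alone.\<close>

definition complex_test :: "(complex \<Rightarrow> complex) \<Rightarrow> (complex \<Rightarrow> complex) \<Rightarrow> (complex \<Rightarrow> complex) \<Rightarrow> bool"
  where "complex_test \<phi> p q \<longleftrightarrow> wirtinger_C1 UNIV \<phi> p q \<and>
    (\<exists>K. compact K \<and> K \<subseteq> unit_disk \<and> (\<forall>z. z \<notin> K \<longrightarrow> \<phi> z = 0))"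

text \<open>The complement of \<open>K\<close> is open and the function vanishes on it, so its
  derivative there is zero and both Wirtinger coefficients vanish.\<close>

lemma complex_test_supp:
  assumes "complex_test \<phi> p q"
  obtains K where "compact K" "K \<subseteq> unit_disk" "\<And>z. z \<notin> K \<Longrightarrow> \<phi> z = 0 \<and> p z = 0 \<and> q z = 0"
proof -
  obtain K where K: "compact K" "K \<subseteq> unit_disk" "\<And>z. z \<notin> K \<Longrightarrow> \<phi> z = 0"
    using assms by (auto simp: complex_test_def)
  have "p z = 0 \<and> q z = 0" if "z \<notin> K" for z
  proof -
    have d: "(\<phi> has_derivative (\<lambda>h. p z * h + q z * cnj h)) (at z)"
      using assms by (auto simp: complex_test_def wirtinger_C1_def)
    have "((\<lambda>_. 0) has_derivative (\<lambda>h. p z * h + q z * cnj h)) (at z)"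
      by (rule has_derivative_transform_within_open[OF d, of "- K"])
        (use K that in \<open>auto simp: compact_imp_closed\<close>)
    then show ?thesis using wirtinger_zero_derivative by blast
  qed
  then show ?thesis using that K by blast
qed

lemma complex_test_continuous:
  assumes "complex_test \<phi> p q"
  shows "continuous_on UNIV \<phi>" "continuous_on UNIV p" "continuous_on UNIV q"
  using assms wirtinger_C1_continuous[of UNIV \<phi> p q] unfolding complex_test_def wirtinger_C1_def by blast+

text \<open>The factor \<open>s\<close> is controlled on the disk only. The product is still
  \<open>C\<^sup>1\<close> on the whole plane, because the disk and the complement of a compact set
  carrying \<open>\<phi>\<close> are two open sets that cover it.\<close>

lemma complex_test_mult:
  assumes \<phi>: "complex_test \<phi> p q" and s: "wirtinger_C1 unit_disk s r t"
  shows "complex_test (\<lambda>z. \<phi> z * s z) (\<lambda>z. \<phi> z * r z + p z * s z) (\<lambda>z. \<phi> z * t z + q z * s z)"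
proof -
  obtain K where K: "compact K" "K \<subseteq> unit_disk" and
    z: "\<And>z. z \<notin> K \<Longrightarrow> \<phi> z = 0 \<and> p z = 0 \<and> q z = 0"
    using complex_test_supp[OF \<phi>] by blast
  have "wirtinger_C1 unit_disk \<phi> p q"
    using \<phi> wirtinger_C1_subset[of UNIV \<phi> p q unit_disk] by (auto simp: complex_test_def)
  note m = wirtinger_C1_mult[OF this s]
  let ?p = "\<lambda>z. \<phi> z * r z + p z * s z" and ?q = "\<lambda>z. \<phi> z * t z + q z * s z"
  have U: "unit_disk \<union> - K = UNIV" using K by auto
  have c: "continuous_on UNIV h" if "continuous_on unit_disk h" "\<And>z. z \<notin> K \<Longrightarrow> h z = 0" for h :: "complex \<Rightarrow> complex"
    unfolding U[symmetric]
  proof (rule continuous_on_open_Un)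
    show "continuous_on (- K) h"
      using that(2) by (subst continuous_on_cong[OF refl, of _ _ "\<lambda>_. 0"]) auto
  qed (use that K in \<open>auto simp: compact_imp_closed\<close>)
  have "((\<lambda>z. \<phi> z * s z) has_derivative (\<lambda>h. ?p z * h + ?q z * cnj h)) (at z)" for z
  proof (cases "z \<in> K")
    case True
    then show ?thesis using m K(2) by (auto simp: wirtinger_C1_def)
  next
    case False
    have "((\<lambda>z. \<phi> z * s z) has_derivative (\<lambda>h. 0)) (at z)"
      by (rule has_derivative_transform_within_open[OF has_derivative_const, of "- K"])
        (use z K False in \<open>auto simp: compact_imp_closed\<close>)
    then show ?thesis using z[OF False] by simp
  qed
  moreover have "continuous_on UNIV ?p" "continuous_on UNIV ?q"
    using m z by (auto intro!: c simp: wirtinger_C1_def)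
  ultimately show ?thesis
    unfolding complex_test_def wirtinger_C1_def using K z by auto
qed

section \<open>Local integrability of products\<close>

lemma locally_integrable_mult:
  fixes u :: "complex \<Rightarrow> complex"
  assumes u: "locally_integrable u" and f: "continuous_on unit_disk f"
  shows "locally_integrable (\<lambda>z. f z * u z)"
  unfolding locally_integrable_def
proof (intro allI impI)
  fix K :: "complex set" assume K: "compact K" "K \<subseteq> unit_disk"
  have fK: "continuous_on K f" using f K continuous_on_subset by blast
  obtain B where B: "B \<ge> 0" "\<And>z. z \<in> K \<Longrightarrow> norm (f z) \<le> B"
    using compact_continuous_bounded[OF K(1) fK] by blast
  have i: "integrable lebesgue (\<lambda>z. indicator K z *\<^sub>R u z)"
    using u K by (auto simp: locally_integrable_def set_integrable_def)
  have m: "(\<lambda>z. indicator K z *\<^sub>R f z) \<in> borel_measurable lebesgue"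
    by (rule measurable_completion) (use borel_measurable_continuous_on_indicator[OF _ fK] K in
      \<open>auto simp: borel_compact\<close>)
  have "integrable lebesgue (\<lambda>z. (indicator K z *\<^sub>R f z) * (indicator K z *\<^sub>R u z))"
  proof (rule Bochner_Integration.integrable_bound)
    show "integrable lebesgue (\<lambda>z. B *\<^sub>R (indicator K z *\<^sub>R u z))" using i by (rule integrable_scaleR_right)
    show "AE z in lebesgue. norm (indicator K z *\<^sub>R f z * indicator K z *\<^sub>R u z) \<le> norm (B *\<^sub>R indicator K z *\<^sub>R u z)"
      using B by (intro AE_I2) (auto simp: norm_mult indicator_def intro!: mult_right_mono)
  qed (use m i in measurable)
  moreover have "(\<lambda>z. (indicator K z *\<^sub>R f z) * (indicator K z *\<^sub>R u z)) = (\<lambda>z. indicator K z *\<^sub>R (f z * u z))"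
    by (auto simp: indicator_def fun_eq_iff)
  ultimately show "set_integrable lebesgue K (\<lambda>z. f z * u z)" by (simp add: set_integrable_def)
qed

lemma set_integrable_mult_supported:
  fixes u :: "complex \<Rightarrow> complex"
  assumes u: "locally_integrable u" and f: "continuous_on unit_disk f"
    and K: "compact K" "K \<subseteq> unit_disk" "\<And>z. z \<in> unit_disk - K \<Longrightarrow> f z = 0"
  shows "set_integrable lebesgue unit_disk (\<lambda>z. f z * u z)"
proof -
  have "set_integrable lebesgue K (\<lambda>z. f z * u z)"
    using locally_integrable_mult[OF u f] K by (auto simp: locally_integrable_def)
  moreover have "(\<lambda>z. indicator K z *\<^sub>R (f z * u z)) = (\<lambda>z. indicator unit_disk z *\<^sub>R (f z * u z))"
    using K(2,3) by (auto simp: indicator_def fun_eq_iff)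
  ultimately show ?thesis by (simp add: set_integrable_def)
qed

lemma locally_integrable_add:
  "locally_integrable u \<Longrightarrow> locally_integrable v \<Longrightarrow> locally_integrable (\<lambda>z. u z + v z)"
  by (auto simp: locally_integrable_def intro: set_integral_add(1))

lemma complex_test_integrable:
  fixes u :: "complex \<Rightarrow> complex"
  assumes "locally_integrable u" "complex_test \<phi> p q"
  shows "set_integrable lebesgue unit_disk (\<lambda>z. \<phi> z * u z)"
    "set_integrable lebesgue unit_disk (\<lambda>z. q z * u z)"
proof -
  obtain K where K: "compact K" "K \<subseteq> unit_disk" and
    z: "\<And>z. z \<notin> K \<Longrightarrow> \<phi> z = 0 \<and> p z = 0 \<and> q z = 0"
    using complex_test_supp[OF assms(2)] by blast
  show "set_integrable lebesgue unit_disk (\<lambda>z. \<phi> z * u z)"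
    "set_integrable lebesgue unit_disk (\<lambda>z. q z * u z)"
    by (rule set_integrable_mult_supported[OF assms(1) _ K];
      use z complex_test_continuous[OF assms(2)] continuous_on_subset in blast)+
qed


section \<open>Real and complex test functions in the weak equation\<close>

lemma complex_test_real:
  assumes "test_function \<phi>"
  shows "complex_test (\<lambda>z. of_real (\<phi> z))
    (\<lambda>z. (of_real (frechet_derivative \<phi> (at z) 1) - \<i> * of_real (frechet_derivative \<phi> (at z) \<i>)) / 2)
    (\<lambda>z. (of_real (frechet_derivative \<phi> (at z) 1) + \<i> * of_real (frechet_derivative \<phi> (at z) \<i>)) / 2)"
proof -
  let ?d = "\<lambda>v z. frechet_derivative \<phi> (at z) v"
  have "(\<phi> has_derivative frechet_derivative \<phi> (at z)) (at z)" for z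
    using assms frechet_derivative_works by (auto simp: test_function_def)
  note has_derivative_real_wirtinger[OF this]
  moreover have "continuous_on UNIV (?d v)" for v
    using assms by (simp add: test_function_def)
  moreover obtain K where "compact K" "K \<subseteq> unit_disk" "\<And>z. z \<notin> K \<Longrightarrow> \<phi> z = 0"
    using assms by (auto simp: test_function_def)
  ultimately show ?thesis
    unfolding complex_test_def wirtinger_C1_def by (auto intro!: continuous_intros)
qed

lemma complex_test_component:
  assumes \<phi>: "complex_test \<phi> p q" and f: "f = Re \<or> f = Im"
  shows "test_function (\<lambda>z. f (\<phi> z))"
    "frechet_derivative (\<lambda>z. f (\<phi> z)) (at z) h = f (p z * h + q z * cnj h)"
proof -
  have bl: "bounded_linear f" using f bounded_linear_Re bounded_linear_Im by blast
  have d: "((\<lambda>z. f (\<phi> z)) has_derivative (\<lambda>h. f (p z * h + q z * cnj h))) (at z)" for z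
    by (rule bounded_linear.has_derivative[OF bl]) (use \<phi> in \<open>auto simp: complex_test_def wirtinger_C1_def\<close>)
  have fd: "frechet_derivative (\<lambda>z. f (\<phi> z)) (at z) = (\<lambda>h. f (p z * h + q z * cnj h))" for z
    using frechet_derivative_at[OF d] by simp
  then show "frechet_derivative (\<lambda>z. f (\<phi> z)) (at z) h = f (p z * h + q z * cnj h)" by simp
  have "continuous_on UNIV (\<lambda>z. f (p z * v + q z * cnj v))" for v
    by (intro bounded_linear.continuous_on[OF bl] continuous_intros complex_test_continuous[OF \<phi>])
  moreover have "(\<lambda>z. f (\<phi> z)) differentiable (at z)" for z
    using d by (auto simp: differentiable_def)
  moreover obtain K where "compact K" "K \<subseteq> unit_disk" "\<And>z. z \<notin> K \<Longrightarrow> \<phi> z = 0"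
    using \<phi> by (auto simp: complex_test_def)
  moreover have "f 0 = 0" using f by auto
  ultimately show "test_function (\<lambda>z. f (\<phi> z))"
    unfolding test_function_def fd by metis
qed

text \<open>The real and imaginary parts of a complex test function are real test functions, and the
  weak equation is complex linear in the test function, so the real ones suffice.\<close>

lemma weak_dbar_complex_iff:
  "weak_dbar \<i> u g \<longleftrightarrow> locally_integrable u \<and> locally_integrable g \<and>
    (\<forall>\<phi> p q. complex_test \<phi> p q \<longrightarrow>
      (LINT z:unit_disk|lebesgue. q z * u z) = - (LINT z:unit_disk|lebesgue. \<phi> z * g z))"
  (is "?L \<longleftrightarrow> ?R")
proof
  assume L: ?L
  then have u: "locally_integrable u" and g: "locally_integrable g" by (auto simp: weak_dbar_def)
  show ?R
  proof (intro conjI u g allI impI)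
    fix \<phi> p q assume \<phi>: "complex_test \<phi> p q"
    \<comment> \<open>\<open>?D Re\<close> and \<open>?D Im\<close> are the d-bar derivatives of the
      real and imaginary parts of \<open>\<phi>\<close>: the derivative of \<open>\<phi>\<close> is
      \<open>p + q\<close> along \<open>1\<close> and \<open>\<i> * (p - q)\<close> along
      \<open>\<i>\<close>.\<close>
    let ?D = "\<lambda>f z. (complex_of_real (f (p z + q z)) + \<i> * of_real (f (\<i> * (p z - q z)))) / 2"
    have c: "(LINT z:unit_disk|lebesgue. ?D f z * u z) = - (LINT z:unit_disk|lebesgue. of_real (f (\<phi> z)) * g z) \<and>
      set_integrable lebesgue unit_disk (\<lambda>z. ?D f z * u z) \<and>
      set_integrable lebesgue unit_disk (\<lambda>z. of_real (f (\<phi> z)) * g z)"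
      if f: "f = Re \<or> f = Im" for f
    proof -
      note t = complex_test_component(1)[OF \<phi> f] and d = complex_test_component(2)[OF \<phi> f]
      have eq: "(\<lambda>z. ?D f z * u z) = (\<lambda>z. (1 / 2) *\<^sub>R (frechet_derivative (\<lambda>z. f (\<phi> z)) (at z) 1 *\<^sub>R u z
                    + \<i> * (frechet_derivative (\<lambda>z. f (\<phi> z)) (at z) \<i> *\<^sub>R u z)))"
        by (simp add: d scaleR_conv_of_real algebra_simps fun_eq_iff add_divide_distrib)
      have "(LINT z:unit_disk|lebesgue. ?D f z * u z) = - (LINT z:unit_disk|lebesgue. of_real (f (\<phi> z)) * g z)"
        unfolding eq using L t by (simp add: weak_dbar_def scaleR_conv_of_real)
      moreover have D: "?D f = (\<lambda>z. (of_real (frechet_derivative (\<lambda>z. f (\<phi> z)) (at z) 1)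
          + \<i> * of_real (frechet_derivative (\<lambda>z. f (\<phi> z)) (at z) \<i>)) / 2)"
        by (simp add: d algebra_simps)
      ultimately show ?thesis
        using complex_test_integrable(1)[OF g complex_test_real[OF t]]
          complex_test_integrable(2)[OF u complex_test_real[OF t], folded fun_cong[OF D]] by blast
    qed
    have "q z = ?D Re z + \<i> * ?D Im z" for z
      by (simp add: complex_eq_iff field_simps)
    then have q: "q z * u z = ?D Re z * u z + \<i> * (?D Im z * u z)" for z
      by (metis distrib_right mult.assoc)
    have \<phi>g: "\<phi> z * g z = of_real (Re (\<phi> z)) * g z + \<i> * (of_real (Im (\<phi> z)) * g z)" for z
      by (simp add: complex_eq_iff algebra_simps)
    have "(LINT z:unit_disk|lebesgue. q z * u z)
       = (LINT z:unit_disk|lebesgue. ?D Re z * u z) + \<i> * (LINT z:unit_disk|lebesgue. ?D Im z * u z)"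
      unfolding q using c[of Re] c[of Im] by (subst set_integral_add) auto
    moreover have "(LINT z:unit_disk|lebesgue. \<phi> z * g z)
       = (LINT z:unit_disk|lebesgue. of_real (Re (\<phi> z)) * g z) + \<i> * (LINT z:unit_disk|lebesgue. of_real (Im (\<phi> z)) * g z)"
      unfolding \<phi>g using c[of Re] c[of Im] by (subst set_integral_add) auto
    ultimately show "(LINT z:unit_disk|lebesgue. q z * u z) = - (LINT z:unit_disk|lebesgue. \<phi> z * g z)"
      using c[of Re] c[of Im] by (simp add: algebra_simps)
  qed
next
  assume R: ?R
  show ?L
    unfolding weak_dbar_def
  proof (intro conjI allI impI)
    fix \<phi> assume t: "test_function \<phi>"
    have "(LINT z:unit_disk|lebesgue. (of_real (frechet_derivative \<phi> (at z) 1)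
         + \<i> * of_real (frechet_derivative \<phi> (at z) \<i>)) / 2 * u z)
       = - (LINT z:unit_disk|lebesgue. of_real (\<phi> z) * g z)"
      using R complex_test_real[OF t] by blast
    moreover have "(\<lambda>z. (of_real (frechet_derivative \<phi> (at z) 1)
         + \<i> * of_real (frechet_derivative \<phi> (at z) \<i>)) / 2 * u z)
      = (\<lambda>z. (1 / 2) *\<^sub>R (frechet_derivative \<phi> (at z) 1 *\<^sub>R u z
                    + \<i> * (frechet_derivative \<phi> (at z) \<i> *\<^sub>R u z)))"
      by (simp add: scaleR_conv_of_real algebra_simps fun_eq_iff add_divide_distrib)
    moreover have "(LINT z:unit_disk|lebesgue. of_real (\<phi> z) * g z) = (LINT z:unit_disk|lebesgue. \<phi> z *\<^sub>R g z)"
      by (simp add: scaleR_conv_of_real)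
    ultimately show "(LINT z:unit_disk|lebesgue. (1 / 2) *\<^sub>R (frechet_derivative \<phi> (at z) 1 *\<^sub>R u z
                    + \<i> * (frechet_derivative \<phi> (at z) \<i> *\<^sub>R u z))) = - (LINT z:unit_disk|lebesgue. \<phi> z *\<^sub>R g z)"
      by metis
  qed (use R in auto)
qed

text \<open>The factor is moved to the test function: \<open>\<phi> * s\<close> is again a test
  function, with d-bar derivative \<open>\<phi> * t + q * s\<close>, and the first summand yields
  the extra term of the product rule.\<close>

lemma weak_dbar_mult_C1:
  assumes u: "weak_dbar \<i> u g" and s: "wirtinger_C1 unit_disk s r t"
  shows "weak_dbar \<i> (\<lambda>z. s z * u z) (\<lambda>z. s z * g z + t z * u z)"
proof -
  have li: "locally_integrable u" "locally_integrable g" using u by (auto simp: weak_dbar_def)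
  have c: "continuous_on unit_disk s" "continuous_on unit_disk t"
    using s wirtinger_C1_continuous[OF s] by (auto simp: wirtinger_C1_def)
  have "locally_integrable (\<lambda>z. s z * g z + t z * u z)"
    by (intro locally_integrable_add locally_integrable_mult li c)
  moreover have "(LINT z:unit_disk|lebesgue. q z * (s z * u z))
     = - (LINT z:unit_disk|lebesgue. \<phi> z * (s z * g z + t z * u z))"
    if \<phi>: "complex_test \<phi> p q" for \<phi> p q
  proof -
    note m = complex_test_mult[OF \<phi> s]
    have "(LINT z:unit_disk|lebesgue. (\<phi> z * t z + q z * s z) * u z)
      = - (LINT z:unit_disk|lebesgue. (\<phi> z * s z) * g z)"
      using u m by (auto simp: weak_dbar_complex_iff)
    moreover note i = complex_test_integrable[OF locally_integrable_mult[OF li(1) c(1)] \<phi>]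
      complex_test_integrable[OF locally_integrable_mult[OF li(1) c(2)] \<phi>]
      complex_test_integrable[OF locally_integrable_mult[OF li(2) c(1)] \<phi>]
    have "(LINT z:unit_disk|lebesgue. (\<phi> z * t z + q z * s z) * u z)
      = (LINT z:unit_disk|lebesgue. \<phi> z * (t z * u z)) + (LINT z:unit_disk|lebesgue. q z * (s z * u z))"
      using i by (subst set_integral_add(2)[symmetric]) (auto simp: algebra_simps)
    moreover have "(LINT z:unit_disk|lebesgue. \<phi> z * (s z * g z + t z * u z))
      = (LINT z:unit_disk|lebesgue. (\<phi> z * s z) * g z) + (LINT z:unit_disk|lebesgue. \<phi> z * (t z * u z))"
      using i by (subst set_integral_add(2)[symmetric]) (auto simp: algebra_simps)
    ultimately show ?thesis by (simp add: algebra_simps eq_neg_iff_add_eq_0)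
  qed
  ultimately show ?thesis
    unfolding weak_dbar_complex_iff using locally_integrable_mult[OF li(1) c(1)] by blast
qed

lemma weak_dbar_add:
  assumes "weak_dbar \<i> u g" "weak_dbar \<i> v h"
  shows "weak_dbar \<i> (\<lambda>z. u z + v z) (\<lambda>z. g z + h z)"
proof -
  have li: "locally_integrable u" "locally_integrable g" "locally_integrable v" "locally_integrable h"
    using assms by (auto simp: weak_dbar_def)
  have "locally_integrable (\<lambda>z. u z + v z)" "locally_integrable (\<lambda>z. g z + h z)"
    by (intro locally_integrable_add li)+
  moreover have "(LINT z:unit_disk|lebesgue. q z * (u z + v z))
     = - (LINT z:unit_disk|lebesgue. \<phi> z * (g z + h z))"
    if \<phi>: "complex_test \<phi> p q" for \<phi> p q
  proof -
    note i = li[THEN complex_test_integrable(1), OF \<phi>] li[THEN complex_test_integrable(2), OF \<phi>]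
    have "(LINT z:unit_disk|lebesgue. q z * u z) = - (LINT z:unit_disk|lebesgue. \<phi> z * g z)"
      "(LINT z:unit_disk|lebesgue. q z * v z) = - (LINT z:unit_disk|lebesgue. \<phi> z * h z)"
      using assms \<phi> by (auto simp: weak_dbar_complex_iff)
    then show ?thesis unfolding ring_distribs using i by (subst (1 2) set_integral_add(2)) auto
  qed
  ultimately show ?thesis unfolding weak_dbar_complex_iff by blast
qed

text \<open>Lebesgue measure is complete, so the preimages of a Borel set under \<open>f\<close> and
  \<open>g\<close>, which differ by a null set, are measurable together.\<close>

lemma borel_measurable_lebesgue_cong_AE:
  fixes f g :: "'a::euclidean_space \<Rightarrow> 'b::topological_space"
  assumes f: "f \<in> borel_measurable lebesgue" and e: "AE z in lebesgue. f z = g z"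
  shows "g \<in> borel_measurable lebesgue"
proof (rule measurableI)
  fix S :: "'b set" assume S: "S \<in> sets borel"
  have "f -` S \<inter> space lebesgue \<in> sets lebesgue" using f S by (rule measurable_sets)
  moreover have "AE z in lebesgue. z \<in> f -` S \<inter> space lebesgue \<longleftrightarrow> z \<in> g -` S \<inter> space lebesgue"
    using e by eventually_elim auto
  ultimately show "g -` S \<inter> space lebesgue \<in> sets lebesgue"
    using completion.in_sets_AE[of "f -` S \<inter> space lebesgue" "g -` S \<inter> space lebesgue" lborel] by auto
qed auto

text \<open>By completeness \<open>f\<close> and \<open>g\<close> are measurable together; if they
  are not, both integrals have the default value \<open>0\<close>, so the equality holds in either
  case.\<close>

lemma integral_lebesgue_cong_AE:
  fixes f g :: "'a::euclidean_space \<Rightarrow> 'b::euclidean_space"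
  assumes "AE z in lebesgue. f z = g z"
  shows "integral\<^sup>L lebesgue f = integral\<^sup>L lebesgue g"
    "integrable lebesgue f \<Longrightarrow> integrable lebesgue g"
proof -
  have "AE z in lebesgue. g z = f z" using assms by eventually_elim simp
  then have *: "f \<in> borel_measurable lebesgue \<longleftrightarrow> g \<in> borel_measurable lebesgue"
    using borel_measurable_lebesgue_cong_AE[of f g] borel_measurable_lebesgue_cong_AE[of g f] assms
    by blast
  then show "integral\<^sup>L lebesgue f = integral\<^sup>L lebesgue g"
  proof (cases "f \<in> borel_measurable lebesgue")
    case True
    then show ?thesis using * assms by (intro integral_cong_AE) auto
  next
    case False
    then show ?thesis using * by (metis not_integrable_integral_eq borel_measurable_integrable)
  qed
  show "integrable lebesgue g" if "integrable lebesgue f"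
    using integrable_cong_AE_imp[OF that _ assms] * borel_measurable_integrable[OF that] by blast
qed

lemma locally_integrable_cong_AE:
  assumes u: "locally_integrable u" and e: "AE z in lebesgue. z \<in> unit_disk \<longrightarrow> u z = v z"
  shows "locally_integrable v"
  unfolding locally_integrable_def set_integrable_def
proof (intro allI impI)
  fix K :: "complex set" assume K: "compact K" "K \<subseteq> unit_disk"
  then have i: "integrable lebesgue (\<lambda>z. indicator K z *\<^sub>R u z)"
    using u by (auto simp: locally_integrable_def set_integrable_def)
  have ae: "AE z in lebesgue. indicator K z *\<^sub>R u z = indicator K z *\<^sub>R v z"
    using e by eventually_elim (use K in \<open>auto simp: indicator_def\<close>)
  show "integrable lebesgue (\<lambda>z. indicator K z *\<^sub>R v z)"
    using integral_lebesgue_cong_AE(2)[OF ae i] .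
qed

lemma set_integral_disk_cong_AE:
  fixes f h :: "complex \<Rightarrow> 'b::euclidean_space"
  assumes "AE z in lebesgue. z \<in> unit_disk \<longrightarrow> f z = h z"
  shows "(LINT z:unit_disk|lebesgue. f z) = (LINT z:unit_disk|lebesgue. h z)"
  unfolding set_lebesgue_integral_def
  by (rule integral_lebesgue_cong_AE(1)) (use assms in eventually_elim, auto simp: indicator_def)

lemma weak_dbar_cong_AE:
  fixes u g :: "complex \<Rightarrow> complex"
  assumes "weak_dbar \<i> u g"
    and u: "AE z in lebesgue. z \<in> unit_disk \<longrightarrow> u z = v z"
    and g: "AE z in lebesgue. z \<in> unit_disk \<longrightarrow> g z = h z"
  shows "weak_dbar \<i> v h"
proof -
  have "(LINT z:unit_disk|lebesgue. q z * u z) = (LINT z:unit_disk|lebesgue. q z * v z)" for q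
    by (rule set_integral_disk_cong_AE) (use u in eventually_elim, auto)
  moreover have "(LINT z:unit_disk|lebesgue. q z * g z) = (LINT z:unit_disk|lebesgue. q z * h z)" for q
    by (rule set_integral_disk_cong_AE) (use g in eventually_elim, auto)
  ultimately show ?thesis
    using assms locally_integrable_cong_AE[OF _ u] locally_integrable_cong_AE[OF _ g]
    by (auto simp: weak_dbar_complex_iff)
qed

section \<open>Convolutions and integration by parts\<close>

lemma integrable_mult_bounded:
  fixes a f :: "'a \<Rightarrow> complex"
  assumes "integrable M a" "f \<in> borel_measurable M" "\<And>x. norm (f x) \<le> B"
  shows "integrable M (\<lambda>x. a x * f x)"
proof (rule Bochner_Integration.integrable_bound)
  show "integrable M (\<lambda>x. B * norm (a x))" using assms by simp
  show "(\<lambda>x. a x * f x) \<in> borel_measurable M" using assms by measurable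
  show "AE x in M. norm (a x * f x) \<le> norm (B * norm (a x))"
  proof (rule AE_I2)
    fix x
    have "norm (f x) \<le> \<bar>B\<bar>" using assms(3)[of x] by linarith
    then show "norm (a x * f x) \<le> norm (B * norm (a x))"
      by (simp add: norm_mult abs_mult mult.commute[of "norm (a x)"] mult_right_mono)
  qed
qed

text \<open>Dominated convergence is applied to sequences, so differentiation under the integral is
  done along arbitrary null sequences of increments.\<close>

lemma has_derivative_sequentially:
  fixes f :: "'a::real_normed_vector \<Rightarrow> 'b::real_normed_vector"
  shows "(f has_derivative D) (at x) \<longleftrightarrow> bounded_linear D \<and>
    (\<forall>h. (\<forall>n. h n \<noteq> 0) \<longrightarrow> h \<longlonglongrightarrow> 0 \<longrightarrow>
      (\<lambda>n. norm (f (x + h n) - f x - D (h n)) / norm (h n)) \<longlonglongrightarrow> 0)"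
  unfolding has_derivative_at tendsto_at_iff_sequentially by (auto simp: o_def)

lemma bounded_linear_wirtinger: "bounded_linear (\<lambda>h. a * h + b * cnj h)"
  by (intro bounded_linear_add bounded_linear_mult_right
      bounded_linear_compose[OF bounded_linear_mult_right bounded_linear_cnj])

lemma borel_measurable_diff_lebesgue:
  fixes f :: "'a::euclidean_space \<Rightarrow> 'b::topological_space"
  assumes "f \<in> borel_measurable borel"
  shows "(\<lambda>\<zeta>. f (z - \<zeta>)) \<in> borel_measurable lebesgue"
proof -
  have "(\<lambda>\<zeta>. z - \<zeta>) \<in> borel_measurable borel" by simp
  then have "(\<lambda>\<zeta>. f (z - \<zeta>)) \<in> borel_measurable borel" using assms by (rule measurable_compose)
  then show ?thesis by (intro measurable_completion) simp
qed

text \<open>Differentiation under the integral by dominated convergence. The kernel may fail to be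
  differentiable on a set \<open>N\<close> as long as the reflected translates of \<open>N\<close>
  are null; this covers \<open>C\<^sup>1\<close> kernels, with \<open>N\<close> empty, as well as
  kernels with a kink along a circle.\<close>

lemma wirtinger_C1_convolution:
  fixes a k p q :: "complex \<Rightarrow> complex"
  assumes a: "integrable lebesgue a"
    and lip: "\<And>x y. norm (k x - k y) \<le> L * norm (x - y)"
    and bd: "\<And>x. norm (k x) \<le> B" "\<And>x. norm (p x) \<le> B" "\<And>x. norm (q x) \<le> B"
    and ms: "p \<in> borel_measurable borel" "q \<in> borel_measurable borel"
    and N: "\<And>z. AE \<zeta> in lebesgue. z - \<zeta> \<notin> N"
    and d: "\<And>x. x \<notin> N \<Longrightarrow> (k has_derivative (\<lambda>h. p x * h + q x * cnj h)) (at x)"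
    and c: "\<And>x. x \<notin> N \<Longrightarrow> isCont p x \<and> isCont q x"
  shows "wirtinger_C1 UNIV (\<lambda>z. LINT \<zeta>|lebesgue. a \<zeta> * k (z - \<zeta>))
    (\<lambda>z. LINT \<zeta>|lebesgue. a \<zeta> * p (z - \<zeta>)) (\<lambda>z. LINT \<zeta>|lebesgue. a \<zeta> * q (z - \<zeta>))"
proof -
  have "0 \<le> L" using lip[of 1 0] norm_ge_zero[of "k 1 - k 0"] by (simp del: norm_ge_zero)
  then have "L-lipschitz_on UNIV k"
    using lip by (auto simp: lipschitz_on_def dist_norm)
  then have kc: "continuous_on UNIV k" by (rule lipschitz_on_continuous_on)
  then have km: "k \<in> borel_measurable borel" by (rule borel_measurable_continuous_onI)
  note meas = borel_measurable_diff_lebesgue[OF km] borel_measurable_diff_lebesgue[OF ms(1)]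
    borel_measurable_diff_lebesgue[OF ms(2)]
  have am: "a \<in> borel_measurable lebesgue" using a by auto
  note int = integrable_mult_bounded[OF a meas(1) bd(1)] integrable_mult_bounded[OF a meas(2) bd(2)]
    integrable_mult_bounded[OF a meas(3) bd(3)]
  have cont: "continuous_on UNIV (\<lambda>z. LINT \<zeta>|lebesgue. a \<zeta> * f (z - \<zeta>))"
    if f: "\<And>x. norm (f x) \<le> B" "f \<in> borel_measurable borel" "\<And>x. x \<notin> N \<Longrightarrow> isCont f x" for f
    unfolding continuous_on_sequentially
  proof (intro allI ballI impI)
    fix x :: "nat \<Rightarrow> complex" and y assume "(\<forall>n. x n \<in> UNIV) \<and> x \<longlonglongrightarrow> y"
    then have x: "x \<longlonglongrightarrow> y" by simp
    show "((\<lambda>z. LINT \<zeta>|lebesgue. a \<zeta> * f (z - \<zeta>)) \<circ> x) \<longlonglongrightarrow> (LINT \<zeta>|lebesgue. a \<zeta> * f (y - \<zeta>))"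
      unfolding o_def
    proof (rule integral_dominated_convergence)
      show "integrable lebesgue (\<lambda>\<zeta>. B * norm (a \<zeta>))" using a by simp
      show "AE \<zeta> in lebesgue. (\<lambda>n. a \<zeta> * f (x n - \<zeta>)) \<longlonglongrightarrow> a \<zeta> * f (y - \<zeta>)"
        using N[of y]
      proof eventually_elim
        case (elim \<zeta>)
        then have "(\<lambda>n. f (x n - \<zeta>)) \<longlonglongrightarrow> f (y - \<zeta>)"
          by (intro isCont_tendsto_compose[of _ f] f(3) tendsto_intros x)
        then show ?case by (rule tendsto_mult_left)
      qed
      show "AE \<zeta> in lebesgue. norm (a \<zeta> * f (x n - \<zeta>)) \<le> B * norm (a \<zeta>)" for n
        using f(1) by (intro AE_I2) (simp add: norm_mult mult.commute[of "norm (a _)"] mult_right_mono)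
    qed (use borel_measurable_diff_lebesgue[OF f(2)] am in measurable)
  qed
  have "((\<lambda>z. LINT \<zeta>|lebesgue. a \<zeta> * k (z - \<zeta>)) has_derivative
      (\<lambda>h. (LINT \<zeta>|lebesgue. a \<zeta> * p (z - \<zeta>)) * h + (LINT \<zeta>|lebesgue. a \<zeta> * q (z - \<zeta>)) * cnj h)) (at z)" for z
    unfolding has_derivative_sequentially
  proof (intro conjI bounded_linear_wirtinger allI impI)
    fix h :: "nat \<Rightarrow> complex" assume h: "\<forall>n. h n \<noteq> 0" "h \<longlonglongrightarrow> 0"
    \<comment> \<open>The remainder of the linear approximation, divided by the length of the
      increment. The Lipschitz bound controls the increment of \<open>k\<close> and \<open>B\<close>
      each of the two derivative terms, so \<open>L + B + B\<close> bounds it uniformly in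
      \<open>n\<close>.\<close>
    let ?r = "\<lambda>n \<zeta>. (k (z + h n - \<zeta>) - k (z - \<zeta>) - (p (z - \<zeta>) * h n + q (z - \<zeta>) * cnj (h n))) / of_real (norm (h n))"
    have lim: "(\<lambda>n. LINT \<zeta>|lebesgue. a \<zeta> * ?r n \<zeta>) \<longlonglongrightarrow> integral\<^sup>L (lebesgue :: complex measure) (\<lambda>_. 0)"
    proof (rule integral_dominated_convergence[where f="\<lambda>_. 0" and s="\<lambda>n \<zeta>. a \<zeta> * ?r n \<zeta>"])
      show "integrable lebesgue (\<lambda>\<zeta>. (L + B + B) * norm (a \<zeta>))" using a by simp
      show "AE \<zeta> in lebesgue. (\<lambda>n. a \<zeta> * ?r n \<zeta>) \<longlonglongrightarrow> 0"
        using N[of z]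
      proof eventually_elim
        case (elim \<zeta>)
        have "(\<lambda>n. norm (k (z - \<zeta> + h n) - k (z - \<zeta>) - (p (z - \<zeta>) * h n + q (z - \<zeta>) * cnj (h n))) / norm (h n)) \<longlonglongrightarrow> 0"
          using d[OF elim] h unfolding has_derivative_sequentially by blast
        then have "(\<lambda>n. norm (?r n \<zeta>)) \<longlonglongrightarrow> 0"
          by (simp add: norm_divide algebra_simps)
        then have "(\<lambda>n. ?r n \<zeta>) \<longlonglongrightarrow> 0" by (rule tendsto_norm_zero_cancel)
        then show ?case by (rule tendsto_mult_right_zero)
      qed
      show "AE \<zeta> in lebesgue. norm (a \<zeta> * ?r n \<zeta>) \<le> (L + B + B) * norm (a \<zeta>)" for n
      proof (rule AE_I2)
        fix \<zeta>
        have "norm (k (z + h n - \<zeta>) - k (z - \<zeta>) - (p (z - \<zeta>) * h n + q (z - \<zeta>) * cnj (h n)))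
          \<le> norm (k (z + h n - \<zeta>) - k (z - \<zeta>)) + norm (p (z - \<zeta>) * h n) + norm (q (z - \<zeta>) * cnj (h n))"
          using norm_triangle_ineq4[of "k (z + h n - \<zeta>) - k (z - \<zeta>)" "p (z - \<zeta>) * h n + q (z - \<zeta>) * cnj (h n)"]
            norm_triangle_ineq[of "p (z - \<zeta>) * h n" "q (z - \<zeta>) * cnj (h n)"] by linarith
        also have "\<dots> \<le> L * norm (h n) + B * norm (h n) + B * norm (h n)"
          using lip[of "z + h n - \<zeta>" "z - \<zeta>"] bd(2,3)
          by (intro add_mono) (auto simp: norm_mult intro: mult_right_mono)
        finally have "norm (?r n \<zeta>) \<le> L + B + B"
          using h(1) by (simp add: norm_divide divide_le_eq algebra_simps)
        then show "norm (a \<zeta> * ?r n \<zeta>) \<le> (L + B + B) * norm (a \<zeta>)"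
          unfolding norm_mult by (simp add: mult.commute[of "norm (a \<zeta>)"] mult_right_mono)
      qed
    qed (use borel_measurable_diff_lebesgue[OF km] borel_measurable_diff_lebesgue[OF ms(1)]
        borel_measurable_diff_lebesgue[OF ms(2)] am in measurable)
    have eq: "(LINT \<zeta>|lebesgue. a \<zeta> * ?r n \<zeta>) =
       ((LINT \<zeta>|lebesgue. a \<zeta> * k (z + h n - \<zeta>)) - (LINT \<zeta>|lebesgue. a \<zeta> * k (z - \<zeta>))
       - ((LINT \<zeta>|lebesgue. a \<zeta> * p (z - \<zeta>)) * h n + (LINT \<zeta>|lebesgue. a \<zeta> * q (z - \<zeta>)) * cnj (h n)))
       / of_real (norm (h n))" (is "_ = ?R") for n
    proof -
      have "?R = (LINT \<zeta>|lebesgue. (a \<zeta> * k (z + h n - \<zeta>) - a \<zeta> * k (z - \<zeta>)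
          - (a \<zeta> * p (z - \<zeta>) * h n + a \<zeta> * q (z - \<zeta>) * cnj (h n))) / of_real (norm (h n)))"
        using int by simp
      also have "\<dots> = (LINT \<zeta>|lebesgue. a \<zeta> * ?r n \<zeta>)"
        by (simp add: algebra_simps)
      finally show ?thesis ..
    qed
    show "(\<lambda>n. norm ((LINT \<zeta>|lebesgue. a \<zeta> * k (z + h n - \<zeta>)) - (LINT \<zeta>|lebesgue. a \<zeta> * k (z - \<zeta>))
       - ((LINT \<zeta>|lebesgue. a \<zeta> * p (z - \<zeta>)) * h n + (LINT \<zeta>|lebesgue. a \<zeta> * q (z - \<zeta>)) * cnj (h n)))
       / norm (h n)) \<longlonglongrightarrow> 0"
      using tendsto_norm[OF lim[unfolded eq]] by (simp add: norm_divide)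
  qed
  then show ?thesis
    unfolding wirtinger_C1_def using cont[OF bd(2) ms(1)] cont[OF bd(3) ms(2)] c by blast
qed

text \<open>Each coefficient contributes at most \<open>B\<close> to the operator norm of the
  derivative, hence the factor 2.\<close>

lemma wirtinger_C1_lipschitz:
  assumes "wirtinger_C1 UNIV f p q" "\<And>x. norm (p x) \<le> B" "\<And>x. norm (q x) \<le> B"
  shows "norm (f x - f y) \<le> 2 * B * norm (x - y)"
proof (rule differentiable_bound[where S=UNIV])
  show "(f has_derivative (\<lambda>h. p z * h + q z * cnj h)) (at z within UNIV)" for z
    using assms(1) by (auto simp: wirtinger_C1_def)
  show "onorm (\<lambda>h. p z * h + q z * cnj h) \<le> 2 * B" for z
  proof (rule onorm_le)
    fix h
    have "norm (p z * h + q z * cnj h) \<le> norm (p z) * norm h + norm (q z) * norm h"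
      by (metis complex_mod_cnj norm_mult norm_triangle_ineq)
    also have "\<dots> \<le> B * norm h + B * norm h"
      using assms by (intro add_mono mult_right_mono) auto
    finally show "norm (p z * h + q z * cnj h) \<le> 2 * B * norm h" by simp
  qed
qed auto

lemma complex_test_bounded:
  assumes "complex_test \<phi> p q"
  obtains B where "\<And>x. norm (\<phi> x) \<le> B" "\<And>x. norm (p x) \<le> B" "\<And>x. norm (q x) \<le> B"
proof -
  obtain K where K: "compact K" "K \<subseteq> unit_disk" and
    z: "\<And>z. z \<notin> K \<Longrightarrow> \<phi> z = 0 \<and> p z = 0 \<and> q z = 0"
    using complex_test_supp[OF assms] by blast
  have *: "\<exists>B. \<forall>x. norm (f x) \<le> B" if fc: "continuous_on UNIV f" and f0: "\<And>z. z \<notin> K \<Longrightarrow> f z = 0" for f :: "complex \<Rightarrow> complex"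
  proof -
    obtain B where "B \<ge> 0" "\<And>z. z \<in> K \<Longrightarrow> norm (f z) \<le> B"
      using compact_continuous_bounded[OF K(1) continuous_on_subset[OF fc subset_UNIV]] by blast
    then have "norm (f z) \<le> B" for z using f0[of z] by (cases "z \<in> K") auto
    then show ?thesis by blast
  qed
  obtain B1 B2 B3 where "\<And>x. norm (\<phi> x) \<le> B1" "\<And>x. norm (p x) \<le> B2" "\<And>x. norm (q x) \<le> B3"
    using *[of \<phi>] *[of p] *[of q] z complex_test_continuous[OF assms] by blast
  then show ?thesis using that[of "max B1 (max B2 B3)"] by (meson max.coboundedI1 max.coboundedI2)
qed

section \<open>Indicators and reflections under Lebesgue measure\<close>

lemma integrable_indicator_complex:
  fixes S :: "'a::euclidean_space set"
  assumes "S \<in> lmeasurable"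
  shows "integrable lebesgue (indicator S :: 'a \<Rightarrow> complex)"
proof -
  have "integrable lebesgue (indicator S :: 'a \<Rightarrow> real)"
    using assms by (auto simp: fmeasurable_def intro!: integrable_real_indicator)
  from integrable_of_real[OF this, where 'a=complex] show ?thesis
    by (rule back_subst[of "integrable lebesgue"]) (auto simp: indicator_def)
qed

lemma lborel_distr_reflect: "distr lborel borel (\<lambda>x. c - x) = (lborel :: 'a::euclidean_space measure)"
  using lborel_affine[of "-1" c] by (simp add: density_1)

lemma lebesgue_reflect:
  fixes f :: "'a::euclidean_space \<Rightarrow> 'b::euclidean_space"
  assumes f: "f \<in> borel_measurable borel"
  shows "(LINT \<zeta>|lebesgue. f (c - \<zeta>)) = (LINT \<zeta>|lebesgue. f \<zeta>)"
    "integrable lebesgue f \<Longrightarrow> integrable lebesgue (\<lambda>\<zeta>. f (c - \<zeta>))"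
proof -
  have m: "(\<lambda>\<zeta>. f (c - \<zeta>)) \<in> borel_measurable borel"
    using f by measurable
  have "(LINT \<zeta>|lborel. f \<zeta>) = (LINT \<zeta>|distr lborel borel (\<lambda>x. c - x). f \<zeta>)"
    by (simp add: lborel_distr_reflect)
  also have "\<dots> = (LINT \<zeta>|lborel. f (c - \<zeta>))"
    using f by (intro integral_distr) auto
  finally show "(LINT \<zeta>|lebesgue. f (c - \<zeta>)) = (LINT \<zeta>|lebesgue. f \<zeta>)"
    using f m by (simp add: integral_completion)
  assume "integrable lebesgue f"
  then have "integrable (distr lborel borel (\<lambda>x. c - x)) f"
    using f by (simp add: lborel_distr_reflect integrable_completion)
  then have "integrable lborel (\<lambda>\<zeta>. f (c - \<zeta>))"
    using f by (subst (asm) integrable_distr_eq) auto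
  then show "integrable lebesgue (\<lambda>\<zeta>. f (c - \<zeta>))"
    using m by (simp add: integrable_completion)
qed

text \<open>Integration by parts for test functions, by translation invariance: the convolution of a
  test function with the indicator of a large disk is constant near the origin.\<close>

lemma weak_dbar_const: "weak_dbar \<i> (\<lambda>_. 1) (\<lambda>_. 0)"
proof -
  have "(LINT z:unit_disk|lebesgue. q z) = 0" if \<phi>: "complex_test \<phi> p q" for \<phi> p q
  proof -
    obtain K where K: "compact K" "K \<subseteq> unit_disk" and
      z: "\<And>z. z \<notin> K \<Longrightarrow> \<phi> z = 0 \<and> p z = 0 \<and> q z = 0"
      using complex_test_supp[OF \<phi>] by blast
    obtain B where B: "\<And>x. norm (\<phi> x) \<le> B" "\<And>x. norm (p x) \<le> B" "\<And>x. norm (q x) \<le> B"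
      using complex_test_bounded[OF \<phi>] by blast
    have W: "wirtinger_C1 UNIV \<phi> p q" using \<phi> by (auto simp: complex_test_def)
    note c = complex_test_continuous[OF \<phi>]
    \<comment> \<open>For \<open>x\<close> and \<open>x - \<zeta>\<close> in the unit disk,
      \<open>\<zeta>\<close> has norm below 2; near the origin the indicator can therefore be
      dropped from the convolution with \<open>\<phi>\<close>.\<close>
    define a :: "complex \<Rightarrow> complex" where "a = indicator (ball 0 2)"
    have a: "integrable lebesgue a"
      unfolding a_def by (rule integrable_indicator_complex) auto
    have "wirtinger_C1 UNIV (\<lambda>z. LINT \<zeta>|lebesgue. a \<zeta> * \<phi> (z - \<zeta>))
      (\<lambda>z. LINT \<zeta>|lebesgue. a \<zeta> * p (z - \<zeta>)) (\<lambda>z. LINT \<zeta>|lebesgue. a \<zeta> * q (z - \<zeta>))"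
    proof (rule wirtinger_C1_convolution[where N="{}" and L="2 * B" and B=B, OF a wirtinger_C1_lipschitz[OF W B(2,3)] B])
      show "isCont p x \<and> isCont q x" for x
        using c continuous_on_eq_continuous_at[OF open_UNIV] by blast
    qed (use W c in \<open>auto simp: wirtinger_C1_def intro: borel_measurable_continuous_onI\<close>)
    then have D: "((\<lambda>z. LINT \<zeta>|lebesgue. a \<zeta> * \<phi> (z - \<zeta>)) has_derivative
      (\<lambda>h. (LINT \<zeta>|lebesgue. a \<zeta> * p (0 - \<zeta>)) * h + (LINT \<zeta>|lebesgue. a \<zeta> * q (0 - \<zeta>)) * cnj h)) (at 0)"
      unfolding wirtinger_C1_def by blast
    have "((\<lambda>z. LINT \<zeta>|lebesgue. \<phi> \<zeta>) has_derivative
      (\<lambda>h. (LINT \<zeta>|lebesgue. a \<zeta> * p (0 - \<zeta>)) * h + (LINT \<zeta>|lebesgue. a \<zeta> * q (0 - \<zeta>)) * cnj h)) (at 0)"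
    proof (rule has_derivative_transform_within_open[OF D, of "ball 0 1"])
      fix x :: complex assume x: "x \<in> ball 0 1"
      have "a \<zeta> * \<phi> (x - \<zeta>) = \<phi> (x - \<zeta>)" for \<zeta>
      proof (cases "\<zeta> \<in> ball 0 2")
        case False
        have "norm \<zeta> \<le> norm x + norm (x - \<zeta>)" by (metis norm_minus_commute norm_triangle_sub)
        then have "x - \<zeta> \<notin> K" using False x K by auto
        then show ?thesis using z by simp
      qed (auto simp: a_def)
      then show "(LINT \<zeta>|lebesgue. a \<zeta> * \<phi> (x - \<zeta>)) = (LINT \<zeta>|lebesgue. \<phi> \<zeta>)"
        using lebesgue_reflect(1)[OF borel_measurable_continuous_onI[OF c(1)], of x] by presburger
    qed auto
    from has_derivative_unique[OF this has_derivative_const]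
    have "((\<lambda>_. 0) has_derivative
      (\<lambda>h. (LINT \<zeta>|lebesgue. a \<zeta> * p (0 - \<zeta>)) * h + (LINT \<zeta>|lebesgue. a \<zeta> * q (0 - \<zeta>)) * cnj h)) (at (0::complex))"
      using has_derivative_const by metis
    from wirtinger_zero_derivative(2)[OF this] have "(LINT \<zeta>|lebesgue. a \<zeta> * q (0 - \<zeta>)) = 0" .
    moreover have "(\<lambda>\<zeta>. a \<zeta> * q (0 - \<zeta>)) = (\<lambda>\<zeta>. indicator unit_disk (0 - \<zeta>) *\<^sub>R q (0 - \<zeta>))"
    proof
      fix \<zeta> show "a \<zeta> * q (0 - \<zeta>) = indicator unit_disk (0 - \<zeta>) *\<^sub>R q (0 - \<zeta>)"
        using z[of "- \<zeta>"] K by (cases "- \<zeta> \<in> K") (auto simp: a_def indicator_def)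
    qed
    moreover have m: "(\<lambda>\<zeta>. indicator unit_disk \<zeta> *\<^sub>R q \<zeta>) \<in> borel_measurable borel"
      using borel_measurable_continuous_on_indicator[OF _ continuous_on_subset[OF c(3)], of unit_disk] by simp
    ultimately have "(LINT \<zeta>|lebesgue. indicator unit_disk \<zeta> *\<^sub>R q \<zeta>) = 0"
      using lebesgue_reflect(1)[OF m, of 0] by simp
    then show ?thesis by (simp add: set_lebesgue_integral_def)
  qed
  moreover have "locally_integrable (\<lambda>_. 1::complex)" "locally_integrable (\<lambda>_. 0::complex)"
    using integrable_of_real[OF integrable_real_indicator, where 'a=complex]
    by (auto simp: locally_integrable_def set_integrable_def scaleR_conv_of_real
        dest!: lmeasurable_compact simp: fmeasurable_def)
  ultimately show ?thesis unfolding weak_dbar_complex_iff by simp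
qed

lemma weak_dbar_C1:
  assumes "wirtinger_C1 unit_disk s r t"
  shows "weak_dbar \<i> s t"
  using weak_dbar_mult_C1[OF weak_dbar_const assms] by simp

section \<open>Estimates for the Cauchy kernel\<close>

text \<open>Absolute continuity of the integral. The excess of \<open>norm (f x)\<close> over a
  level \<open>n\<close> has integral below \<open>e / 2\<close>, and the truncated part contributes
  at most \<open>n\<close> times the measure of the set.\<close>

lemma integral_small_on_small_sets:
  fixes f :: "'a \<Rightarrow> 'b::{banach, second_countable_topology}"
  assumes f: "integrable M f" and e: "e > 0"
  obtains d where "d > 0"
    "\<And>A. A \<in> sets M \<Longrightarrow> emeasure M A < ennreal d \<Longrightarrow> (LINT x|M. indicator A x * norm (f x)) < e"
proof -
  have nf: "integrable M (\<lambda>x. norm (f x))" using f by simp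
  have "(\<lambda>n. LINT x|M. norm (f x) - min (norm (f x)) (real n)) \<longlonglongrightarrow> (LINT x|M. 0)"
  proof (rule integral_dominated_convergence[where w="\<lambda>x. norm (f x)"])
    show "AE x in M. (\<lambda>n. norm (f x) - min (norm (f x)) (real n)) \<longlonglongrightarrow> 0"
    proof (rule AE_I2)
      fix x
      obtain N where N: "norm (f x) \<le> real N" using real_arch_simple by blast
      have "eventually (\<lambda>n. norm (f x) - min (norm (f x)) (real n) = 0) sequentially"
        using eventually_ge_at_top[of N] by eventually_elim (use N in auto)
      then show "(\<lambda>n. norm (f x) - min (norm (f x)) (real n)) \<longlonglongrightarrow> 0"
        by (rule tendsto_eventually)
    qed
    show "AE x in M. norm (norm (f x) - min (norm (f x)) (real n)) \<le> norm (f x)" for n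
      by (rule AE_I2) (auto simp: min_def)
  qed (use f in auto)
  then have "eventually (\<lambda>n. (LINT x|M. norm (f x) - min (norm (f x)) (real n)) < e / 2) sequentially"
    using e by (intro order_tendstoD(2)) auto
  then obtain n where n: "(LINT x|M. norm (f x) - min (norm (f x)) (real n)) < e / 2"
    by (auto simp: eventually_sequentially)
  \<comment> \<open>\<open>Suc n\<close> keeps the quotient meaningful when the truncation level
    \<open>n\<close> is \<open>0\<close>.\<close>
  define d where "d = e / (2 * real (Suc n))"
  have "d > 0" using e by (simp add: d_def)
  moreover have "(LINT x|M. indicator A x * norm (f x)) < e"
    if A: "A \<in> sets M" "emeasure M A < ennreal d" for A
  proof -
    have mA: "measure M A < d"
      using A \<open>d > 0\<close> by (metis emeasure_eq_ennreal_measure ennreal_less_iff infinity_ennreal_def measure_nonneg less_top order.strict_trans ennreal_less_top top.not_eq_extremum)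
    have iA: "integrable M (indicator A :: 'a \<Rightarrow> real)"
      using A by (intro integrable_real_indicator) (auto simp: less_top[symmetric] dest: less_trans[OF _ ennreal_less_top])
    have i1: "integrable M (\<lambda>x. norm (f x) - min (norm (f x)) (real n))"
      by (rule Bochner_Integration.integrable_bound[OF nf]) (use f in \<open>auto simp: min_def\<close>)
    have "(LINT x|M. indicator A x * norm (f x))
      \<le> (LINT x|M. (norm (f x) - min (norm (f x)) (real n)) + real n * indicator A x)"
    proof (rule integral_mono)
      show "integrable M (\<lambda>x. indicator A x * norm (f x))"
        using integrable_mult_indicator[OF A(1) nf] by simp
      show "integrable M (\<lambda>x. (norm (f x) - min (norm (f x)) (real n)) + real n * indicator A x)"
        using i1 iA by auto
    qed (auto simp: indicator_def min_def)
    also have "\<dots> = (LINT x|M. norm (f x) - min (norm (f x)) (real n)) + real n * measure M A"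
      using i1 iA A by (subst Bochner_Integration.integral_add) auto
    also have "\<dots> < e / 2 + e / 2"
    proof (rule add_less_le_mono[OF n])
      have "real n * measure M A \<le> real (Suc n) * d"
        using mA \<open>d > 0\<close> by (intro mult_mono) auto
      moreover have "real (Suc n) * d = e / 2" unfolding d_def by (simp del: of_nat_Suc)
      ultimately show "real n * measure M A \<le> e / 2" by simp
    qed
    finally show ?thesis by simp
  qed
  ultimately show ?thesis using that by blast
qed

section \<open>Powers of the norm in the plane\<close>

lemma emeasure_lebesgue_ball_complex:
  "r \<ge> 0 \<Longrightarrow> emeasure lebesgue (ball (c::complex) r) = ennreal (pi * r\<^sup>2)"
  using emeasure_ball[of r c] by (simp add: unit_ball_vol_2)

lemma dyadic_scale:
  fixes x :: real
  assumes "0 < x" "x < 1"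
  obtains k where "(1 / 2) ^ Suc k \<le> x" "x < (1 / 2) ^ k"
proof -
  obtain n where "(1 / 2) ^ n < x" using real_arch_pow_inv[of x "1/2"] assms by auto
  then have ex: "\<exists>n. (1 / 2) ^ n \<le> x" by (auto intro: less_imp_le)
  define m where "m = (LEAST n. (1 / 2) ^ n \<le> x)"
  have m: "(1 / 2) ^ m \<le> x" unfolding m_def by (rule LeastI_ex[OF ex])
  then have "m \<noteq> 0" using assms by (cases m) auto
  then obtain k where k: "m = Suc k" using not0_implies_Suc by blast
  have "\<not> (1 / 2) ^ k \<le> x" using not_less_Least[of k "\<lambda>n. (1 / 2) ^ n \<le> x"] k by (simp add: m_def)
  then show ?thesis using that m k by auto
qed

text \<open>On the annulus with radii \<open>(1/2) ^ Suc k\<close> and \<open>(1/2) ^ k\<close> the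
  function is at most \<open>2 powr (real (Suc k) * s)\<close>, and the disk around it has area
  \<open>pi * ((1/2) ^ k)\<^sup>2\<close>. The resulting series is geometric with ratio
  \<open>2 powr (s - 2) < 1\<close>.\<close>

lemma integrable_norm_powr:
  assumes s: "0 < s" "s < 2"
  shows "integrable lebesgue (\<lambda>w::complex. indicator (ball 0 1) w * norm w powr (- s))"
proof (rule integrableI_nonneg)
  let ?f = "\<lambda>w::complex. indicator (ball 0 1) w * norm w powr (- s)"
  have le_suminf: "f k \<le> suminf f" for f :: "nat \<Rightarrow> ennreal" and k
    using sum_le_suminf[OF summableI, of "{k}" f] by simp
  have "(\<lambda>w::complex. indicator (ball 0 1) w * norm w powr (- s)) \<in> borel_measurable borel"
    by (intro borel_measurable_times borel_measurable_indicator powr_real_measurable) auto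
  then show "?f \<in> borel_measurable lebesgue" by (intro measurable_completion) simp
  let ?c = "\<lambda>k::nat. 2 powr (real (Suc k) * s)"
  have "ennreal (?f w) \<le> (\<Sum>k. ennreal (?c k) * indicator (ball 0 ((1/2)^k)) w)" for w :: complex
  proof (cases "0 < norm w \<and> norm w < 1")
    case True
    then obtain k where k: "(1 / 2) ^ Suc k \<le> norm w" "norm w < (1 / 2) ^ k"
      using dyadic_scale by blast
    have "norm w powr (- s) \<le> ((1 / 2) ^ Suc k) powr (- s)"
      using s k True by (intro powr_mono2') auto
    also have "((1 / 2 :: real) ^ Suc k) = 2 powr (- real (Suc k))"
      by (subst powr_minus, subst powr_realpow) (simp_all add: power_one_over inverse_eq_divide)
    also have "(2 powr (- real (Suc k))) powr (- s) = ?c k"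
      unfolding powr_powr by (simp add: algebra_simps)
    finally have "ennreal (?f w) \<le> ennreal (?c k) * indicator (ball 0 ((1/2)^k)) w"
      using k True by (simp add: ennreal_leI)
    also have "\<dots> \<le> (\<Sum>k. ennreal (?c k) * indicator (ball 0 ((1/2)^k)) w)"
      by (rule le_suminf)
    finally show ?thesis .
  next
    case False
    \<comment> \<open>The origin belongs to this case as well, since
      \<open>0 powr _ = 0\<close>.\<close>
    then have "?f w = 0" by (auto simp: indicator_def)
    then show ?thesis by (simp only: ennreal_0 zero_le)
  qed
  then have "(\<integral>\<^sup>+ w. ennreal (?f w) \<partial>lebesgue)
    \<le> (\<integral>\<^sup>+ w. (\<Sum>k. ennreal (?c k) * indicator (ball (0::complex) ((1/2)^k)) w) \<partial>lebesgue)"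
    by (intro nn_integral_mono)
  also have "\<dots> = (\<Sum>k. ennreal (?c k) * ennreal (pi * ((1/2)^k)\<^sup>2))"
  proof -
    have b: "ball 0 ((1/2)^k) \<in> sets (lebesgue :: complex measure)" for k :: nat by simp
    have "(\<integral>\<^sup>+ w. (\<Sum>k. ennreal (?c k) * indicator (ball (0::complex) ((1/2)^k)) w) \<partial>lebesgue)
      = (\<Sum>k. \<integral>\<^sup>+ w. ennreal (?c k) * indicator (ball (0::complex) ((1/2)^k)) w \<partial>lebesgue)"
      by (rule nn_integral_suminf)
        (intro borel_measurable_times_ennreal borel_measurable_const borel_measurable_indicator b)
    also have "\<dots> = (\<Sum>k. ennreal (?c k) * ennreal (pi * ((1/2)^k)\<^sup>2))"
      using emeasure_lebesgue_ball_complex[of "(1/2)^k" for k]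
      by (intro suminf_cong) (simp only: nn_integral_cmult_indicator[OF b] zero_le_power zero_le_divide_1_iff zero_le_numeral)
    finally show ?thesis .
  qed
  also have "\<dots> = (\<Sum>k. ennreal (pi * 2 powr s * (2 powr (s - 2)) ^ k))"
  proof (rule suminf_cong)
    fix k
    have "?c k * (pi * ((1/2)^k)\<^sup>2) = pi * 2 powr s * (2 powr (s - 2)) ^ k"
    proof -
      have "((1/2::real)^k)\<^sup>2 = 2 powr (- 2 * real k)"
        by (simp add: powr_minus powr_realpow[symmetric] power_one_over inverse_eq_divide power2_eq_square powr_add[symmetric])
      moreover have "(2 powr (s - 2)) ^ k = 2 powr ((s - 2) * real k)"
        by (simp add: powr_powr powr_realpow[symmetric])
      moreover have "?c k = 2 powr s * 2 powr (s * real k)"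
        by (simp add: powr_add[symmetric] algebra_simps)
      ultimately show ?thesis
        by (simp add: powr_add[symmetric] algebra_simps powr_diff)
    qed
    then show "ennreal (?c k) * ennreal (pi * ((1/2)^k)\<^sup>2) = ennreal (pi * 2 powr s * (2 powr (s - 2)) ^ k)"
      by (subst ennreal_mult[symmetric]) auto
  qed
  also have "\<dots> < \<infinity>"
  proof -
    have "2 powr (s - 2) < 2 powr (0::real)" using s by (intro powr_less_mono) auto
    then have "summable (\<lambda>k. pi * 2 powr s * (2 powr (s - 2)) ^ k)"
      by (intro summable_mult summable_geometric) auto
    then show ?thesis
      using ennreal_suminf_neq_top by (simp add: less_top)
  qed
  finally show "(\<integral>\<^sup>+ w. ennreal (?f w) \<partial>lebesgue) < \<infinity>" .
qed (auto intro!: AE_I2)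

text \<open>A pointwise substitute for Hoelder's inequality. With \<open>b = 1 / (q - 1)\<close>,
  either \<open>x \<le> r powr (- b)\<close>, which gives the first term, or
  \<open>1 / r \<le> x powr (q - 1)\<close>, which gives the second. The exponent
  \<open>1 + b\<close> is the one conjugate to \<open>q\<close>.\<close>

lemma divide_le_powr_sum:
  fixes x r q :: real
  assumes q: "q > 2" and "x \<ge> 0" "r \<ge> 0"
  shows "x / r \<le> r powr (- (1 + 1 / (q - 1))) + x powr q"
proof (cases "r = 0")
  case False
  then have r: "r > 0" using assms by simp
  let ?b = "1 / (q - 1)"
  show ?thesis
  proof (cases "x \<le> r powr (- ?b)")
    case True
    then have "x / r \<le> r powr (- ?b) / r" using r by (intro divide_right_mono) auto
    also have "\<dots> = r powr (- (1 + ?b))"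
      using r by (simp add: powr_diff powr_minus field_simps powr_add)
    finally show ?thesis by (simp add: add_increasing2)
  next
    case False
    then have x: "x > 0" using r by (meson less_le_trans not_le powr_ge_zero order.trans linorder_not_less)
    have "(r powr (- ?b)) powr (q - 1) \<le> x powr (q - 1)"
      using False q by (intro powr_mono2) auto
    moreover have "(r powr (- ?b)) powr (q - 1) = 1 / r"
    proof -
      have "(r powr (- ?b)) powr (q - 1) = r powr (-1)" using q by (simp add: powr_powr)
      then show ?thesis using r by (simp add: powr_minus_divide)
    qed
    ultimately have "1 / r \<le> x powr (q - 1)" by simp
    then have "x * (1 / r) \<le> x * x powr (q - 1)" using x by (intro mult_left_mono) auto
    also have "\<dots> = x powr q" using x by (simp add: powr_diff)
    finally show ?thesis by (simp add: add_increasing)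
  qed
qed auto

text \<open>For \<open>\<zeta>\<close> near \<open>z\<close> the integrand is bounded by
  \<open>h (z - \<zeta>) + norm (a \<zeta>) powr q\<close>. Over small disks the first term has an
  integral independent of \<open>z\<close>, by reflection, and the second is small by absolute
  continuity; so the smallness is uniform in \<open>z\<close>.\<close>

lemma cauchy_kernel_integrable_small:
  fixes a :: "complex \<Rightarrow> complex"
  assumes a: "integrable lebesgue a" and aq: "integrable lebesgue (\<lambda>z. norm (a z) powr q)" and q: "q > 2"
  shows "integrable lebesgue (\<lambda>\<zeta>. a \<zeta> / (z - \<zeta>))"
    and "e > 0 \<Longrightarrow> \<exists>d. 0 < d \<and> d < e \<and>
      (\<forall>z. (LINT \<zeta>|lebesgue. indicator (ball z d) \<zeta> * norm (a \<zeta> / (z - \<zeta>))) < e)"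
proof -
  let ?s = "1 + 1 / (q - 1)"
  define h where "h = (\<lambda>w::complex. indicator (ball 0 1) w * norm w powr (- ?s) :: real)"
  have s: "0 < ?s" "?s < 2" using q by (auto simp: field_simps)
  have hi: "integrable lebesgue h" unfolding h_def by (rule integrable_norm_powr[OF s])
  have hb: "h \<in> borel_measurable borel" unfolding h_def
    by (intro borel_measurable_times borel_measurable_indicator powr_real_measurable) auto
  have hzi: "integrable lebesgue (\<lambda>\<zeta>. h (z - \<zeta>))" for z using lebesgue_reflect(2)[OF hb hi] .
  have near: "norm (a \<zeta> / (z - \<zeta>)) \<le> h (z - \<zeta>) + norm (a \<zeta>) powr q" if "dist z \<zeta> < 1" for z \<zeta>
    using divide_le_powr_sum[OF q, of "norm (a \<zeta>)" "norm (z - \<zeta>)"] that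
    by (simp add: h_def norm_divide dist_norm indicator_def)
  have m: "(\<lambda>\<zeta>. a \<zeta> / (z - \<zeta>)) \<in> borel_measurable lebesgue" for z
  proof -
    have "(\<lambda>w::complex. 1 / w) \<in> borel_measurable borel" by measurable
    from borel_measurable_diff_lebesgue[OF this, of z]
    have "(\<lambda>\<zeta>. a \<zeta> * (1 / (z - \<zeta>))) \<in> borel_measurable lebesgue"
      using borel_measurable_integrable[OF a] by measurable
    then show ?thesis by simp
  qed
  show int: "integrable lebesgue (\<lambda>\<zeta>. a \<zeta> / (z - \<zeta>))" for z
  proof (rule Bochner_Integration.integrable_bound)
    show "integrable lebesgue (\<lambda>\<zeta>. h (z - \<zeta>) + norm (a \<zeta>) powr q + norm (a \<zeta>))"
      using hzi aq a by auto
    show "AE \<zeta> in lebesgue. norm (a \<zeta> / (z - \<zeta>)) \<le> norm (h (z - \<zeta>) + norm (a \<zeta>) powr q + norm (a \<zeta>))"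
    proof (rule AE_I2)
      fix \<zeta>
      have h0: "h (z - \<zeta>) \<ge> 0" by (simp add: h_def)
      show "norm (a \<zeta> / (z - \<zeta>)) \<le> norm (h (z - \<zeta>) + norm (a \<zeta>) powr q + norm (a \<zeta>))"
      proof (cases "dist z \<zeta> < 1")
        case True
        then show ?thesis using near[OF True] h0 by (simp add: add_increasing2)
      next
        case False
        then have "norm (a \<zeta> / (z - \<zeta>)) \<le> norm (a \<zeta>)"
          by (simp add: norm_divide dist_norm divide_le_eq mult_left_le[of _ "norm (a \<zeta>)"] mult_le_cancel_left1)
        then show ?thesis using h0 by (smt (verit) powr_ge_zero real_norm_def)
      qed
    qed
  qed (rule m)
  show "\<exists>d. 0 < d \<and> d < e \<and> (\<forall>z. (LINT \<zeta>|lebesgue. indicator (ball z d) \<zeta> * norm (a \<zeta> / (z - \<zeta>))) < e)"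
    if e: "e > 0"
  proof -
    have "e / 2 > 0" using e by simp
    obtain d1 where d1: "d1 > 0" "\<And>A. A \<in> sets lebesgue \<Longrightarrow> emeasure lebesgue A < ennreal d1 \<Longrightarrow>
        (LINT x|lebesgue. indicator A x * norm (h x)) < e / 2"
      using integral_small_on_small_sets[OF hi \<open>e / 2 > 0\<close>] by blast
    obtain d2 where d2: "d2 > 0" "\<And>A. A \<in> sets lebesgue \<Longrightarrow> emeasure lebesgue A < ennreal d2 \<Longrightarrow>
        (LINT x|lebesgue. indicator A x * norm (norm (a x) powr q)) < e / 2"
      using integral_small_on_small_sets[OF aq \<open>e / 2 > 0\<close>] by blast
    have "(\<lambda>n. pi * (inverse (real (Suc n)))\<^sup>2) \<longlonglongrightarrow> pi * 0\<^sup>2"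
      by (intro tendsto_intros LIMSEQ_inverse_real_of_nat)
    then have "eventually (\<lambda>n. pi * (inverse (real (Suc n)))\<^sup>2 < min d1 d2) sequentially"
      using d1 d2 by (intro order_tendstoD(2)) auto
    moreover have "eventually (\<lambda>n. inverse (real (Suc n)) < min e 1) sequentially"
      using e by (intro order_tendstoD(2)[OF LIMSEQ_inverse_real_of_nat]) auto
    ultimately obtain n where n: "pi * (inverse (real (Suc n)))\<^sup>2 < min d1 d2" "inverse (real (Suc n)) < min e 1"
      using eventually_happens'[OF sequentially_bot eventually_conj] by blast
    define d where "d = inverse (real (Suc n))"
    have d: "0 < d" "d < e" "d < 1" "pi * d\<^sup>2 < d1" "pi * d\<^sup>2 < d2" using n by (auto simp: d_def)
    have em: "emeasure lebesgue (ball (z::complex) d) < ennreal d1" "emeasure lebesgue (ball z d) < ennreal d2" for z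
      using d d1(1) d2(1) emeasure_lebesgue_ball_complex[of d] by (simp_all del: emeasure_completion add: ennreal_lessI)
    have "(LINT \<zeta>|lebesgue. indicator (ball z d) \<zeta> * norm (a \<zeta> / (z - \<zeta>))) < e" for z
    proof -
      have hb2: "(\<lambda>w. indicator (ball 0 d) w * h w) \<in> borel_measurable borel"
        using hb by (intro borel_measurable_times borel_measurable_indicator) auto
      have hi2: "integrable lebesgue (\<lambda>w. indicator (ball 0 d) w * h w)"
        using integrable_mult_indicator[OF _ hi, of "ball 0 d"] by simp
      have eq: "indicator (ball 0 d) (z - \<zeta>) = (indicator (ball z d) \<zeta> :: real)" for \<zeta>
        by (auto simp: indicator_def dist_complex_def norm_minus_commute)
      have i1: "integrable lebesgue (\<lambda>\<zeta>. indicator (ball z d) \<zeta> * h (z - \<zeta>))"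
        using lebesgue_reflect(2)[OF hb2 hi2, of z] by (simp add: eq)
      have i2: "integrable lebesgue (\<lambda>\<zeta>. indicator (ball z d) \<zeta> * norm (a \<zeta>) powr q)"
        using integrable_mult_indicator[OF _ aq, of "ball z d"] by simp
      have "(LINT \<zeta>|lebesgue. indicator (ball z d) \<zeta> * norm (a \<zeta> / (z - \<zeta>)))
        \<le> (LINT \<zeta>|lebesgue. indicator (ball z d) \<zeta> * h (z - \<zeta>) + indicator (ball z d) \<zeta> * norm (a \<zeta>) powr q)"
      proof (rule integral_mono)
        show "integrable lebesgue (\<lambda>\<zeta>. indicator (ball z d) \<zeta> * norm (a \<zeta> / (z - \<zeta>)))"
          using integrable_mult_indicator[OF _ integrable_norm[OF int], of "ball z d"] by simp
        show "integrable lebesgue (\<lambda>\<zeta>. indicator (ball z d) \<zeta> * h (z - \<zeta>) + indicator (ball z d) \<zeta> * norm (a \<zeta>) powr q)"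
          using i1 i2 by auto
        show "indicator (ball z d) \<zeta> * norm (a \<zeta> / (z - \<zeta>))
          \<le> indicator (ball z d) \<zeta> * h (z - \<zeta>) + indicator (ball z d) \<zeta> * norm (a \<zeta>) powr q" for \<zeta>
          using near[of z \<zeta>] d by (simp add: indicator_def)
      qed
      also have "\<dots> = (LINT \<zeta>|lebesgue. indicator (ball z d) \<zeta> * h (z - \<zeta>))
          + (LINT \<zeta>|lebesgue. indicator (ball z d) \<zeta> * norm (a \<zeta>) powr q)"
        using i1 i2 by (rule Bochner_Integration.integral_add)
      also have "(LINT \<zeta>|lebesgue. indicator (ball z d) \<zeta> * h (z - \<zeta>))
          = (LINT w|lebesgue. indicator (ball 0 d) w * h w)"
        using lebesgue_reflect(1)[OF hb2, of z] by (simp add: eq)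
      also have "\<dots> < e / 2" using d1(2)[OF _ em(1), of 0] by (simp add: h_def)
      also have "(LINT \<zeta>|lebesgue. indicator (ball z d) \<zeta> * norm (a \<zeta>) powr q) < e / 2"
        using d2(2)[OF _ em(2), of z] by simp
      finally show ?thesis by simp
    qed
    then show ?thesis using d by blast
  qed
qed

text \<open>Since \<open>1 / w = cnj w / (norm w)\<^sup>2\<close>, replacing \<open>norm w\<close>
  by \<open>max (norm w) d\<close> removes the singularity and leaves the kernel unchanged outside
  the disk of radius \<open>d\<close>. Inside, it is real-linear with constant d-bar derivative
  \<open>1 / d\<^sup>2\<close>, so that the d-bar derivative approximates \<open>pi\<close> times a
  point mass.\<close>

definition reg_kernel :: "real \<Rightarrow> complex \<Rightarrow> complex"
  where "reg_kernel d w = (if norm w < d then cnj w / of_real (d\<^sup>2) else 1 / w)"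

lemma reg_kernel_eq: "d > 0 \<Longrightarrow> reg_kernel d w = cnj w / of_real ((max (norm w) d)\<^sup>2)"
  by (cases "norm w < d") (auto simp: reg_kernel_def complex_div_cnj[of 1] max_def not_less)

text \<open>Write the kernel as \<open>cnj z / M\<^sup>2\<close> with
  \<open>M = max (norm z) d\<close>. Changing the numerator costs a factor
  \<open>1 / d\<^sup>2\<close>, changing the denominator \<open>2 / d\<^sup>2\<close>, which
  explains the 3.\<close>

lemma reg_kernel_lipschitz:
  assumes d: "d > 0"
  shows "norm (reg_kernel d z - reg_kernel d w) \<le> 3 / d\<^sup>2 * norm (z - w)"
proof -
  have *: "norm (reg_kernel d z - reg_kernel d w) \<le> 3 / d\<^sup>2 * norm (z - w)" if zw: "norm z \<le> norm w" for z w
  proof -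
  let ?M = "\<lambda>z. max (norm z) d"
  have M: "?M z \<ge> d" "?M w \<ge> d" "?M z \<le> ?M w" using zw by auto
  have "reg_kernel d z - reg_kernel d w
    = (cnj z - cnj w) / of_real ((?M z)\<^sup>2) + cnj w * of_real (1 / (?M z)\<^sup>2 - 1 / (?M w)\<^sup>2)"
    using d by (simp add: reg_kernel_eq diff_divide_distrib algebra_simps)
  also have "norm \<dots> \<le> norm ((cnj z - cnj w) / of_real ((?M z)\<^sup>2)) + norm (cnj w * of_real (1 / (?M z)\<^sup>2 - 1 / (?M w)\<^sup>2))"
    by (rule norm_triangle_ineq)
  also have "norm ((cnj z - cnj w) / of_real ((?M z)\<^sup>2)) \<le> norm (z - w) / d\<^sup>2"
  proof -
    have "norm (z - w) / (?M z)\<^sup>2 \<le> norm (z - w) / d\<^sup>2"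
      using M d by (intro divide_left_mono power_mono mult_pos_pos zero_less_power) auto
    then show ?thesis
      by (simp add: norm_divide norm_power complex_cnj_diff[symmetric] del: complex_cnj_diff)
  qed
  also have "norm (cnj w * of_real (1 / (?M z)\<^sup>2 - 1 / (?M w)\<^sup>2)) \<le> 2 / d\<^sup>2 * norm (z - w)"
  proof -
    have pos: "?M z > 0" "?M w > 0" using d by auto
    have e: "1 / (?M z)\<^sup>2 - 1 / (?M w)\<^sup>2 = (?M w - ?M z) * (?M w + ?M z) / ((?M z)\<^sup>2 * (?M w)\<^sup>2)"
      using pos by (simp add: field_simps power2_eq_square)
    have nn: "0 \<le> 1 / (?M z)\<^sup>2 - 1 / (?M w)\<^sup>2" unfolding e using M d by auto
    have "norm (cnj w * of_real (1 / (?M z)\<^sup>2 - 1 / (?M w)\<^sup>2))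
        = norm w * ((?M w - ?M z) * (?M w + ?M z) / ((?M z)\<^sup>2 * (?M w)\<^sup>2))"
      using nn e by (simp only: norm_mult norm_of_real complex_mod_cnj abs_of_nonneg)
    \<comment> \<open>\<open>norm w\<close> and the sum of the two maxima are estimated by
      \<open>?M w\<close> and \<open>2 * ?M w\<close>, which cancels \<open>(?M w)\<^sup>2\<close>
      in the denominator.\<close>
    also have "\<dots> \<le> ?M w * ((?M w - ?M z) * (2 * ?M w) / ((?M z)\<^sup>2 * (?M w)\<^sup>2))"
      using M d by (intro mult_mono divide_right_mono mult_left_mono) auto
    also have "\<dots> = 2 / (?M z)\<^sup>2 * (?M w - ?M z)"
      using pos by (simp add: field_simps power2_eq_square)
    also have "\<dots> \<le> 2 / d\<^sup>2 * norm (z - w)"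
    proof (rule mult_mono)
      show "2 / (?M z)\<^sup>2 \<le> 2 / d\<^sup>2"
        using M d by (intro divide_left_mono power_mono mult_pos_pos zero_less_power) auto
      show "?M w - ?M z \<le> norm (z - w)"
        using norm_triangle_ineq2[of w z] zw norm_ge_zero[of "z - w"] by (simp add: norm_minus_commute max_def del: norm_ge_zero)
    qed (use M d in auto)
    finally show ?thesis .
  qed
  finally show "norm (reg_kernel d z - reg_kernel d w) \<le> 3 / d\<^sup>2 * norm (z - w)"
    by (simp add: field_simps)
  qed
  show ?thesis using *[of z w] *[of w z] by (cases "norm z \<le> norm w") (simp_all add: norm_minus_commute)
qed

section \<open>The Cauchy transform of an integrable function\<close>

text \<open>The convolution with \<open>1 / (pi * w)\<close>, the fundamental solution of d-bar,
  taken over the whole plane so that reflection applies. For the extension of \<open>a\<close> by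
  zero it agrees with \<open>T_disk\<close>, whose minus sign is absorbed in
  \<open>z - \<zeta>\<close>.\<close>

definition cauchy_transform :: "(complex \<Rightarrow> complex) \<Rightarrow> complex \<Rightarrow> complex"
  where "cauchy_transform a z = (LINT \<zeta>|lebesgue. a \<zeta> / (z - \<zeta>)) / of_real pi"

definition cauchy_reg :: "real \<Rightarrow> (complex \<Rightarrow> complex) \<Rightarrow> complex \<Rightarrow> complex"
  where "cauchy_reg d a z = (LINT \<zeta>|lebesgue. a \<zeta> / of_real pi * reg_kernel d (z - \<zeta>))"

text \<open>This is \<open>pi\<close> times the uniform density on the disk of radius
  \<open>d\<close>; the missing \<open>1 / pi\<close> travels with \<open>a\<close> in
  \<open>cauchy_reg\<close>.\<close>

definition disk_kernel :: "real \<Rightarrow> complex \<Rightarrow> complex"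
  where "disk_kernel d w = (if norm w < d then 1 / of_real (d\<^sup>2) else 0)"

lemma isCont_open_cong:
  fixes f g :: "'a::t2_space \<Rightarrow> 'b::topological_space"
  assumes "continuous_on S g" "open S" "x \<in> S" "\<And>y. y \<in> S \<Longrightarrow> f y = g y"
  shows "isCont f x"
proof -
  have "continuous_on S f" using assms(1) by (rule continuous_on_eq) (simp add: assms(4))
  then show ?thesis using assms(2,3) by (simp add: continuous_on_eq_continuous_at)
qed

lemma borel_measurable_if_norm_less:
  fixes f g :: "complex \<Rightarrow> complex"
  assumes "f \<in> borel_measurable borel" "g \<in> borel_measurable borel"
  shows "(\<lambda>w. if norm w < d then f w else g w) \<in> borel_measurable borel"
proof (rule measurable_If[OF assms])
  have "{x \<in> space borel. norm x < d} = ball (0::complex) d" by auto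
  then show "{x \<in> space borel. norm (x::complex) < d} \<in> sets borel" by simp
qed

lemma borel_measurable_kernels:
  "reg_kernel d \<in> borel_measurable borel" "disk_kernel d \<in> borel_measurable borel"
  "(\<lambda>w::complex. if norm w < d then 0 else - 1 / w\<^sup>2) \<in> borel_measurable borel"
proof -
  have 1: "(\<lambda>w::complex. 1 / w) \<in> borel_measurable borel" by measurable
  have "(\<lambda>w::complex. - ((1 / w) * (1 / w))) \<in> borel_measurable borel"
    by (intro borel_measurable_uminus borel_measurable_times 1)
  then have 2: "(\<lambda>w::complex. - 1 / w\<^sup>2) \<in> borel_measurable borel" by (simp add: power2_eq_square)
  have 3: "(\<lambda>w. cnj w / of_real (d\<^sup>2)) \<in> borel_measurable borel"
    unfolding divide_inverse by (intro borel_measurable_continuous_onI continuous_intros)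
  show "reg_kernel d \<in> borel_measurable borel" "disk_kernel d \<in> borel_measurable borel"
    "(\<lambda>w::complex. if norm w < d then 0 else - 1 / w\<^sup>2) \<in> borel_measurable borel"
    using borel_measurable_if_norm_less[OF 3 1, of d] borel_measurable_if_norm_less[OF _ 2, of "\<lambda>_. 0" d]
      borel_measurable_if_norm_less[of "\<lambda>_. 1 / of_real (d\<^sup>2)" "\<lambda>_. 0" d]
    unfolding reg_kernel_def[abs_def] disk_kernel_def[abs_def] by simp_all
qed

text \<open>The regularized kernel is \<open>C\<^sup>1\<close> off the circle of radius
  \<open>d\<close>, whose translates are null sets. Its d-bar derivative is the disk kernel, so that
  of the regularized transform is the mean of \<open>a\<close> over the disk of radius
  \<open>d\<close> about \<open>z\<close>.\<close>

lemma cauchy_reg_C1: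
  assumes a: "integrable lebesgue a" and d: "d > 0"
  shows "wirtinger_C1 UNIV (cauchy_reg d a)
    (\<lambda>z. LINT \<zeta>|lebesgue. a \<zeta> / of_real pi * (if norm (z - \<zeta>) < d then 0 else - 1 / (z - \<zeta>)\<^sup>2))
    (\<lambda>z. LINT \<zeta>|lebesgue. a \<zeta> / of_real pi * disk_kernel d (z - \<zeta>))"
  unfolding cauchy_reg_def
\<comment> \<open>One bound has to serve the kernel, which is at most \<open>1 / d\<close>, and both
  derivatives, which are at most \<open>1 / d\<^sup>2\<close>.\<close>
proof (rule wirtinger_C1_convolution[where N="sphere 0 d" and L="3 / d\<^sup>2" and B="1 / d + 1 / d\<^sup>2"
      and p="\<lambda>w. if norm w < d then 0 else - 1 / w\<^sup>2"])
  show "integrable lebesgue (\<lambda>\<zeta>. a \<zeta> / complex_of_real pi)" using a by simp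
  show "norm (reg_kernel d x - reg_kernel d y) \<le> 3 / d\<^sup>2 * norm (x - y)" for x y
    by (rule reg_kernel_lipschitz[OF d])
  show "norm (reg_kernel d x) \<le> 1 / d + 1 / d\<^sup>2" for x
  proof -
    have "norm (reg_kernel d x) \<le> 1 / d"
    proof (cases "norm x < d")
      case True
      then have "norm x / d\<^sup>2 \<le> d / d\<^sup>2" using d by (intro divide_right_mono) auto
      moreover have "d / d\<^sup>2 = 1 / d" using d by (simp add: power2_eq_square)
      moreover have "norm (reg_kernel d x) = norm x / d\<^sup>2"
        using True by (simp add: reg_kernel_def norm_divide norm_power del: of_real_power)
      ultimately show ?thesis by simp
    next
      case False
      then show ?thesis using d by (simp add: reg_kernel_def norm_divide frac_le)
    qed
    then show ?thesis using d by (simp add: add_increasing2)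
  qed
  show "norm (if norm x < d then 0 else - 1 / x\<^sup>2) \<le> 1 / d + 1 / d\<^sup>2" for x :: complex
  proof -
    have "1 / (norm x)\<^sup>2 \<le> 1 / d\<^sup>2" if "\<not> norm x < d"
      using that d by (intro frac_le power_mono) auto
    then show ?thesis using d by (auto simp: norm_divide norm_power intro: add_increasing)
  qed
  show "norm (disk_kernel d x) \<le> 1 / d + 1 / d\<^sup>2" for x
    using d by (simp add: disk_kernel_def norm_divide norm_power)
  show "(\<lambda>w::complex. if norm w < d then 0 else - 1 / w\<^sup>2) \<in> borel_measurable borel"
    "disk_kernel d \<in> borel_measurable borel"
    using borel_measurable_kernels[of d] by simp_all
  show "AE \<zeta> in lebesgue. z - \<zeta> \<notin> sphere 0 d" for z :: complex
  proof -
    have "sphere z d \<in> null_sets lebesgue" using negligible_sphere by (simp add: negligible_iff_null_sets)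
    then have "AE \<zeta> in lebesgue. \<zeta> \<notin> sphere z d" by (rule AE_not_in)
    then show ?thesis by eventually_elim (simp add: dist_norm norm_minus_commute)
  qed
  fix x :: complex assume x: "x \<notin> sphere 0 d"
  consider "x \<in> ball 0 d" | "x \<in> - cball 0 d" using x by fastforce
  note cases = this
  show "(reg_kernel d has_derivative (\<lambda>h. (if norm x < d then 0 else - 1 / x\<^sup>2) * h + disk_kernel d x * cnj h)) (at x)"
    using cases
  proof cases
    case 1
    have "((\<lambda>w. cnj w / of_real (d\<^sup>2)) has_derivative (\<lambda>h. cnj h / of_real (d\<^sup>2))) (at x)"
      by (rule bounded_linear.has_derivative[OF bounded_linear_compose[OF bounded_linear_divide bounded_linear_cnj]])
        (rule has_derivative_ident)
    then have "(reg_kernel d has_derivative (\<lambda>h. cnj h / of_real (d\<^sup>2))) (at x)"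
      by (rule has_derivative_transform_within_open[of _ _ _ _ "ball 0 d"]) (use 1 in \<open>auto simp: reg_kernel_def\<close>)
    then show ?thesis using 1 by (simp add: disk_kernel_def)
  next
    case 2
    have "((\<lambda>w. 1 / w) has_field_derivative (- 1 / x\<^sup>2)) (at x)"
      using 2 d by (auto intro!: derivative_eq_intros simp: power2_eq_square)
    then have "((\<lambda>w. 1 / w) has_derivative (\<lambda>h. (- 1 / x\<^sup>2) * h)) (at x)"
      unfolding has_field_derivative_def .
    then have "(reg_kernel d has_derivative (\<lambda>h. (- 1 / x\<^sup>2) * h)) (at x)"
      by (rule has_derivative_transform_within_open[of _ _ _ _ "- cball 0 d"]) (use 2 in \<open>auto simp: reg_kernel_def\<close>)
    then show ?thesis using 2 by (simp add: disk_kernel_def)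
  qed
  show "isCont (\<lambda>w. if norm w < d then 0 else - 1 / w\<^sup>2) x \<and> isCont (disk_kernel d) x"
    using cases
  proof cases
    case 1
    have "continuous_on (ball 0 d) (\<lambda>_. 0::complex)" "continuous_on (ball 0 d) (\<lambda>_. 1 / of_real (d\<^sup>2) :: complex)"
      by (rule continuous_on_const)+
    then show ?thesis
      using 1 isCont_open_cong[of "ball 0 d" "\<lambda>_. 0" x "\<lambda>w. if norm w < d then 0 else - 1 / w\<^sup>2"]
        isCont_open_cong[of "ball 0 d" "\<lambda>_. 1 / of_real (d\<^sup>2)" x "disk_kernel d"] by (simp add: disk_kernel_def)
  next
    case 2
    have "continuous_on (- cball 0 d) (\<lambda>w::complex. - 1 / w\<^sup>2)"
      using d by (intro continuous_intros) auto
    moreover have "continuous_on (- cball (0::complex) d) (\<lambda>_. 0::complex)" by (rule continuous_on_const)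
    ultimately show ?thesis
      using 2 isCont_open_cong[of "- cball 0 d" "\<lambda>w. - 1 / w\<^sup>2" x "\<lambda>w. if norm w < d then 0 else - 1 / w\<^sup>2"]
        isCont_open_cong[of "- cball 0 d" "\<lambda>_. 0" x "disk_kernel d"] by (simp add: disk_kernel_def open_Compl)
  qed
qed

text \<open>The two kernels differ only in the disk of radius \<open>d\<close>, by at most
  \<open>2 / norm w\<close>; the normalization by \<open>pi\<close> brings the constant down to
  \<open>2 / pi \<le> 1\<close>.\<close>

lemma cauchy_reg_approx:
  assumes a: "integrable lebesgue a" and aq: "integrable lebesgue (\<lambda>z. norm (a z) powr q)" and q: "q > 2"
    and d: "d > 0"
  shows "norm (cauchy_reg d a z - cauchy_transform a z)
    \<le> (LINT \<zeta>|lebesgue. indicator (ball z d) \<zeta> * norm (a \<zeta> / (z - \<zeta>)))"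
proof -
  note int = cauchy_kernel_integrable_small(1)[OF a aq q, of z]
  note rkb = borel_measurable_kernels(1)[of d]
  have rk: "integrable lebesgue (\<lambda>\<zeta>. a \<zeta> / of_real pi * reg_kernel d (z - \<zeta>))"
  proof (rule integrable_mult_bounded)
    show "norm (reg_kernel d (z - \<zeta>)) \<le> 3 / d\<^sup>2 * d + 1 / d" for \<zeta>
    proof (cases "norm (z - \<zeta>) < d")
      case True
      have "norm (reg_kernel d (z - \<zeta>)) \<le> 3 / d\<^sup>2 * norm (z - \<zeta>)"
        using reg_kernel_lipschitz[OF d, of "z - \<zeta>" 0] d by (simp add: reg_kernel_def)
      also have "\<dots> \<le> 3 / d\<^sup>2 * d" using True by (intro mult_left_mono) auto
      finally have "norm (reg_kernel d (z - \<zeta>)) \<le> 3 / d\<^sup>2 * d" .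
      then show ?thesis using d by (simp add: add_increasing2)
    next
      case False
      then show ?thesis using d by (simp add: reg_kernel_def norm_divide frac_le add_increasing)
    qed
  qed (use a borel_measurable_diff_lebesgue[OF rkb] in auto)
  have "cauchy_reg d a z - cauchy_transform a z
    = (LINT \<zeta>|lebesgue. a \<zeta> / of_real pi * reg_kernel d (z - \<zeta>) - a \<zeta> / (z - \<zeta>) / of_real pi)"
    unfolding cauchy_reg_def cauchy_transform_def integral_divide_zero[symmetric]
    by (rule Bochner_Integration.integral_diff[symmetric, OF rk integrable_divide_zero[OF int]])
  also have "norm \<dots> \<le> (LINT \<zeta>|lebesgue. indicator (ball z d) \<zeta> * norm (a \<zeta> / (z - \<zeta>)))"
  proof (rule Bochner_Integration.integral_norm_bound_integral)
    show "integrable lebesgue (\<lambda>\<zeta>. a \<zeta> / of_real pi * reg_kernel d (z - \<zeta>) - a \<zeta> / (z - \<zeta>) / of_real pi)"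
      by (intro Bochner_Integration.integrable_diff rk integrable_divide_zero int)
    show "integrable lebesgue (\<lambda>\<zeta>. indicator (ball z d) \<zeta> * norm (a \<zeta> / (z - \<zeta>)))"
      using integrable_mult_indicator[OF _ integrable_norm[OF int], of "ball z d"] by simp
    fix \<zeta>
    show "norm (a \<zeta> / of_real pi * reg_kernel d (z - \<zeta>) - a \<zeta> / (z - \<zeta>) / of_real pi)
        \<le> indicator (ball z d) \<zeta> * norm (a \<zeta> / (z - \<zeta>))"
    proof (cases "norm (z - \<zeta>) < d")
      case True
      let ?w = "z - \<zeta>"
      have eq: "a \<zeta> / of_real pi * reg_kernel d ?w - a \<zeta> / ?w / of_real pi
          = a \<zeta> / of_real pi * (reg_kernel d ?w - 1 / ?w)"
        by (simp add: algebra_simps)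
      have "norm (reg_kernel d ?w - 1 / ?w) \<le> 2 / norm ?w"
      proof (cases "?w = 0")
        case False
        have "norm ?w * norm ?w \<le> d * d" using True d by (intro mult_mono) auto
        then have "norm ?w / d\<^sup>2 \<le> 1 / norm ?w"
          using False d by (simp add: power2_eq_square field_simps)
        moreover have "norm (reg_kernel d ?w) = norm ?w / d\<^sup>2"
          unfolding reg_kernel_def using True by (simp only: if_True norm_divide norm_of_real complex_mod_cnj abs_power2)
        ultimately have "norm (reg_kernel d ?w) \<le> 1 / norm ?w" by simp
        then show ?thesis
          using norm_triangle_ineq4[of "reg_kernel d ?w" "1 / ?w"] by (simp add: norm_divide)
      qed (simp add: reg_kernel_def d)
      then have "norm (a \<zeta> / of_real pi * (reg_kernel d ?w - 1 / ?w)) \<le> norm (a \<zeta>) / pi * (2 / norm ?w)"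
        unfolding norm_mult norm_divide by (intro mult_mono) auto
      also have "\<dots> = (2 / pi) * (norm (a \<zeta>) / norm ?w)" by simp
      also have "\<dots> \<le> 1 * (norm (a \<zeta>) / norm ?w)"
        using pi_gt3 by (intro mult_right_mono) auto
      finally show ?thesis unfolding eq using True by (simp add: indicator_def dist_norm norm_divide)
    qed (simp add: reg_kernel_def indicator_def dist_norm)
  qed
  finally show ?thesis .
qed

lemma cauchy_reg_sequence:
  assumes a: "integrable lebesgue a" and aq: "integrable lebesgue (\<lambda>z. norm (a z) powr q)" and q: "q > 2"
  obtains d :: "nat \<Rightarrow> real" where "\<And>n. d n > 0" "d \<longlonglongrightarrow> 0"
    "\<And>n z. norm (cauchy_reg (d n) a z - cauchy_transform a z) \<le> inverse (real (Suc n))"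
proof -
  have "\<exists>d. 0 < d \<and> d < inverse (real (Suc n)) \<and>
      (\<forall>z. (LINT \<zeta>|lebesgue. indicator (ball z d) \<zeta> * norm (a \<zeta> / (z - \<zeta>))) < inverse (real (Suc n)))" for n
    by (rule cauchy_kernel_integrable_small(2)[OF a aq q]) simp
  then obtain d where d: "\<And>n. 0 < d n" "\<And>n. d n < inverse (real (Suc n))"
      "\<And>n z. (LINT \<zeta>|lebesgue. indicator (ball z (d n)) \<zeta> * norm (a \<zeta> / (z - \<zeta>))) < inverse (real (Suc n))"
    by metis
  have "d \<longlonglongrightarrow> 0"
    by (rule tendsto_sandwich[OF _ _ tendsto_const LIMSEQ_inverse_real_of_nat])
      (use d in \<open>auto intro!: always_eventually less_imp_le\<close>)
  moreover have "norm (cauchy_reg (d n) a z - cauchy_transform a z) \<le> inverse (real (Suc n))" for n z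
    using cauchy_reg_approx[OF a aq q d(1)] d(3)[of z n] by (meson less_imp_le order_trans)
  ultimately show ?thesis using that d(1) by blast
qed

lemma cauchy_transform_continuous:
  assumes a: "integrable lebesgue a" and aq: "integrable lebesgue (\<lambda>z. norm (a z) powr q)" and q: "q > 2"
  shows "continuous_on UNIV (cauchy_transform a)"
proof -
  obtain d :: "nat \<Rightarrow> real" where d: "\<And>n. d n > 0"
    "\<And>n z. norm (cauchy_reg (d n) a z - cauchy_transform a z) \<le> inverse (real (Suc n))"
    using cauchy_reg_sequence[OF a aq q] by metis
  show ?thesis
  proof (rule uniform_limit_theorem[where F=sequentially and f="\<lambda>n. cauchy_reg (d n) a"])
    show "eventually (\<lambda>n. continuous_on UNIV (cauchy_reg (d n) a)) sequentially"
      using wirtinger_C1_continuous[OF cauchy_reg_C1[OF a d(1)]] by simp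
    show "uniform_limit UNIV (\<lambda>n. cauchy_reg (d n) a) (cauchy_transform a) sequentially"
    proof (rule uniform_limitI)
      fix e :: real assume "e > 0"
      then have "eventually (\<lambda>n. inverse (real (Suc n)) < e) sequentially"
        by (rule order_tendstoD(2)[OF LIMSEQ_inverse_real_of_nat])
      then show "eventually (\<lambda>n. \<forall>z\<in>UNIV. dist (cauchy_reg (d n) a z) (cauchy_transform a z) < e) sequentially"
        by eventually_elim (use d(2) in \<open>auto simp: dist_norm intro: le_less_trans\<close>)
    qed
  qed simp
qed

section \<open>Fubini's theorem for convolutions and averages over disks\<close>

lemma sigma_finite_lebesgue: "sigma_finite_measure (lebesgue :: 'a::euclidean_space measure)"
proof
  obtain A :: "'a set set" where A: "countable A" "A \<subseteq> sets lborel" "\<Union>A = space lborel"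
      "\<forall>a\<in>A. emeasure lborel a \<noteq> \<infinity>"
    using lborel.sigma_finite_countable by auto
  then show "\<exists>A. countable A \<and> A \<subseteq> sets (lebesgue :: 'a measure) \<and> \<Union>A = space lebesgue \<and> (\<forall>a\<in>A. emeasure lebesgue a \<noteq> \<infinity>)"
    by (intro exI[of _ A]) (auto simp: subset_eq)
qed

text \<open>Borel measurability of \<open>k\<close> makes its composition with the difference map
  measurable for the product of two Lebesgue measures, and its boundedness reduces integrability to
  that of \<open>f z * a \<zeta>\<close>.\<close>

lemma Fubini_convolution:
  fixes f a k :: "complex \<Rightarrow> complex"
  assumes f: "integrable lebesgue f" and a: "integrable lebesgue a"
    and k: "k \<in> borel_measurable borel" "\<And>x. norm (k x) \<le> B"
  shows "(LINT z|lebesgue. f z * (LINT \<zeta>|lebesgue. a \<zeta> * k (z - \<zeta>)))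
    = (LINT \<zeta>|lebesgue. a \<zeta> * (LINT z|lebesgue. f z * k (z - \<zeta>)))"
proof -
  interpret sigma_finite_measure "lebesgue :: complex measure" by (rule sigma_finite_lebesgue)
  interpret P: pair_sigma_finite "lebesgue :: complex measure" "lebesgue :: complex measure" ..
  have fm[measurable]: "f \<in> borel_measurable lebesgue" and am[measurable]: "a \<in> borel_measurable lebesgue"
    using f a by auto
  have fa: "integrable (lebesgue \<Otimes>\<^sub>M lebesgue) (\<lambda>(z, \<zeta>). f z * a \<zeta>)"
  proof (rule P.Fubini_integrable)
    show "(\<lambda>(z, \<zeta>). f z * a \<zeta>) \<in> borel_measurable (lebesgue \<Otimes>\<^sub>M lebesgue)" by measurable
    show "integrable lebesgue (\<lambda>z. LINT \<zeta>|lebesgue. norm (case (z, \<zeta>) of (z, \<zeta>) \<Rightarrow> f z * a \<zeta>))"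
      using f by (simp add: norm_mult)
    show "AE z in lebesgue. integrable lebesgue (\<lambda>\<zeta>. case (z, \<zeta>) of (z, \<zeta>) \<Rightarrow> f z * a \<zeta>)"
      using a by simp
  qed
  have id1: "(\<lambda>x::complex. x) \<in> borel_measurable lebesgue" by (rule measurable_completion) simp
  have "(\<lambda>p. fst p - snd p) \<in> borel_measurable ((lebesgue :: complex measure) \<Otimes>\<^sub>M lebesgue)"
    using id1 by measurable
  then have km: "(\<lambda>p. k (fst p - snd p)) \<in> borel_measurable (lebesgue \<Otimes>\<^sub>M lebesgue)"
    using k(1) by (rule measurable_compose)
  have i: "integrable (lebesgue \<Otimes>\<^sub>M lebesgue) (\<lambda>(z, \<zeta>). f z * a \<zeta> * k (z - \<zeta>))"
    using integrable_mult_bounded[OF fa km k(2)] by (simp add: case_prod_unfold)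
  have "(LINT \<zeta>|lebesgue. LINT z|lebesgue. f z * a \<zeta> * k (z - \<zeta>))
      = (LINT z|lebesgue. LINT \<zeta>|lebesgue. f z * a \<zeta> * k (z - \<zeta>))"
    by (rule P.Fubini_integral[OF i])
  moreover have "(LINT z|lebesgue. f z * a \<zeta> * k (z - \<zeta>)) = a \<zeta> * (LINT z|lebesgue. f z * k (z - \<zeta>))" for \<zeta>
    by (subst integral_mult_right_zero[symmetric]) (simp add: ac_simps)
  moreover have "(LINT \<zeta>|lebesgue. f z * a \<zeta> * k (z - \<zeta>)) = f z * (LINT \<zeta>|lebesgue. a \<zeta> * k (z - \<zeta>))" for z
    by (subst integral_mult_right_zero[symmetric]) (simp add: ac_simps)
  ultimately show ?thesis by simp
qed

text \<open>The disk has area \<open>pi * d\<^sup>2\<close>, so the quotient is the mean of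
  \<open>f\<close> over it, and a mean deviates from \<open>c\<close> by no more than the values
  do.\<close>

lemma disk_average:
  fixes f :: "complex \<Rightarrow> complex"
  assumes f: "integrable lebesgue f" and d: "d > 0" and c: "\<And>z. z \<in> ball x d \<Longrightarrow> norm (f z - c) \<le> e"
  shows "norm ((LINT z|lebesgue. f z * disk_kernel d (z - x)) / of_real pi - c) \<le> e"
proof -
  have bm: "ball x d \<in> lmeasurable" by simp
  have eq: "f z * disk_kernel d (z - x) = of_real (1 / d\<^sup>2) * (indicator (ball x d) z *\<^sub>R f z)" for z
    by (simp add: disk_kernel_def indicator_def dist_norm norm_minus_commute)
  have ib: "integrable lebesgue (indicator (ball x d) :: complex \<Rightarrow> real)"
    using bm by (simp add: lmeasurable_iff_integrable)
  have i1: "integrable lebesgue (\<lambda>z. indicator (ball x d) z *\<^sub>R f z)"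
    using f by (intro integrable_mult_indicator) auto
  have i2: "integrable lebesgue (\<lambda>z. indicator (ball x d) z *\<^sub>R c)"
    using ib by (rule integrable_scaleR_left)
  have mb: "measure lebesgue (ball x d) = pi * d\<^sup>2"
    using emeasure_lebesgue_ball_complex[of d x] d by (simp add: measure_def)
  have cc: "(LINT z|lebesgue. indicator (ball x d) z *\<^sub>R c) = of_real (pi * d\<^sup>2) * c"
    using mb ib by (simp add: scaleR_conv_of_real del: of_real_mult)
  have "(LINT z|lebesgue. f z * disk_kernel d (z - x)) / of_real pi - c
     = (LINT z|lebesgue. indicator (ball x d) z *\<^sub>R f z) / of_real (pi * d\<^sup>2)
       - (LINT z|lebesgue. indicator (ball x d) z *\<^sub>R c) / of_real (pi * d\<^sup>2)"
    unfolding eq cc integral_mult_right_zero using d by (simp add: field_simps)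
  also have "\<dots> = (LINT z|lebesgue. indicator (ball x d) z *\<^sub>R (f z - c)) / of_real (pi * d\<^sup>2)"
    using i1 i2 by (simp add: scaleR_diff_right diff_divide_distrib)
  also have "norm \<dots> \<le> e"
  proof -
    have "norm (LINT z|lebesgue. indicator (ball x d) z *\<^sub>R (f z - c)) \<le> (LINT z|lebesgue. indicator (ball x d) z * e)"
    proof (rule Bochner_Integration.integral_norm_bound_integral)
      show "integrable lebesgue (\<lambda>z. indicator (ball x d) z *\<^sub>R (f z - c))"
        using i1 i2 by (simp add: scaleR_diff_right)
      show "integrable lebesgue (\<lambda>z. indicator (ball x d) z * e)" using ib by simp
    qed (use c in \<open>auto simp: indicator_def\<close>)
    also have "\<dots> = pi * d\<^sup>2 * e" using mb ib by simp
    finally have "norm (LINT z|lebesgue. indicator (ball x d) z *\<^sub>R (f z - c)) \<le> pi * d\<^sup>2 * e" .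
    moreover have "pi * d\<^sup>2 > 0" using d by simp
    ultimately show ?thesis
      by (simp add: norm_divide norm_mult norm_power divide_le_eq mult.commute)
  qed
  finally show ?thesis .
qed

section \<open>Multiplication by the exponential of a Cauchy transform\<close>

lemma continuous_on_extend_zero:
  fixes f :: "complex \<Rightarrow> complex"
  assumes f: "continuous_on unit_disk f" and K: "compact K" "K \<subseteq> unit_disk" "\<And>z. z \<in> unit_disk - K \<Longrightarrow> f z = 0"
  shows "continuous_on UNIV (\<lambda>z. indicator unit_disk z *\<^sub>R f z)"
proof -
  have "unit_disk \<union> - K = UNIV" using K by auto
  moreover have "continuous_on (unit_disk \<union> - K) (\<lambda>z. indicator unit_disk z *\<^sub>R f z)"
  proof (rule continuous_on_open_Un)
    show "continuous_on unit_disk (\<lambda>z. indicator unit_disk z *\<^sub>R f z)"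
      by (rule continuous_on_eq[OF f]) simp
    show "continuous_on (- K) (\<lambda>z. indicator unit_disk z *\<^sub>R f z)"
      by (rule continuous_on_eq[OF continuous_on_const[of _ 0]]) (use K in \<open>auto simp: indicator_def\<close>)
  qed (use K in \<open>auto simp: compact_imp_closed\<close>)
  ultimately show ?thesis by simp
qed

lemma set_integral_disk_dominated:
  fixes s :: "nat \<Rightarrow> complex \<Rightarrow> complex"
  assumes f: "set_integrable lebesgue unit_disk f"
    and s: "\<And>n. continuous_on UNIV (s n)" "\<And>n z. z \<in> unit_disk \<Longrightarrow> norm (s n z) \<le> C"
    and lim: "\<And>z. z \<in> unit_disk \<Longrightarrow> (\<lambda>n. s n z) \<longlonglongrightarrow> t z" and t: "continuous_on UNIV t"
  shows "(\<lambda>n. LINT z:unit_disk|lebesgue. s n z * f z) \<longlonglongrightarrow> (LINT z:unit_disk|lebesgue. t z * f z)"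
  unfolding set_lebesgue_integral_def
proof (rule integral_dominated_convergence)
  let ?f = "\<lambda>z. indicator unit_disk z *\<^sub>R f z"
  have f': "integrable lebesgue ?f" using f by (simp add: set_integrable_def)
  show "integrable lebesgue (\<lambda>z. C * norm (?f z))" using f' by (intro integrable_mult_right integrable_norm)
  have m: "(\<lambda>z. indicator unit_disk z *\<^sub>R (r z * f z)) \<in> borel_measurable lebesgue"
    if "continuous_on UNIV r" for r :: "complex \<Rightarrow> complex"
  proof -
    have "r \<in> borel_measurable lebesgue"
      using that by (intro measurable_completion) (simp add: borel_measurable_continuous_onI)
    then have "(\<lambda>z. r z * ?f z) \<in> borel_measurable lebesgue"
      using borel_measurable_integrable[OF f'] by (rule borel_measurable_times)
    then show ?thesis by simp
  qed
  show "(\<lambda>z. indicator unit_disk z *\<^sub>R (t z * f z)) \<in> borel_measurable lebesgue" by (rule m[OF t])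
  show "(\<lambda>z. indicator unit_disk z *\<^sub>R (s n z * f z)) \<in> borel_measurable lebesgue" for n by (rule m[OF s(1)])
  show "AE z in lebesgue. (\<lambda>n. indicator unit_disk z *\<^sub>R (s n z * f z)) \<longlonglongrightarrow> indicator unit_disk z *\<^sub>R (t z * f z)"
    using lim by (intro AE_I2) (auto simp: indicator_def intro!: tendsto_mult)
  show "AE z in lebesgue. norm (indicator unit_disk z *\<^sub>R (s n z * f z)) \<le> C * norm (?f z)" for n
    using s(2) by (intro AE_I2) (auto simp: indicator_def norm_mult intro!: mult_right_mono)
qed

text \<open>Pick in each ball a point where the deviation exceeds \<open>e\<close>, if there is one.
  These points converge to \<open>y\<close>, so the deviations at them become small, and from then
  on no ball contains a bad point.\<close>

lemma continuous_convergence_ball: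
  fixes f :: "nat \<Rightarrow> 'a::metric_space \<Rightarrow> 'b::real_normed_vector" and d :: "nat \<Rightarrow> real"
  assumes d: "\<And>n. d n > 0" "d \<longlonglongrightarrow> 0" and e: "e > 0"
    and lim: "\<And>x. x \<longlonglongrightarrow> y \<Longrightarrow> (\<lambda>n. f n (x n)) \<longlonglongrightarrow> c"
  shows "\<exists>N. \<forall>n\<ge>N. \<forall>z\<in>ball y (d n). norm (f n z - c) \<le> e"
proof -
  have "\<exists>z. z \<in> ball y (d n) \<and> ((\<exists>z\<in>ball y (d n). norm (f n z - c) > e) \<longrightarrow> norm (f n z - c) > e)" for n
    using d(1)[of n] by (metis centre_in_ball)
  then obtain x where x: "\<And>n. x n \<in> ball y (d n)"
    "\<And>n z. z \<in> ball y (d n) \<Longrightarrow> norm (f n z - c) > e \<Longrightarrow> norm (f n (x n) - c) > e"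
    by metis
  have "(\<lambda>n. dist (x n) y) \<longlonglongrightarrow> 0"
    by (rule tendsto_sandwich[OF _ _ tendsto_const d(2)])
      (use x(1) in \<open>auto simp: dist_commute intro!: always_eventually less_imp_le\<close>)
  then have "x \<longlonglongrightarrow> y" by (simp only: tendsto_dist_iff[of x y])
  from lim[OF this] obtain N where "\<And>n. n \<ge> N \<Longrightarrow> norm (f n (x n) - c) < e"
    using e LIMSEQ_D by blast
  then have "\<forall>n\<ge>N. \<forall>z\<in>ball y (d n). norm (f n z - c) \<le> e"
    using x(2) by (meson less_asym not_le)
  then show ?thesis ..
qed

text \<open>The exponential is only continuous, so it is approximated by the continuously differentiable
  exponentials of the regularized Cauchy transforms, whose $\partial / \partial z^*$ are disk averages
  of \<open>a\<close>; the averages are moved to the other factor by Fubini's theorem.\<close>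

lemma weak_dbar_exp_mult:
  assumes a: "integrable lebesgue a" and aq: "integrable lebesgue (\<lambda>z. norm (a z) powr q)" and q: "q > 2"
    and u: "continuous_on unit_disk u" and ug: "weak_dbar \<i> u g"
  shows "weak_dbar \<i> (\<lambda>z. exp (cauchy_transform a z) * u z)
    (\<lambda>z. exp (cauchy_transform a z) * (g z + a z * u z))"
proof -
  let ?T = "cauchy_transform a"
  define S where "S z = exp (?T z)" for z
  have Tc: "continuous_on UNIV ?T" by (rule cauchy_transform_continuous[OF a aq q])
  have Sc: "continuous_on UNIV S" unfolding S_def by (intro continuous_intros Tc)
  have li: "locally_integrable u" "locally_integrable g" using ug by (auto simp: weak_dbar_def)
  have lia: "locally_integrable a"
    unfolding locally_integrable_def set_integrable_def
    using integrable_mult_indicator[OF fmeasurableD[OF lmeasurable_compact] a] by blast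
  have liau: "locally_integrable (\<lambda>z. u z * a z)" by (rule locally_integrable_mult[OF lia u])
  have Sd: "continuous_on unit_disk S" using Sc continuous_on_subset by blast
  have LI: "locally_integrable (\<lambda>z. S z * u z)" "locally_integrable (\<lambda>z. S z * (g z + a z * u z))"
  proof -
    have "locally_integrable (\<lambda>z. S z * g z + S z * (u z * a z))"
      by (intro locally_integrable_add locally_integrable_mult li liau Sd)
    then show "locally_integrable (\<lambda>z. S z * (g z + a z * u z))" by (simp add: algebra_simps)
  qed (rule locally_integrable_mult[OF li(1) Sd])
  obtain d :: "nat \<Rightarrow> real" where d: "\<And>n. d n > 0" "d \<longlonglongrightarrow> 0"
    "\<And>n z. norm (cauchy_reg (d n) a z - ?T z) \<le> inverse (real (Suc n))"
    using cauchy_reg_sequence[OF a aq q] by metis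
  define R where "R n = cauchy_reg (d n) a" for n
  define M where "M n z = (LINT \<zeta>|lebesgue. a \<zeta> / of_real pi * disk_kernel (d n) (z - \<zeta>))" for n z
  obtain p where RC: "wirtinger_C1 UNIV (R n) (p n) (M n)" for n
    using that[OF cauchy_reg_C1[OF a d(1), folded R_def M_def]] .
  define s where "s n z = exp (R n z)" for n z
  have sC: "wirtinger_C1 UNIV (s n) (\<lambda>z. s n z * p n z) (\<lambda>z. s n z * M n z)" for n
    unfolding s_def by (rule wirtinger_C1_exp[OF RC])
  have sc: "continuous_on UNIV (s n)" for n by (rule wirtinger_C1_continuous[OF sC])
  have Mc: "continuous_on UNIV (M n)" for n using RC by (auto simp: wirtinger_C1_def)
  obtain C0 where C0: "C0 \<ge> 0" "\<And>z. z \<in> cball 0 1 \<Longrightarrow> norm (?T z) \<le> C0"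
    using compact_continuous_bounded[OF compact_cball continuous_on_subset[OF Tc subset_UNIV]] by metis
  \<comment> \<open>\<open>inverse (real (Suc n)) \<le> 1\<close>, so on the disk every regularized
    transform stays within 1 of the transform, and all the exponentials share the bound
    \<open>C\<close>.\<close>
  have Rb: "norm (R n z) \<le> C0 + 1" if "z \<in> unit_disk" for n z
  proof -
    have "norm (R n z - ?T z) \<le> 1"
      using d(3)[of n z] by (simp add: R_def inverse_eq_divide) (smt (verit) divide_le_eq_1 of_nat_0_le_iff)
    then show ?thesis using C0(2)[of z] that norm_triangle_sub[of "R n z" "?T z"] by simp
  qed
  define C where "C = exp (C0 + 1)"
  have sb: "norm (s n z) \<le> C" if "z \<in> unit_disk" for n z
    unfolding s_def C_def norm_exp_eq_Re
    using Rb[OF that, of n] complex_Re_le_cmod[of "R n z"] by simp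
  have Rlim: "(\<lambda>n. R n (x n)) \<longlonglongrightarrow> ?T y" if "x \<longlonglongrightarrow> y" for x y
  proof -
    have "(\<lambda>n. R n (x n) - ?T (x n)) \<longlonglongrightarrow> 0"
      by (rule Lim_null_comparison[OF _ LIMSEQ_inverse_real_of_nat]) (use d(3) in \<open>auto simp: R_def\<close>)
    moreover have "(\<lambda>n. ?T (x n)) \<longlonglongrightarrow> ?T y"
      using Tc that by (simp add: continuous_on_eq_continuous_at isCont_tendsto_compose)
    ultimately show ?thesis using tendsto_add by fastforce
  qed
  have slim: "(\<lambda>n. s n (x n)) \<longlonglongrightarrow> S y" if "x \<longlonglongrightarrow> y" for x y
    unfolding s_def S_def by (intro tendsto_intros Rlim that)
  have main: "(LINT z:unit_disk|lebesgue. q' z * (S z * u z))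
      = - (LINT z:unit_disk|lebesgue. \<phi> z * (S z * (g z + a z * u z)))"
    if \<phi>: "complex_test \<phi> p' q'" for \<phi> p' q'
  proof -
    obtain K where K: "compact K" "K \<subseteq> unit_disk" and
      z0: "\<And>z. z \<notin> K \<Longrightarrow> \<phi> z = 0 \<and> p' z = 0 \<and> q' z = 0"
      using complex_test_supp[OF \<phi>] by blast
    note \<phi>c = complex_test_continuous[OF \<phi>]
    have \<phi>d: "continuous_on unit_disk \<phi>" using \<phi>c continuous_on_subset by blast
    note qu = complex_test_integrable(2)[OF li(1) \<phi>] and \<phi>g = complex_test_integrable(1)[OF li(2) \<phi>]
    have L1: "(\<lambda>n. LINT z:unit_disk|lebesgue. s n z * (q' z * u z)) \<longlonglongrightarrow> (LINT z:unit_disk|lebesgue. S z * (q' z * u z))"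
      by (rule set_integral_disk_dominated[OF qu sc sb _ Sc]) (auto intro: slim)
    have L2: "(\<lambda>n. LINT z:unit_disk|lebesgue. s n z * (\<phi> z * g z)) \<longlonglongrightarrow> (LINT z:unit_disk|lebesgue. S z * (\<phi> z * g z))"
      by (rule set_integral_disk_dominated[OF \<phi>g sc sb _ Sc]) (auto intro: slim)
    \<comment> \<open>The cofactor of the average \<open>M n\<close> in the integral, extended by
      zero outside the disk. It is continuous on the plane because \<open>\<phi>\<close> vanishes
      near the circle.\<close>
    define \<psi> where "\<psi> n z = indicator unit_disk z *\<^sub>R (s n z * \<phi> z * u z)" for n z
    define \<Psi> where "\<Psi> z = indicator unit_disk z *\<^sub>R (S z * \<phi> z * u z)" for z
    have uK: "continuous_on K (\<lambda>z. \<phi> z * u z)"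
      using K \<phi>d u by (intro continuous_intros) (auto intro: continuous_on_subset)
    obtain B where B: "B \<ge> 0" "\<And>z. z \<in> K \<Longrightarrow> norm (\<phi> z * u z) \<le> B"
      using compact_continuous_bounded[OF K(1) uK] by blast
    have C: "C \<ge> 0" by (simp add: C_def)
    have \<psi>b: "norm (\<psi> n z) \<le> C * B" for n z
    proof (cases "z \<in> K")
      case True
      then have z: "z \<in> unit_disk" using K by auto
      then have "norm (s n z) * norm (\<phi> z * u z) \<le> C * B"
        using sb[OF z] B(2)[OF True] C by (intro mult_mono) auto
      then show ?thesis using z by (simp add: \<psi>_def norm_mult mult.assoc)
    next
      case False
      then show ?thesis using z0[OF False] C B by (simp add: \<psi>_def)
    qed
    have \<psi>c: "continuous_on UNIV (\<psi> n)" for n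
      unfolding \<psi>_def
      by (rule continuous_on_extend_zero[OF _ K])
        (use z0 \<phi>d u continuous_on_subset[OF sc] in \<open>auto intro!: continuous_intros\<close>)
    have \<Psi>c: "continuous_on UNIV \<Psi>"
      unfolding \<Psi>_def
      by (rule continuous_on_extend_zero[OF _ K])
        (use z0 \<phi>d u Sd in \<open>auto intro!: continuous_intros\<close>)
    have \<psi>i: "integrable lebesgue (\<psi> n)" for n
    proof (rule Bochner_Integration.integrable_bound)
      show "integrable lebesgue (\<lambda>z. indicator unit_disk z * (C * B) :: real)"
        using lmeasurable_ball[of "0::complex" 1] by (auto simp: lmeasurable_iff_integrable)
      show "\<psi> n \<in> borel_measurable lebesgue"
        using \<psi>c by (intro measurable_completion) (simp add: borel_measurable_continuous_onI)
      show "AE z in lebesgue. norm (\<psi> n z) \<le> norm (indicator unit_disk z * (C * B) :: real)"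
      proof (rule AE_I2)
        fix z show "norm (\<psi> n z) \<le> norm (indicator unit_disk z * (C * B) :: real)"
          using \<psi>b[of n z] C B by (cases "z \<in> unit_disk") (simp_all add: \<psi>_def)
      qed
    qed
    have kb: "norm (disk_kernel (d n) x) \<le> 1 / (d n)\<^sup>2" for n x
      by (simp add: disk_kernel_def norm_divide norm_power)
    have I3: "(LINT z:unit_disk|lebesgue. \<phi> z * (s n z * M n z * u z))
      = (LINT \<zeta>|lebesgue. a \<zeta> * ((LINT z|lebesgue. \<psi> n z * disk_kernel (d n) (z - \<zeta>)) / of_real pi))" for n
    proof -
      have "(LINT z:unit_disk|lebesgue. \<phi> z * (s n z * M n z * u z)) = (LINT z|lebesgue. \<psi> n z * M n z)"
        unfolding set_lebesgue_integral_def \<psi>_def by (intro Bochner_Integration.integral_cong) auto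
      also have "\<dots> = (LINT \<zeta>|lebesgue. a \<zeta> / of_real pi * (LINT z|lebesgue. \<psi> n z * disk_kernel (d n) (z - \<zeta>)))"
        unfolding M_def
        by (rule Fubini_convolution[OF \<psi>i integrable_divide_zero[OF a] borel_measurable_kernels(2) kb])
      finally show ?thesis by simp
    qed
    have L3: "(\<lambda>n. LINT z:unit_disk|lebesgue. \<phi> z * (s n z * M n z * u z))
      \<longlonglongrightarrow> (LINT \<zeta>|lebesgue. a \<zeta> * \<Psi> \<zeta>)"
      unfolding I3
    proof (rule integral_dominated_convergence)
      let ?A = "\<lambda>n \<zeta>. (LINT z|lebesgue. \<psi> n z * disk_kernel (d n) (z - \<zeta>)) / of_real pi"
      have am: "a \<in> borel_measurable lebesgue" using a by auto
      show "(\<lambda>\<zeta>. a \<zeta> * \<Psi> \<zeta>) \<in> borel_measurable lebesgue"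
        by (intro borel_measurable_times am measurable_completion)
          (simp add: borel_measurable_continuous_onI[OF \<Psi>c])
      have sym: "disk_kernel (d n) (z - \<zeta>) = disk_kernel (d n) (\<zeta> - z)" for n z \<zeta>
        by (simp add: disk_kernel_def norm_minus_commute)
      \<comment> \<open>Up to the symmetry of the disk kernel, \<open>?A n\<close> is the d-bar
        derivative of a regularized Cauchy transform of \<open>\<psi> n\<close>; its continuity is
        part of \<open>cauchy_reg_C1\<close>.\<close>
      have "continuous_on UNIV (\<lambda>\<zeta>. LINT z|lebesgue. \<psi> n z / of_real pi * disk_kernel (d n) (\<zeta> - z))" for n
        using cauchy_reg_C1[OF \<psi>i d(1), of n n] by (auto simp: wirtinger_C1_def)
      then have "continuous_on UNIV (?A n)" for n
        unfolding sym by simp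
      then have "?A n \<in> borel_measurable borel" for n
        by (rule borel_measurable_continuous_onI)
      then have "?A n \<in> borel_measurable lborel" for n
        by simp
      then show "(\<lambda>\<zeta>. a \<zeta> * ?A n \<zeta>) \<in> borel_measurable lebesgue" for n
        by (intro borel_measurable_times am measurable_completion)
      show "integrable lebesgue (\<lambda>\<zeta>. C * B * norm (a \<zeta>))" using a by simp
      show "AE \<zeta> in lebesgue. norm (a \<zeta> * ?A n \<zeta>) \<le> C * B * norm (a \<zeta>)" for n
      proof (rule AE_I2)
        fix \<zeta>
        \<comment> \<open>With \<open>c = 0\<close> the estimate for the deviation of an average
          bounds the average itself.\<close>
        have "norm (?A n \<zeta> - 0) \<le> C * B"
          by (rule disk_average[OF \<psi>i d(1)]) (use \<psi>b in simp)
        then have "norm (a \<zeta>) * norm (?A n \<zeta>) \<le> norm (a \<zeta>) * (C * B)"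
          by (intro mult_left_mono) auto
        then show "norm (a \<zeta> * ?A n \<zeta>) \<le> C * B * norm (a \<zeta>)"
          by (simp only: norm_mult mult.commute)
      qed
      show "AE \<zeta> in lebesgue. (\<lambda>n. a \<zeta> * ?A n \<zeta>) \<longlonglongrightarrow> a \<zeta> * \<Psi> \<zeta>"
      proof (intro AE_I2 tendsto_mult_left)
        fix \<zeta>
        \<comment> \<open>Both the function \<open>\<psi> n\<close> and the radius of the disk vary
          with \<open>n\<close>, so the limit of the averages requires convergence along every
          sequence that tends to the centre.\<close>
        have \<psi>lim: "(\<lambda>n. \<psi> n (x n)) \<longlonglongrightarrow> \<Psi> \<zeta>" if x: "x \<longlonglongrightarrow> \<zeta>" for x
        proof -
          have c: "continuous_on UNIV (\<lambda>z. indicator unit_disk z *\<^sub>R (\<phi> z * u z))"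
            by (rule continuous_on_extend_zero[OF _ K]) (use z0 \<phi>d u in \<open>auto intro!: continuous_intros\<close>)
          then have "(\<lambda>n. indicator unit_disk (x n) *\<^sub>R (\<phi> (x n) * u (x n))) \<longlonglongrightarrow> indicator unit_disk \<zeta> *\<^sub>R (\<phi> \<zeta> * u \<zeta>)"
            using x by (intro isCont_tendsto_compose[OF _ x]) (simp add: continuous_on_eq_continuous_at)
          from tendsto_mult[OF slim[OF x] this] show ?thesis
            by (simp add: \<psi>_def \<Psi>_def mult.assoc)
        qed
        show "(\<lambda>n. ?A n \<zeta>) \<longlonglongrightarrow> \<Psi> \<zeta>"
        proof (rule LIMSEQ_I)
          fix e :: real assume e: "e > 0"
          then have "e / 2 > 0" by simp
          from continuous_convergence_ball[where f=\<psi>, OF d(1,2) this \<psi>lim] obtain N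
            where N: "\<And>n z. n \<ge> N \<Longrightarrow> z \<in> ball \<zeta> (d n) \<Longrightarrow> norm (\<psi> n z - \<Psi> \<zeta>) \<le> e / 2"
            by blast
          have "norm (?A n \<zeta> - \<Psi> \<zeta>) < e" if n: "n \<ge> N" for n
          proof -
            have "norm (?A n \<zeta> - \<Psi> \<zeta>) \<le> e / 2"
              by (rule disk_average[OF \<psi>i d(1)]) (rule N[OF n])
            then show ?thesis using e by linarith
          qed
          then show "\<exists>N. \<forall>n\<ge>N. norm (?A n \<zeta> - \<Psi> \<zeta>) < e" by blast
        qed
      qed
    qed
    have eqn: "(LINT z:unit_disk|lebesgue. s n z * (q' z * u z))
      = - ((LINT z:unit_disk|lebesgue. s n z * (\<phi> z * g z)) + (LINT z:unit_disk|lebesgue. \<phi> z * (s n z * M n z * u z)))" for n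
    proof -
      have sd: "continuous_on unit_disk (s n)" "continuous_on unit_disk (M n)"
        using sc Mc continuous_on_subset by blast+
      have "weak_dbar \<i> (\<lambda>z. s n z * u z) (\<lambda>z. s n z * g z + s n z * M n z * u z)"
        by (rule weak_dbar_mult_C1[OF ug wirtinger_C1_subset[OF sC]]) simp
      then have "(LINT z:unit_disk|lebesgue. q' z * (s n z * u z))
         = - (LINT z:unit_disk|lebesgue. \<phi> z * (s n z * g z + s n z * M n z * u z))"
        using \<phi> by (simp add: weak_dbar_complex_iff)
      moreover have "(LINT z:unit_disk|lebesgue. \<phi> z * (s n z * g z + s n z * M n z * u z))
        = (LINT z:unit_disk|lebesgue. \<phi> z * (s n z * g z)) + (LINT z:unit_disk|lebesgue. \<phi> z * (s n z * M n z * u z))"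
        unfolding distrib_left
        by (rule set_integral_add(2); rule complex_test_integrable(1)[OF locally_integrable_mult \<phi>])
          (use li sd in \<open>auto intro: continuous_intros\<close>)
      ultimately show ?thesis by (simp add: mult.left_commute)
    qed
    have "(\<lambda>n. LINT z:unit_disk|lebesgue. s n z * (q' z * u z))
      \<longlonglongrightarrow> - ((LINT z:unit_disk|lebesgue. S z * (\<phi> z * g z)) + (LINT \<zeta>|lebesgue. a \<zeta> * \<Psi> \<zeta>))"
      unfolding eqn by (intro tendsto_intros L2 L3)
    then have "(LINT z:unit_disk|lebesgue. S z * (q' z * u z))
        = - ((LINT z:unit_disk|lebesgue. S z * (\<phi> z * g z)) + (LINT \<zeta>|lebesgue. a \<zeta> * \<Psi> \<zeta>))"
      using LIMSEQ_unique[OF L1] by blast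
    moreover have "(LINT \<zeta>|lebesgue. a \<zeta> * \<Psi> \<zeta>) = (LINT z:unit_disk|lebesgue. \<phi> z * (S z * (u z * a z)))"
      unfolding set_lebesgue_integral_def \<Psi>_def by (intro Bochner_Integration.integral_cong) auto
    moreover have "(LINT z:unit_disk|lebesgue. \<phi> z * (S z * g z)) + (LINT z:unit_disk|lebesgue. \<phi> z * (S z * (u z * a z)))
      = (LINT z:unit_disk|lebesgue. \<phi> z * (S z * g z) + \<phi> z * (S z * (u z * a z)))"
      by (rule set_integral_add(2)[symmetric]; rule complex_test_integrable(1)[OF locally_integrable_mult \<phi>])
        (use li liau Sd in auto)
    ultimately have "(LINT z:unit_disk|lebesgue. S z * (q' z * u z))
      = - (LINT z:unit_disk|lebesgue. \<phi> z * (S z * g z) + \<phi> z * (S z * (u z * a z)))"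
      by (simp only: mult.left_commute[of "S _"])
    then show ?thesis by (simp add: algebra_simps)
  qed
  show ?thesis
    unfolding weak_dbar_complex_iff using LI main unfolding S_def by blast
qed

section \<open>Uniqueness of weak derivatives\<close>

lemma wirtinger_C1_add:
  assumes "wirtinger_C1 S f p q" "wirtinger_C1 S g r s"
  shows "wirtinger_C1 S (\<lambda>z. f z + g z) (\<lambda>z. p z + r z) (\<lambda>z. q z + s z)"
  using assms unfolding wirtinger_C1_def
  by (auto intro!: continuous_intros derivative_eq_intros simp: algebra_simps)

lemma real_polynomial_function_C1:
  fixes f :: "complex \<Rightarrow> real"
  assumes "real_polynomial_function f"
  shows "\<exists>p q. wirtinger_C1 UNIV (\<lambda>z. of_real (f z)) p q"
  using assms
proof (induction rule: real_polynomial_function.induct)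
  case (linear f)
  note has_derivative_real_wirtinger[OF bounded_linear_imp_has_derivative[OF linear]]
  then show ?case unfolding wirtinger_C1_def
    by (intro exI[of _ "\<lambda>_. (of_real (f 1) - \<i> * of_real (f \<i>)) / 2"] exI[of _ "\<lambda>_. (of_real (f 1) + \<i> * of_real (f \<i>)) / 2"])
      auto
next
  case (const c)
  have "wirtinger_C1 UNIV (\<lambda>z. complex_of_real c) (\<lambda>_. 0) (\<lambda>_. 0)"
    by (simp add: wirtinger_C1_def)
  then show ?case by blast
next
  case (add f g)
  then obtain p q r s where "wirtinger_C1 UNIV (\<lambda>z. of_real (f z)) p q" "wirtinger_C1 UNIV (\<lambda>z. of_real (g z)) r s"
    by blast
  then have "wirtinger_C1 UNIV (\<lambda>z. of_real (f z) + of_real (g z)) (\<lambda>z. p z + r z) (\<lambda>z. q z + s z)"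
    by (rule wirtinger_C1_add)
  then show ?case by auto
next
  case (mult f g)
  then show ?case using wirtinger_C1_mult by fastforce
qed

text \<open>Squaring the positive part makes the function \<open>C\<^sup>1\<close> across the circle
  of radius \<open>r\<close>. The norm enters only through its square, so the derivative is explicit
  everywhere, the origin included.\<close>

definition bump :: "real \<Rightarrow> complex \<Rightarrow> real"
  where "bump r w = (max 0 (r\<^sup>2 - (norm w)\<^sup>2))\<^sup>2"

text \<open>The real factor common to the two Wirtinger derivatives of the bump; they arise from it
  by multiplication with \<open>cnj w\<close> and \<open>w\<close>.\<close>

definition bump_slope :: "real \<Rightarrow> complex \<Rightarrow> real"
  where "bump_slope r w = - 2 * max 0 (r\<^sup>2 - (norm w)\<^sup>2)"

lemma bump_C1:
  "wirtinger_C1 UNIV (\<lambda>z. of_real (bump r (z - c)))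
    (\<lambda>z. of_real (bump_slope r (z - c)) * cnj (z - c))
    (\<lambda>z. of_real (bump_slope r (z - c)) * (z - c))"
proof -
  have m: "((\<lambda>t::real. (max 0 t)\<^sup>2) has_real_derivative 2 * max 0 t) (at t)" for t
  proof -
    consider "t > 0" | "t < 0" | "t = 0" by linarith
    then show ?thesis
    proof cases
      case 1
      have "((\<lambda>t::real. t\<^sup>2) has_real_derivative 2 * max 0 t) (at t)"
        using 1 by (auto intro!: derivative_eq_intros)
      then show ?thesis
        by (rule has_field_derivative_transform_within_open[of _ _ _ "{0<..}"]) (use 1 in auto)
    next
      case 2
      have "((\<lambda>t::real. 0) has_real_derivative 2 * max 0 t) (at t)" using 2 by simp
      then show ?thesis
        by (rule has_field_derivative_transform_within_open[of _ _ _ "{..<0}"]) (use 2 in auto)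
    next
      case 3
      have "(\<lambda>h::real. ((max 0 (t + h))\<^sup>2 - (max 0 t)\<^sup>2) / h) \<midarrow>0\<rightarrow> 0"
      proof (rule Lim_null_comparison)
        show "eventually (\<lambda>h. norm (((max 0 (t + h))\<^sup>2 - (max 0 t)\<^sup>2) / h) \<le> \<bar>h\<bar>) (at (0::real))"
        proof (intro always_eventually allI)
          fix h :: real
          show "norm (((max 0 (t + h))\<^sup>2 - (max 0 t)\<^sup>2) / h) \<le> \<bar>h\<bar>"
            using 3 by (cases "h > 0") (auto simp: power2_eq_square max_def)
        qed
        show "((\<lambda>h. \<bar>h\<bar>) \<longlongrightarrow> 0) (at (0::real))" by (intro tendsto_rabs_zero tendsto_ident_at)
      qed
      then show ?thesis using 3 by (simp add: DERIV_def)
    qed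
  qed
  have n: "((\<lambda>z. r\<^sup>2 - (norm (z - c))\<^sup>2) has_derivative (\<lambda>h. - 2 * ((z - c) \<bullet> h))) (at z)" for z
    unfolding power2_norm_eq_inner
    by (auto intro!: derivative_eq_intros simp: inner_commute algebra_simps)
  have "((\<lambda>z. complex_of_real ((max 0 (r\<^sup>2 - (norm (z - c))\<^sup>2))\<^sup>2)) has_derivative
      (\<lambda>h. of_real (- 2 * max 0 (r\<^sup>2 - (norm (z - c))\<^sup>2)) * cnj (z - c) * h
        + of_real (- 2 * max 0 (r\<^sup>2 - (norm (z - c))\<^sup>2)) * (z - c) * cnj h)) (at z)" for z
  proof -
    have "((\<lambda>z. (max 0 (r\<^sup>2 - (norm (z - c))\<^sup>2))\<^sup>2) has_derivative
        (\<lambda>h. 2 * max 0 (r\<^sup>2 - (norm (z - c))\<^sup>2) * (- 2 * ((z - c) \<bullet> h)))) (at z)"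
      using has_derivative_compose[OF n m[unfolded has_field_derivative_def]] .
    then have "((\<lambda>z. complex_of_real ((max 0 (r\<^sup>2 - (norm (z - c))\<^sup>2))\<^sup>2)) has_derivative
        (\<lambda>h. of_real (2 * max 0 (r\<^sup>2 - (norm (z - c))\<^sup>2) * (- 2 * ((z - c) \<bullet> h))))) (at z)"
      by (rule has_derivative_of_real)
    then show ?thesis
    proof (rule has_derivative_eq_rhs, intro ext)
      fix h
      \<comment> \<open>Written with conjugates, the real inner product splits the derivative into
        its two Wirtinger parts.\<close>
      have "of_real (2 * ((z - c) \<bullet> h)) = cnj (z - c) * h + (z - c) * cnj h"
        by (simp add: complex_eq_iff inner_complex_def algebra_simps)
      then have "of_real (- 2 * max 0 (r\<^sup>2 - (norm (z - c))\<^sup>2)) * of_real (2 * ((z - c) \<bullet> h))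
        = of_real (- 2 * max 0 (r\<^sup>2 - (norm (z - c))\<^sup>2)) * (cnj (z - c) * h + (z - c) * cnj h)"
        by (rule arg_cong)
      then show "of_real (2 * max 0 (r\<^sup>2 - (norm (z - c))\<^sup>2) * (- 2 * ((z - c) \<bullet> h)))
        = of_real (- 2 * max 0 (r\<^sup>2 - (norm (z - c))\<^sup>2)) * cnj (z - c) * h
        + of_real (- 2 * max 0 (r\<^sup>2 - (norm (z - c))\<^sup>2)) * (z - c) * cnj h"
        by (simp add: distrib_left mult.assoc mult.left_commute)
    qed
  qed
  then show ?thesis
    unfolding wirtinger_C1_def bump_def bump_slope_def by (auto intro!: continuous_intros)
qed

lemma bump_test:
  assumes "cball c r \<subseteq> unit_disk" "r \<ge> 0"
  shows "complex_test (\<lambda>z. of_real (bump r (z - c)))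
    (\<lambda>z. of_real (bump_slope r (z - c)) * cnj (z - c))
    (\<lambda>z. of_real (bump_slope r (z - c)) * (z - c))"
  unfolding complex_test_def
proof (intro conjI bump_C1 exI[of _ "cball c r"] allI impI)
  fix z assume "z \<notin> cball c r"
  then have "r < norm (z - c)" by (simp add: dist_norm norm_minus_commute)
  then have "r\<^sup>2 \<le> (norm (z - c))\<^sup>2" using assms(2) by (intro power_mono) auto
  then show "complex_of_real (bump r (z - c)) = 0" by (simp add: bump_def)
qed (use assms in auto)

text \<open>The sign of \<open>f\<close> is approximated almost everywhere by polynomials, uniformly bounded on
  the disk.\<close>

lemma zero_AE_if_orthogonal_polynomials:
  fixes f :: "complex \<Rightarrow> real"
  assumes f: "integrable lebesgue f" "\<And>z. z \<notin> cball 0 1 \<Longrightarrow> f z = 0"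
    and o: "\<And>g. real_polynomial_function g \<Longrightarrow> (LINT z|lebesgue. g z * f z) = 0"
  shows "AE z in lebesgue. f z = 0"
proof -
  have fm: "f \<in> borel_measurable lebesgue" using f by auto
  have "(\<lambda>z. sgn (f z)) \<in> borel_measurable (lebesgue_on UNIV)"
    using measurable_compose[OF fm borel_measurable_sgn] by simp
  then have "(\<lambda>z. sgn (f z)) measurable_on UNIV"
    by (intro lebesgue_measurable_imp_measurable_on) (auto simp: lebesgue_on_UNIV_eq)
  then obtain N g where N: "negligible N" and g: "\<And>n. continuous_on UNIV (g n)"
    "\<And>z. z \<notin> N \<Longrightarrow> (\<lambda>n. g n z) \<longlonglongrightarrow> sgn (f z)"
    unfolding measurable_on_def by auto
  \<comment> \<open>Clamping to the interval from -1 to 1 does not affect the limit, which is a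
    sign, and gives a uniform bound; a polynomial error of at most 1 then raises the bound to
    2.\<close>
  define h where "h n z = max (-1) (min 1 (g n z))" for n :: nat and z
  have hc: "continuous_on (cball 0 1) (h n)" for n
    unfolding h_def by (intro continuous_intros continuous_on_subset[OF g(1)]) auto
  have "\<exists>p. real_polynomial_function p \<and> (\<forall>z\<in>cball 0 1. \<bar>h n z - p z\<bar> < inverse (real (Suc n)))" for n
    using Stone_Weierstrass_real_polynomial_function[OF compact_cball hc, of "inverse (real (Suc n))" n] by (metis inverse_positive_iff_positive of_nat_0_less_iff zero_less_Suc)
  then obtain p where p: "\<And>n. real_polynomial_function (p n)"
    "\<And>n z. z \<in> cball 0 1 \<Longrightarrow> \<bar>h n z - p n z\<bar> < inverse (real (Suc n))"
    by metis
  have pb: "\<bar>p n z\<bar> \<le> 2" if "z \<in> cball 0 1" for n z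
  proof -
    have "inverse (real (Suc n)) \<le> 1" by (simp add: inverse_eq_divide)
    moreover have "\<bar>h n z\<bar> \<le> 1" by (auto simp: h_def)
    ultimately show ?thesis using p(2)[OF that, of n] by linarith
  qed
  have plim: "(\<lambda>n. p n z) \<longlonglongrightarrow> sgn (f z)" if "z \<notin> N" "z \<in> cball 0 1" for z
  proof -
    have "(\<lambda>n. h n z) \<longlonglongrightarrow> max (-1) (min 1 (sgn (f z)))"
      unfolding h_def by (intro tendsto_intros g(2) that)
    moreover have "max (-1) (min 1 (sgn (f z))) = sgn (f z)" by (simp add: sgn_if)
    moreover have "(\<lambda>n. p n z - h n z) \<longlonglongrightarrow> 0"
      by (rule Lim_null_comparison[OF _ LIMSEQ_inverse_real_of_nat])
        (use p(2)[OF that(2)] in \<open>auto simp: abs_minus_commute intro!: always_eventually less_imp_le\<close>)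
    ultimately show ?thesis using tendsto_add[of "\<lambda>n. p n z - h n z" 0 sequentially "\<lambda>n. h n z"] by simp
  qed
  have "(\<lambda>n. LINT z|lebesgue. p n z * f z) \<longlonglongrightarrow> (LINT z|lebesgue. \<bar>f z\<bar>)"
  proof (rule integral_dominated_convergence)
    show "(\<lambda>z. \<bar>f z\<bar>) \<in> borel_measurable lebesgue" using fm by measurable
    show "(\<lambda>z. p n z * f z) \<in> borel_measurable lebesgue" for n
    proof -
      have "p n \<in> borel_measurable borel"
        using continuous_on_polymonial_function[of "p n" UNIV] p(1)[of n]
        by (intro borel_measurable_continuous_onI) (simp add: real_polynomial_function_eq)
      then have "p n \<in> borel_measurable lebesgue" by (intro measurable_completion) simp
      then show ?thesis using fm by (rule borel_measurable_times)
    qed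
    show "integrable lebesgue (\<lambda>z. 2 * \<bar>f z\<bar>)" using f by auto
    have "AE z in lebesgue. z \<notin> N" using N by (simp add: negligible_iff_null_sets AE_not_in)
    then show "AE z in lebesgue. (\<lambda>n. p n z * f z) \<longlonglongrightarrow> \<bar>f z\<bar>"
    proof eventually_elim
      case (elim z)
      show ?case
      proof (cases "z \<in> cball 0 1")
        case True
        have "(\<lambda>n. p n z * f z) \<longlonglongrightarrow> sgn (f z) * f z" by (intro tendsto_intros plim elim True)
        moreover have "sgn (f z) * f z = \<bar>f z\<bar>" by (simp add: sgn_if)
        ultimately show ?thesis by simp
      qed (simp add: f(2))
    qed
    show "AE z in lebesgue. norm (p n z * f z) \<le> 2 * \<bar>f z\<bar>" for n
    proof (rule AE_I2)
      fix z show "norm (p n z * f z) \<le> 2 * \<bar>f z\<bar>"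
        using pb[of z n] f(2)[of z] by (cases "z \<in> cball 0 1") (auto simp: abs_mult intro!: mult_right_mono)
    qed
  qed
  then have "(LINT z|lebesgue. \<bar>f z\<bar>) = 0" using o[OF p(1)] by (simp add: LIMSEQ_const_iff)
  then have "AE z in lebesgue. \<bar>f z\<bar> = 0"
    using f(1) by (subst (asm) integral_nonneg_eq_0_iff_AE) auto
  then show ?thesis by simp
qed

text \<open>The difference \<open>k\<close> of the two derivatives is orthogonal to all test
  functions. A polynomial times a bump is a test function, so \<open>k\<close> times the bump is
  orthogonal to all polynomials and vanishes almost everywhere; the bump is positive on
  \<open>ball 0 r\<close>, and \<open>r\<close> runs to 1.\<close>

lemma weak_dbar_unique:
  assumes "weak_dbar \<i> u g" "weak_dbar \<i> u h"
  shows "AE z in lebesgue. z \<in> unit_disk \<longrightarrow> g z = h z"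
proof -
  define k where "k z = g z - h z" for z
  have li: "locally_integrable g" "locally_integrable h" using assms by (auto simp: weak_dbar_def)
  have k: "locally_integrable k"
    using li unfolding k_def by (auto simp: locally_integrable_def intro: set_integral_diff(1))
  have ko: "(LINT z:unit_disk|lebesgue. \<phi> z * k z) = 0" if \<phi>: "complex_test \<phi> p q" for \<phi> p q
  proof -
    have "(LINT z:unit_disk|lebesgue. \<phi> z * g z) = (LINT z:unit_disk|lebesgue. \<phi> z * h z)"
    proof -
      have "(LINT z:unit_disk|lebesgue. q z * u z) = - (LINT z:unit_disk|lebesgue. \<phi> z * g z)"
        using assms(1) \<phi> unfolding weak_dbar_complex_iff by blast
      moreover have "(LINT z:unit_disk|lebesgue. q z * u z) = - (LINT z:unit_disk|lebesgue. \<phi> z * h z)"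
        using assms(2) \<phi> unfolding weak_dbar_complex_iff by blast
      ultimately show ?thesis by simp
    qed
    moreover have "(LINT z:unit_disk|lebesgue. \<phi> z * k z) = (LINT z:unit_disk|lebesgue. \<phi> z * g z) - (LINT z:unit_disk|lebesgue. \<phi> z * h z)"
      unfolding k_def right_diff_distrib
      by (intro set_integral_diff(2) complex_test_integrable(1)[OF _ \<phi>] li)
    ultimately show ?thesis by simp
  qed
  have "AE z in lebesgue. z \<in> ball 0 r \<longrightarrow> k z = 0" if r: "0 < r" "r < 1" for r
  proof -
    define b where "b z = bump r z" for z
    have sub: "cball 0 r \<subseteq> unit_disk" using r by auto
    have bt: "complex_test (\<lambda>z. of_real (b z)) (\<lambda>z. of_real (bump_slope r z) * cnj z)
      (\<lambda>z. of_real (bump_slope r z) * z)"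
      using bump_test[OF sub] r by (simp add: b_def)
    define F where "F z = indicator unit_disk z *\<^sub>R (of_real (b z) * k z)" for z
    have Fi: "integrable lebesgue F"
      using complex_test_integrable(1)[OF k bt] by (simp add: F_def[abs_def] set_integrable_def)
    have Fo: "(LINT z|lebesgue. of_real (p z) * F z) = 0" if p: "real_polynomial_function p" for p
    proof -
      obtain p1 p2 where "wirtinger_C1 UNIV (\<lambda>z. of_real (p z)) p1 p2"
        using real_polynomial_function_C1[OF p] by blast
      then have "wirtinger_C1 unit_disk (\<lambda>z. of_real (p z)) p1 p2" by (rule wirtinger_C1_subset) simp
      from ko[OF complex_test_mult[OF bt this]]
      have "(LINT z:unit_disk|lebesgue. of_real (b z) * of_real (p z) * k z) = 0" .
      then show ?thesis by (simp add: set_lebesgue_integral_def F_def mult.assoc mult.left_commute)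
    qed
    have Fpi: "integrable lebesgue (\<lambda>z. of_real (p z) * F z)" if p: "real_polynomial_function p" for p
    proof -
      obtain p1 p2 where "wirtinger_C1 UNIV (\<lambda>z. of_real (p z)) p1 p2"
        using real_polynomial_function_C1[OF p] by blast
      then have "wirtinger_C1 unit_disk (\<lambda>z. of_real (p z)) p1 p2" by (rule wirtinger_C1_subset) simp
      from complex_test_integrable(1)[OF k complex_test_mult[OF bt this]]
      show ?thesis by (simp add: set_integrable_def F_def mult.assoc mult.left_commute)
    qed
    have "AE z in lebesgue. Re (F z) = 0"
    proof (rule zero_AE_if_orthogonal_polynomials)
      show "(LINT z|lebesgue. p z * Re (F z)) = 0" if "real_polynomial_function p" for p
        using arg_cong[OF Fo[OF that], of Re] integral_Re[OF Fpi[OF that]] by simp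
    qed (use integrable_Re[OF Fi] in \<open>auto simp: F_def\<close>)
    moreover have "AE z in lebesgue. Im (F z) = 0"
    proof (rule zero_AE_if_orthogonal_polynomials)
      show "(LINT z|lebesgue. p z * Im (F z)) = 0" if "real_polynomial_function p" for p
        using arg_cong[OF Fo[OF that], of Im] integral_Im[OF Fpi[OF that]] by simp
    qed (use integrable_Im[OF Fi] in \<open>auto simp: F_def\<close>)
    ultimately show ?thesis
    proof eventually_elim
      case (elim z)
      show ?case
      proof
        assume z: "z \<in> ball 0 r"
        then have "norm z < r" by simp
        then have "(norm z)\<^sup>2 < r\<^sup>2" by (intro power_strict_mono) auto
        then have "b z \<noteq> 0" by (simp add: b_def bump_def)
        moreover have "F z = 0" using elim by (simp add: complex_eq_iff)
        ultimately show "k z = 0" using z r by (auto simp: F_def)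
      qed
    qed
  qed
  \<comment> \<open>Countably many radii suffice to exhaust the disk, so the exceptional null sets
    can be united; \<open>Suc (Suc n)\<close> keeps the radii positive.\<close>
  moreover have "0 < 1 - inverse (real (Suc (Suc n)))" "1 - inverse (real (Suc (Suc n))) < 1" for n
    by (auto simp: field_simps)
  ultimately have "AE z in lebesgue. \<forall>n. z \<in> ball 0 (1 - inverse (real (Suc (Suc n)))) \<longrightarrow> k z = 0"
    unfolding AE_all_countable by blast
  then show ?thesis
  proof eventually_elim
    case (elim z)
    show ?case
    proof
      assume "z \<in> unit_disk"
      then obtain n where "inverse (real (Suc n)) < 1 - norm z" using reals_Archimedean[of "1 - norm z"] by auto
      moreover have "inverse (real (Suc (Suc n))) \<le> inverse (real (Suc n))" by (simp add: field_simps)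
      ultimately have "norm z < 1 - inverse (real (Suc (Suc n)))" by linarith
      then have "z \<in> ball 0 (1 - inverse (real (Suc (Suc n))))" by (simp only: mem_ball_0)
      then have "k z = 0" using elim by blast
      then show "g z = h z" by (simp add: k_def)
    qed
  qed
qed

section \<open>Weyl's lemma\<close>

lemma bump_bounds:
  assumes "\<epsilon> > 0"
  shows "\<bar>bump \<epsilon> w\<bar> \<le> \<epsilon> ^ 4" "0 \<le> bump \<epsilon> w" "\<bar>bump_slope \<epsilon> w\<bar> * norm w \<le> 2 * \<epsilon> ^ 3"
    "bump \<epsilon> w \<noteq> 0 \<longleftrightarrow> norm w < \<epsilon>" "\<epsilon> \<le> norm w \<Longrightarrow> bump_slope \<epsilon> w = 0"
proof -
  have m: "max 0 (\<epsilon>\<^sup>2 - (norm w)\<^sup>2) \<le> \<epsilon>\<^sup>2" by simp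
  show "0 \<le> bump \<epsilon> w" by (simp add: bump_def)
  have "bump \<epsilon> w \<le> (\<epsilon>\<^sup>2)\<^sup>2" unfolding bump_def using m by (intro power_mono) auto
  then show "\<bar>bump \<epsilon> w\<bar> \<le> \<epsilon> ^ 4" by (simp add: bump_def)
  have lt: "0 < \<epsilon>\<^sup>2 - (norm w)\<^sup>2" if "norm w < \<epsilon>"
    using power_strict_mono[OF that, of 2] by simp
  have ge: "max 0 (\<epsilon>\<^sup>2 - (norm w)\<^sup>2) = 0" if "\<epsilon> \<le> norm w"
    using power_mono[OF that, of 2] assms by simp
  show "bump \<epsilon> w \<noteq> 0 \<longleftrightarrow> norm w < \<epsilon>" using lt ge by (cases "norm w < \<epsilon>") (auto simp: bump_def)
  show "bump_slope \<epsilon> w = 0" if "\<epsilon> \<le> norm w" using ge[OF that] by (simp add: bump_slope_def)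
  show "\<bar>bump_slope \<epsilon> w\<bar> * norm w \<le> 2 * \<epsilon> ^ 3"
  proof (cases "norm w < \<epsilon>")
    case True
    then have "max 0 (\<epsilon>\<^sup>2 - (norm w)\<^sup>2) * norm w \<le> \<epsilon>\<^sup>2 * \<epsilon>"
      using m by (intro mult_mono) auto
    moreover have "\<bar>bump_slope \<epsilon> w\<bar> = 2 * max 0 (\<epsilon>\<^sup>2 - (norm w)\<^sup>2)" by (simp add: bump_slope_def)
    ultimately show ?thesis by (simp add: power2_eq_square power3_eq_cube)
  next
    case False
    then have "max 0 (\<epsilon>\<^sup>2 - (norm w)\<^sup>2) = 0" using ge by simp
    then show ?thesis using assms by (simp add: bump_slope_def)
  qed
qed

lemma continuous_on_bump: "continuous_on UNIV (bump \<epsilon>)"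
  unfolding bump_def by (intro continuous_intros)

text \<open>Positivity, needed to normalize the bump: a nonnegative function with zero integral
  vanishes almost everywhere, but the bump is nonzero on a disk.\<close>

lemma bump_integral:
  assumes "\<epsilon> > 0"
  shows "integrable lebesgue (bump \<epsilon>)" "(LINT w|lebesgue. bump \<epsilon> w) > 0"
proof -
  have bm: "bump \<epsilon> \<in> borel_measurable lebesgue"
    by (intro measurable_completion) (simp add: borel_measurable_continuous_onI continuous_on_bump)
  show bi: "integrable lebesgue (bump \<epsilon>)"
  proof (rule Bochner_Integration.integrable_bound[OF _ bm])
    show "integrable lebesgue (\<lambda>w::complex. indicator (ball 0 \<epsilon>) w * \<epsilon> ^ 4 :: real)"
      using lmeasurable_ball[of "0::complex" \<epsilon>]
      by (intro integrable_mult_left) (simp add: lmeasurable_iff_integrable)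
    show "AE w in lebesgue. norm (bump \<epsilon> w) \<le> norm (indicator (ball 0 \<epsilon>) w * \<epsilon> ^ 4 :: real)"
    proof (rule AE_I2)
      fix w :: complex
      show "norm (bump \<epsilon> w) \<le> norm (indicator (ball 0 \<epsilon>) w * \<epsilon> ^ 4 :: real)"
        using bump_bounds(1,4)[OF assms, of w] assms by (cases "norm w < \<epsilon>") auto
    qed
  qed
  have "(LINT w|lebesgue. bump \<epsilon> w) \<noteq> 0"
  proof
    assume "(LINT w|lebesgue. bump \<epsilon> w) = 0"
    then have "AE w in lebesgue. bump \<epsilon> w = 0"
      using bi bump_bounds(2)[OF assms] by (subst (asm) integral_nonneg_eq_0_iff_AE) auto
    then have "AE w in lebesgue. w \<notin> ball (0::complex) \<epsilon>"
      by eventually_elim (use bump_bounds(4)[OF assms] in auto)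
    then have "ball (0::complex) \<epsilon> \<in> null_sets lebesgue"
      by (subst AE_iff_null_sets[of "ball (0::complex) \<epsilon>" lebesgue]) simp_all
    then have "emeasure lebesgue (ball (0::complex) \<epsilon>) = 0" by (rule null_setsD1)
    then show False using emeasure_lebesgue_ball_complex[of \<epsilon> 0] assms by simp
  qed
  moreover have "(LINT w|lebesgue. bump \<epsilon> w) \<ge> 0" by (rule Bochner_Integration.integral_nonneg) (rule bump_bounds(2)[OF assms])
  ultimately show "(LINT w|lebesgue. bump \<epsilon> w) > 0" by simp
qed

lemma holomorphic_on_disk_if_smaller:
  assumes "\<And>r. 0 < r \<Longrightarrow> r < 1 \<Longrightarrow> f holomorphic_on ball 0 r"
  shows "f holomorphic_on unit_disk"
proof -
  have "\<exists>f'. (f has_field_derivative f') (at z)" if z: "z \<in> unit_disk" for z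
  proof -
    obtain r where r: "norm z < r" "r < 1" using z dense[of "norm z" 1] by auto
    then have "f holomorphic_on ball 0 r" using norm_ge_zero[of z] by (intro assms) linarith+
    then show ?thesis using r by (auto simp: holomorphic_on_open)
  qed
  then show ?thesis by (simp add: holomorphic_on_open)
qed

text \<open>Mollification. Up to normalization, the mollified function at \<open>z\<close> pairs
  \<open>u\<close> with a bump about \<open>z\<close>; its d-bar derivative pairs \<open>u\<close>
  with the derivative of a test function, hence is zero. Holomorphy survives the uniform limit on
  \<open>ball 0 r\<close>.\<close>

lemma weak_dbar_zero_imp_holomorphic:
  assumes u: "continuous_on unit_disk u" and w: "weak_dbar \<i> u (\<lambda>_. 0)"
  shows "u holomorphic_on unit_disk"
proof (rule holomorphic_on_disk_if_smaller)
  fix r :: real assume r: "0 < r" "r < 1"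
  \<comment> \<open>A margin between \<open>r\<close> and 1: for \<open>z\<close> in
    \<open>ball 0 r\<close> the bumps of radius \<open>\<epsilon> n \<le> R - r\<close> about
    \<open>z\<close> live in \<open>cball 0 R\<close>, where \<open>u\<close> is integrable and
    uniformly continuous.\<close>
  define R where "R = (1 + r) / 2"
  have R: "r < R" "R < 1" using r by (auto simp: R_def)
  define a where "a \<zeta> = indicator (cball 0 R) \<zeta> *\<^sub>R u \<zeta>" for \<zeta>
  have a: "integrable lebesgue a"
  proof -
    have "set_integrable lebesgue (cball 0 R) u"
    proof -
      have "cball (0::complex) R \<subseteq> unit_disk" using R by auto
      moreover have "locally_integrable u" using w by (simp add: weak_dbar_def)
      ultimately show ?thesis unfolding locally_integrable_def using compact_cball by blast
    qed
    then show ?thesis by (simp add: a_def[abs_def] set_integrable_def)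
  qed
  define \<epsilon> where "\<epsilon> n = (R - r) * inverse (real (Suc n))" for n
  have \<epsilon>: "\<epsilon> n > 0" "r + \<epsilon> n \<le> R" for n
  proof -
    show "\<epsilon> n > 0" using R by (simp add: \<epsilon>_def)
    have "(R - r) * inverse (real (Suc n)) \<le> (R - r) * 1"
      using R by (intro mult_left_mono) (auto simp: inverse_eq_divide)
    then show "r + \<epsilon> n \<le> R" by (simp add: \<epsilon>_def)
  qed
  have \<epsilon>0: "\<epsilon> \<longlonglongrightarrow> 0"
    unfolding \<epsilon>_def using tendsto_mult_left[OF LIMSEQ_inverse_real_of_nat, of "R - r"] by simp
  define N where "N n = (LINT w|lebesgue. bump (\<epsilon> n) w)" for n
  have N: "N n > 0" for n unfolding N_def by (rule bump_integral(2)[OF \<epsilon>(1)])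
  define U where "U n z = (LINT \<zeta>|lebesgue. a \<zeta> * of_real (bump (\<epsilon> n) (z - \<zeta>))) / of_real (N n)" for n z
  have hol: "U n holomorphic_on ball 0 r" for n
  proof -
    let ?m = "bump_slope (\<epsilon> n)"
    have BC: "wirtinger_C1 UNIV (\<lambda>w. of_real (bump (\<epsilon> n) w)) (\<lambda>w. of_real (?m w) * cnj w) (\<lambda>w. of_real (?m w) * w)"
      using bump_C1[of "\<epsilon> n" 0] by simp
    let ?B = "2 * \<epsilon> n ^ 3 + \<epsilon> n ^ 4"
    have b: "norm (of_real (?m w) * cnj w) \<le> ?B" "norm (of_real (?m w) * w) \<le> ?B" for w :: complex
      using bump_bounds(3)[OF \<epsilon>(1), of n w] \<epsilon>(1)[of n]
      by (auto simp: norm_mult intro: add_increasing2)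
    have c: "continuous_on UNIV (\<lambda>w. of_real (?m w) * cnj w)" "continuous_on UNIV (\<lambda>w::complex. of_real (?m w) * w)"
      using BC by (auto simp: wirtinger_C1_def)
    have CC: "wirtinger_C1 UNIV (\<lambda>z. LINT \<zeta>|lebesgue. a \<zeta> * of_real (bump (\<epsilon> n) (z - \<zeta>)))
      (\<lambda>z. LINT \<zeta>|lebesgue. a \<zeta> * (of_real (?m (z - \<zeta>)) * cnj (z - \<zeta>)))
      (\<lambda>z. LINT \<zeta>|lebesgue. a \<zeta> * (of_real (?m (z - \<zeta>)) * (z - \<zeta>)))"
    proof (rule wirtinger_C1_convolution[where N="{}" and L="2 * ?B" and B="?B", OF a])
      show "norm (complex_of_real (bump (\<epsilon> n) x) - of_real (bump (\<epsilon> n) y)) \<le> 2 * ?B * norm (x - y)" for x y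
        by (rule wirtinger_C1_lipschitz[OF BC b])
      show "norm (complex_of_real (bump (\<epsilon> n) x)) \<le> ?B" for x
        using bump_bounds(1)[OF \<epsilon>(1), of n x] \<epsilon>(1)[of n] by (simp add: add_increasing)
      show "((\<lambda>w. complex_of_real (bump (\<epsilon> n) w)) has_derivative (\<lambda>h. of_real (?m x) * cnj x * h + of_real (?m x) * x * cnj h)) (at x)" for x
        using BC unfolding wirtinger_C1_def by blast
      show "isCont (\<lambda>w. of_real (?m w) * cnj w) x \<and> isCont (\<lambda>w. of_real (?m w) * w) x" for x :: complex
        using c continuous_on_eq_continuous_at[OF open_UNIV] by blast
    qed (use b c in \<open>auto intro: borel_measurable_continuous_onI\<close>)
    \<comment> \<open>The bump is even, so exchanging \<open>z - \<zeta>\<close> and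
      \<open>\<zeta> - z\<close> changes only the sign of the derivative, and the integral is, up to
      sign, the left side of the weak equation tested with the bump about \<open>z\<close>.\<close>
    have q0: "(LINT \<zeta>|lebesgue. a \<zeta> * (of_real (?m (z - \<zeta>)) * (z - \<zeta>))) = 0" if z: "z \<in> ball 0 r" for z
    proof -
      have sub: "cball z (\<epsilon> n) \<subseteq> cball 0 R"
      proof
        fix x assume "x \<in> cball z (\<epsilon> n)"
        then have "norm (x - z) \<le> \<epsilon> n" by (simp add: dist_norm norm_minus_commute)
        then show "x \<in> cball 0 R" using z \<epsilon>(2)[of n] norm_triangle_sub[of x z] by simp
      qed
      then have "cball z (\<epsilon> n) \<subseteq> unit_disk" using R by auto
      from bump_test[OF this] \<epsilon>(1)[of n]
      have "(LINT \<zeta>:unit_disk|lebesgue. of_real (?m (\<zeta> - z)) * (\<zeta> - z) * u \<zeta>) = 0"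
        using w unfolding weak_dbar_complex_iff by fastforce
      moreover have sym: "?m (z - \<zeta>) = ?m (\<zeta> - z)" for \<zeta> by (simp add: bump_slope_def norm_minus_commute)
      moreover have "indicator unit_disk \<zeta> *\<^sub>R (of_real (?m (\<zeta> - z)) * (\<zeta> - z) * u \<zeta>)
        = - (a \<zeta> * (of_real (?m (z - \<zeta>)) * (z - \<zeta>)))" for \<zeta>
      proof (cases "norm (\<zeta> - z) < \<epsilon> n")
        case True
        then have "\<zeta> \<in> cball z (\<epsilon> n)" by (simp add: dist_norm norm_minus_commute)
        then have "\<zeta> \<in> cball 0 R" using sub by blast
        moreover from this have "\<zeta> \<in> unit_disk" using R by auto
        ultimately show ?thesis by (simp add: a_def sym algebra_simps)
      next
        case False
        then have "?m (\<zeta> - z) = 0"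
          using bump_bounds(5)[OF \<epsilon>(1), of n "\<zeta> - z"] by simp
        then show ?thesis by (simp add: sym)
      qed
      ultimately have "(LINT \<zeta>|lebesgue. - (a \<zeta> * (of_real (?m (z - \<zeta>)) * (z - \<zeta>)))) = 0"
        by (simp only: set_lebesgue_integral_def)
      then show ?thesis by (simp only: Bochner_Integration.integral_minus neg_equal_0_iff_equal)
    qed
    have "(\<lambda>z. LINT \<zeta>|lebesgue. a \<zeta> * of_real (bump (\<epsilon> n) (z - \<zeta>))) holomorphic_on ball 0 r"
    proof (subst holomorphic_on_open, simp, intro ballI exI)
      fix z assume z: "z \<in> ball (0::complex) r"
      show "((\<lambda>z. LINT \<zeta>|lebesgue. a \<zeta> * of_real (bump (\<epsilon> n) (z - \<zeta>))) has_field_derivative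
        (LINT \<zeta>|lebesgue. a \<zeta> * (of_real (?m (z - \<zeta>)) * cnj (z - \<zeta>)))) (at z)"
      proof -
        have "((\<lambda>z. LINT \<zeta>|lebesgue. a \<zeta> * of_real (bump (\<epsilon> n) (z - \<zeta>))) has_derivative
          (\<lambda>h. (LINT \<zeta>|lebesgue. a \<zeta> * (of_real (?m (z - \<zeta>)) * cnj (z - \<zeta>))) * h
            + (LINT \<zeta>|lebesgue. a \<zeta> * (of_real (?m (z - \<zeta>)) * (z - \<zeta>))) * cnj h)) (at z)"
          using CC unfolding wirtinger_C1_def by blast
        then show ?thesis unfolding q0[OF z] has_field_derivative_def by simp
      qed
    qed
    then show ?thesis unfolding U_def using N[of n] by (intro holomorphic_intros) auto
  qed
  have ul: "uniform_limit (ball 0 r) U u sequentially"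
  proof (rule uniform_limitI)
    fix e :: real assume e: "e > 0"
    have "uniformly_continuous_on (cball 0 R) u"
      using u R by (intro compact_uniformly_continuous) (auto intro: continuous_on_subset)
    then obtain d where d: "d > 0" "\<And>x y. x \<in> cball 0 R \<Longrightarrow> y \<in> cball 0 R \<Longrightarrow> dist y x < d \<Longrightarrow> dist (u y) (u x) < e / 2"
      using e unfolding uniformly_continuous_on_def by (meson half_gt_zero)
    have "eventually (\<lambda>n. \<epsilon> n < d) sequentially" using \<epsilon>0 d(1) by (rule order_tendstoD(2))
    then show "eventually (\<lambda>n. \<forall>z\<in>ball 0 r. dist (U n z) (u z) < e) sequentially"
    proof (eventually_elim, intro ballI)
      fix n z assume n: "\<epsilon> n < d" and z: "z \<in> ball (0::complex) r"
      have bi: "integrable lebesgue (\<lambda>\<zeta>. bump (\<epsilon> n) (z - \<zeta>))"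
        and bn: "(LINT \<zeta>|lebesgue. bump (\<epsilon> n) (z - \<zeta>)) = N n"
        using lebesgue_reflect[OF borel_measurable_continuous_onI[OF continuous_on_bump], of "\<epsilon> n" z]
          bump_integral(1)[OF \<epsilon>(1)[of n]] by (simp_all add: N_def)
      have bc: "integrable lebesgue (\<lambda>\<zeta>. complex_of_real (bump (\<epsilon> n) (z - \<zeta>)))"
        using bi by (rule integrable_of_real)
      have ai: "integrable lebesgue (\<lambda>\<zeta>. a \<zeta> * of_real (bump (\<epsilon> n) (z - \<zeta>)))"
      proof (rule integrable_mult_bounded[OF a])
        show "(\<lambda>\<zeta>. complex_of_real (bump (\<epsilon> n) (z - \<zeta>))) \<in> borel_measurable lebesgue" using bc by auto
        show "norm (complex_of_real (bump (\<epsilon> n) (z - \<zeta>))) \<le> \<epsilon> n ^ 4" for \<zeta>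
          using bump_bounds(1)[OF \<epsilon>(1)] by simp
      qed
      \<comment> \<open>\<open>u z\<close> is written as its own weighted mean, so that the error
        becomes a mean of \<open>u \<zeta> - u z\<close> over points \<open>\<zeta>\<close> within
        \<open>\<epsilon> n\<close> of \<open>z\<close>.\<close>
      have un: "u z * of_real (N n) = (LINT \<zeta>|lebesgue. u z * of_real (bump (\<epsilon> n) (z - \<zeta>)))"
        unfolding integral_mult_right_zero bn[symmetric] by simp
      have "norm ((LINT \<zeta>|lebesgue. a \<zeta> * of_real (bump (\<epsilon> n) (z - \<zeta>))) - u z * of_real (N n))
        = norm (LINT \<zeta>|lebesgue. a \<zeta> * of_real (bump (\<epsilon> n) (z - \<zeta>)) - u z * of_real (bump (\<epsilon> n) (z - \<zeta>)))"
        unfolding un using ai bc by (subst Bochner_Integration.integral_diff) auto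
      also have "\<dots> \<le> (LINT \<zeta>|lebesgue. e / 2 * bump (\<epsilon> n) (z - \<zeta>))"
      proof (rule Bochner_Integration.integral_norm_bound_integral)
        show "integrable lebesgue (\<lambda>\<zeta>. a \<zeta> * of_real (bump (\<epsilon> n) (z - \<zeta>)) - u z * of_real (bump (\<epsilon> n) (z - \<zeta>)))"
          using ai bc by (intro Bochner_Integration.integrable_diff integrable_mult_right)
        show "integrable lebesgue (\<lambda>\<zeta>. e / 2 * bump (\<epsilon> n) (z - \<zeta>))"
          using bi by (intro integrable_mult_right)
        fix \<zeta>
        show "norm (a \<zeta> * of_real (bump (\<epsilon> n) (z - \<zeta>)) - u z * of_real (bump (\<epsilon> n) (z - \<zeta>)))
          \<le> e / 2 * bump (\<epsilon> n) (z - \<zeta>)"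
        proof (cases "norm (z - \<zeta>) < \<epsilon> n")
          case True
          have "norm \<zeta> \<le> norm z + norm (z - \<zeta>)" by (metis norm_minus_commute norm_triangle_sub)
          then have "norm \<zeta> \<le> R" using True z \<epsilon>(2)[of n] by simp
          then have a': "a \<zeta> = u \<zeta>" and cb: "\<zeta> \<in> cball 0 R" "z \<in> cball 0 R"
            using z R by (auto simp: a_def)
          have "norm (u \<zeta> - u z) \<le> e / 2"
            using d(2)[OF cb(2,1)] True n by (simp add: dist_norm norm_minus_commute)
          then have "norm (u \<zeta> - u z) * bump (\<epsilon> n) (z - \<zeta>) \<le> e / 2 * bump (\<epsilon> n) (z - \<zeta>)"
            by (rule mult_right_mono) (rule bump_bounds(2)[OF \<epsilon>(1)])
          then show ?thesis unfolding a' left_diff_distrib[symmetric] norm_mult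
            using bump_bounds(2)[OF \<epsilon>(1)] by simp
        next
          case False
          then have "bump (\<epsilon> n) (z - \<zeta>) = 0" using bump_bounds(4)[OF \<epsilon>(1)] by blast
          then show ?thesis by simp
        qed
      qed
      also have "\<dots> = e / 2 * N n" using bn by simp
      finally have *: "norm ((LINT \<zeta>|lebesgue. a \<zeta> * of_real (bump (\<epsilon> n) (z - \<zeta>))) - u z * of_real (N n)) \<le> e / 2 * N n" .
      have "norm (U n z - u z) * N n \<le> e / 2 * N n"
      proof -
        have "(U n z - u z) * of_real (N n) = (LINT \<zeta>|lebesgue. a \<zeta> * of_real (bump (\<epsilon> n) (z - \<zeta>))) - u z * of_real (N n)"
          using N[of n] by (simp add: U_def field_simps)
        then have "norm (U n z - u z) * N n = norm ((LINT \<zeta>|lebesgue. a \<zeta> * of_real (bump (\<epsilon> n) (z - \<zeta>))) - u z * of_real (N n))"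
          using N[of n] by (metis abs_of_pos norm_mult norm_of_real)
        then show ?thesis using * by simp
      qed
      then have "norm (U n z - u z) \<le> e / 2" using N[of n] by simp
      then show "dist (U n z) (u z) < e" using e by (simp add: dist_norm)
    qed
  qed
  show "u holomorphic_on ball 0 r"
  proof (rule holomorphic_uniform_sequence[OF open_ball hol])
    fix x :: complex assume "x \<in> ball 0 r"
    then obtain d where "d > 0" "cball x d \<subseteq> ball 0 r" using open_contains_cball[of "ball (0::complex) r"] open_ball by blast
    then show "\<exists>d>0. cball x d \<subseteq> ball 0 r \<and> uniform_limit (cball x d) U u sequentially"
      using uniform_limit_on_subset[OF ul] by blast
  qed
qed

section \<open>Cauchy and Poisson integrals on the unit circle\<close>

abbreviation unit_circle :: "real \<Rightarrow> complex"
  where "unit_circle \<equiv> circlepath 0 1"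

lemma circle_integrable:
  "continuous_on (sphere 0 1) f \<Longrightarrow> f contour_integrable_on unit_circle"
  by (rule contour_integrable_continuous_circlepath) (simp add: path_image_circlepath)

lemma circle_integral_cong:
  assumes "\<And>\<zeta>. \<zeta> \<in> sphere 0 1 \<Longrightarrow> f \<zeta> = g \<zeta>"
  shows "contour_integral unit_circle f = contour_integral unit_circle g"
  by (rule contour_integral_eq) (use assms in \<open>simp add: path_image_circlepath\<close>)

lemma one_minus_cnj_mult_nonzero:
  assumes "norm z < 1" "norm \<zeta> \<le> 1"
  shows "1 - cnj z * \<zeta> \<noteq> 0"
proof
  assume "1 - cnj z * \<zeta> = 0"
  then have "norm (cnj z * \<zeta>) = 1" by (metis norm_one eq_iff_diff_eq_0)
  moreover have "norm (cnj z * \<zeta>) \<le> norm z * 1"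
    unfolding norm_mult using assms by (intro mult_mono) auto
  ultimately show False using assms by simp
qed

text \<open>Cauchy's theorem for functions that are merely continuous on the circle, read off from
  Cauchy's formula at the origin for \<open>u \<mapsto> f u * u\<close>, which vanishes
  there.\<close>

lemma circle_integral_holomorphic:
  assumes "continuous_on (cball 0 1) f" "f holomorphic_on ball 0 1"
  shows "contour_integral unit_circle f = 0"
proof -
  have "((\<lambda>u. (f u * u) / (u - 0)) has_contour_integral (2 * of_real pi * \<i> * (f 0 * 0))) unit_circle"
    using assms by (intro Cauchy_integral_circlepath) (auto intro!: continuous_intros holomorphic_intros)
  then have "((\<lambda>u. (f u * u) / (u - 0)) has_contour_integral 0) unit_circle"
    by (simp only: mult_zero_right)
  then have "(f has_contour_integral 0) unit_circle"
    by (rule has_contour_integral_eq) (auto simp: path_image_circlepath)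
  then show ?thesis by (rule contour_integral_unique)
qed

definition poisson_kernel :: "complex \<Rightarrow> complex \<Rightarrow> real"
  where "poisson_kernel z \<zeta> = (1 - (norm z)\<^sup>2) / (norm (\<zeta> - z))\<^sup>2"

text \<open>On the unit circle \<open>1 - cnj z * \<zeta> = \<zeta> * cnj (\<zeta> - z)\<close>.
  This is why adding \<open>cnj z / (1 - cnj z * \<zeta>)\<close> to the Cauchy kernel leads to a
  nonnegative real density; the factor \<open>\<zeta>\<close> is supplied by the parametrization of
  the circle.\<close>

lemma poisson_kernel_eq:
  assumes "norm z < 1" "norm \<zeta> = 1"
  shows "\<zeta> * (1 / (\<zeta> - z) + cnj z / (1 - cnj z * \<zeta>)) = of_real (poisson_kernel z \<zeta>)"
proof -
  have nz: "\<zeta> - z \<noteq> 0" "\<zeta> \<noteq> 0" "1 - cnj z * \<zeta> \<noteq> 0"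
    using assms one_minus_cnj_mult_nonzero[of z \<zeta>] by auto
  have u: "\<zeta> * cnj \<zeta> = 1" using assms by (simp add: complex_norm_square[symmetric])
  then have e: "1 - cnj z * \<zeta> = \<zeta> * cnj (\<zeta> - z)" by (simp add: algebra_simps)
  have "\<zeta> * (1 / (\<zeta> - z) + cnj z / (1 - cnj z * \<zeta>))
      = \<zeta> * ((1 - cnj z * \<zeta> + cnj z * (\<zeta> - z)) / ((\<zeta> - z) * (1 - cnj z * \<zeta>)))"
    using nz by (simp add: add_divide_eq_iff divide_add_eq_iff field_simps)
  also have "1 - cnj z * \<zeta> + cnj z * (\<zeta> - z) = of_real (1 - (norm z)\<^sup>2)"
    by (simp only: of_real_diff of_real_1 complex_norm_square) (simp add: algebra_simps)
  also have "\<zeta> * (of_real (1 - (norm z)\<^sup>2) / ((\<zeta> - z) * (1 - cnj z * \<zeta>)))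
      = of_real (1 - (norm z)\<^sup>2) / ((\<zeta> - z) * cnj (\<zeta> - z))"
    unfolding e using nz by simp
  also have "\<dots> = of_real (poisson_kernel z \<zeta>)"
    by (simp only: poisson_kernel_def complex_norm_square of_real_divide)
  finally show ?thesis .
qed

text \<open>The total mass of the Poisson kernel: the added term is holomorphic in the disk and
  contributes nothing, the Cauchy kernel contributes its residue.\<close>

lemma circle_integral_kernel:
  assumes "norm z < 1"
  shows "contour_integral unit_circle (\<lambda>\<zeta>. 1 / (\<zeta> - z) + cnj z / (1 - cnj z * \<zeta>)) = 2 * of_real pi * \<i>"
proof -
  have 1: "((\<lambda>u. 1 / (u - z)) has_contour_integral (2 * of_real pi * \<i> * 1)) unit_circle"
    by (rule Cauchy_integral_circlepath) (use assms in \<open>auto intro: continuous_intros\<close>)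
  have nz: "1 - cnj z * u \<noteq> 0" if "norm u \<le> 1" for u
    using one_minus_cnj_mult_nonzero[OF assms that] .
  have c: "continuous_on (cball 0 1) (\<lambda>\<zeta>. cnj z / (1 - cnj z * \<zeta>))"
    by (intro continuous_intros) (use nz in auto)
  have "contour_integral unit_circle (\<lambda>\<zeta>. cnj z / (1 - cnj z * \<zeta>)) = 0"
    by (intro circle_integral_holomorphic c holomorphic_intros) (use nz in auto)
  moreover have "(\<lambda>\<zeta>. cnj z / (1 - cnj z * \<zeta>)) contour_integrable_on unit_circle"
    by (intro circle_integrable continuous_on_subset[OF c]) auto
  ultimately show ?thesis
    using 1 by (subst contour_integral_add) (auto simp: contour_integrable_on_def contour_integral_unique)
qed

text \<open>On the circle the derivative of the path at \<open>t\<close> is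
  \<open>2 * pi * \<i> * \<zeta>\<close>, hence the kernel becomes \<open>2 * pi * \<i>\<close>
  times the Poisson kernel, which is nonnegative with integral 1 over the parameter interval. The
  pointwise bound therefore integrates to \<open>e + D\<close>.\<close>

lemma circle_integral_kernel_bound:
  assumes z: "norm z < 1" and h: "continuous_on (sphere 0 1) h"
    and b: "\<And>\<zeta>. \<zeta> \<in> sphere 0 1 \<Longrightarrow> norm (h \<zeta>) * poisson_kernel z \<zeta> \<le> e * poisson_kernel z \<zeta> + D"
  shows "norm (contour_integral unit_circle (\<lambda>\<zeta>. h \<zeta> * (1 / (\<zeta> - z) + cnj z / (1 - cnj z * \<zeta>)))) \<le> 2 * pi * (e + D)"
proof -
  let ?K = "\<lambda>\<zeta>. 1 / (\<zeta> - z) + cnj z / (1 - cnj z * \<zeta>)"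
  let ?P = "\<lambda>t. poisson_kernel z (unit_circle t)"
  have nz: "1 - cnj z * u \<noteq> 0" "u - z \<noteq> 0" if "norm u = 1" for u
    using one_minus_cnj_mult_nonzero[OF z, of u] that z by auto
  have Kc: "continuous_on (sphere 0 1) ?K"
    by (intro continuous_intros) (use nz in auto)
  have nu: "norm (unit_circle t) = 1" for t by (simp add: circlepath)
  have vd: "?K (unit_circle t) * vector_derivative unit_circle (at t within {0..1}) = 2 * of_real pi * \<i> * of_real (?P t)"
    if "t \<in> {0..1}" for t
  proof -
    have "vector_derivative unit_circle (at t within {0..1}) = 2 * of_real pi * \<i> * unit_circle t"
      using that vector_derivative_circlepath01[of t 0 1] by (simp only: circlepath atLeastAtMost_iff) simp
    then have "?K (unit_circle t) * vector_derivative unit_circle (at t within {0..1})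
       = 2 * of_real pi * \<i> * (unit_circle t * ?K (unit_circle t))"
      by (simp only: mult_ac)
    then show ?thesis unfolding poisson_kernel_eq[OF z nu] .
  qed
  have "(?K has_contour_integral (2 * of_real pi * \<i>)) unit_circle"
    using circle_integrable[OF Kc] circle_integral_kernel[OF z] by (metis has_contour_integral_integral)
  then have "((\<lambda>t. ?K (unit_circle t) * vector_derivative unit_circle (at t within {0..1})) has_integral (2 * of_real pi * \<i>)) {0..1}"
    by (simp add: has_contour_integral_def)
  then have "((\<lambda>t. 2 * of_real pi * \<i> * complex_of_real (?P t)) has_integral (2 * of_real pi * \<i>)) {0..1}"
    by (rule has_integral_eq[rotated]) (rule vd)
  then have "((\<lambda>t. Im (2 * of_real pi * \<i> * complex_of_real (?P t)) / (2 * pi)) has_integral Im (2 * of_real pi * \<i>) / (2 * pi)) {0..1}"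
    by (intro has_integral_divide has_integral_Im)
  then have P1: "(?P has_integral 1) {0..1}" by simp
  have hKc: "continuous_on (sphere 0 1) (\<lambda>\<zeta>. h \<zeta> * ?K \<zeta>)" by (rule continuous_on_mult[OF h Kc])
  have "((\<lambda>\<zeta>. h \<zeta> * ?K \<zeta>) has_contour_integral contour_integral unit_circle (\<lambda>\<zeta>. h \<zeta> * ?K \<zeta>)) unit_circle"
    using circle_integrable[OF hKc] by (rule has_contour_integral_integral)
  then have I: "((\<lambda>t. h (unit_circle t) * ?K (unit_circle t) * vector_derivative unit_circle (at t within {0..1}))
      has_integral contour_integral unit_circle (\<lambda>\<zeta>. h \<zeta> * ?K \<zeta>)) {0..1}"
    by (simp add: has_contour_integral_def)
  have R: "((\<lambda>t. 2 * pi * (e * ?P t + D)) has_integral 2 * pi * (e * 1 + D)) {0..1}"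
    using has_integral_const_real[of D 0 1] by (intro has_integral_mult_right has_integral_add P1) simp
  have "norm (contour_integral unit_circle (\<lambda>\<zeta>. h \<zeta> * ?K \<zeta>)) \<le> 2 * pi * (e * 1 + D)"
    unfolding integral_unique[OF I, symmetric] integral_unique[OF R, symmetric]
  proof (rule Henstock_Kurzweil_Integration.integral_norm_bound_integral)
    show "(\<lambda>t. h (unit_circle t) * ?K (unit_circle t) * vector_derivative unit_circle (at t within {0..1})) integrable_on {0..1}"
      using I by blast
    show "(\<lambda>t. 2 * pi * (e * ?P t + D)) integrable_on {0..1}" using R by blast
    fix t :: real assume t: "t \<in> {0..1}"
    have P0: "?P t \<ge> 0" using z by (simp add: poisson_kernel_def abs_square_le_1[symmetric] power_le_one)
    have "norm (h (unit_circle t) * ?K (unit_circle t) * vector_derivative unit_circle (at t within {0..1}))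
      = 2 * pi * (norm (h (unit_circle t)) * ?P t)"
      unfolding mult.assoc[of "h (unit_circle t)"] vd[OF t] using P0 by (simp add: norm_mult)
    also have "\<dots> \<le> 2 * pi * (e * ?P t + D)"
      using b[of "unit_circle t"] nu[of t] by (intro mult_left_mono) auto
    finally show "norm (h (unit_circle t) * ?K (unit_circle t) * vector_derivative unit_circle (at t within {0..1}))
      \<le> 2 * pi * (e * ?P t + D)" .
  qed
  then show ?thesis by simp
qed

text \<open>The approximate identity argument for data \<open>G z\<close> that vary with
  \<open>z\<close>. Near \<open>x\<close> the data are close to \<open>c\<close>; away from
  \<open>x\<close> they are bounded, while the Poisson kernel is at most
  \<open>(1 - (norm z)\<^sup>2) / (d / 2)\<^sup>2\<close>, which tends to zero.\<close>

lemma poisson_limit: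
  fixes G :: "complex \<Rightarrow> complex \<Rightarrow> complex"
  assumes G: "\<And>z. z \<in> unit_disk \<Longrightarrow> continuous_on (sphere 0 1) (G z)"
    and M: "\<And>z \<zeta>. z \<in> unit_disk \<Longrightarrow> \<zeta> \<in> sphere 0 1 \<Longrightarrow> norm (G z \<zeta>) \<le> M"
    and x: "x \<in> sphere 0 1"
    and lim: "\<And>e. e > 0 \<Longrightarrow> \<exists>d>0. \<forall>z\<in>unit_disk. \<forall>\<zeta>\<in>sphere 0 1. dist z x < d \<longrightarrow> dist \<zeta> x < d \<longrightarrow> norm (G z \<zeta> - c) \<le> e"
  shows "((\<lambda>z. contour_integral unit_circle (\<lambda>\<zeta>. G z \<zeta> * (1 / (\<zeta> - z) + cnj z / (1 - cnj z * \<zeta>))))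
    \<longlongrightarrow> 2 * of_real pi * \<i> * c) (at x within unit_disk)"
proof (rule tendstoI)
  fix e0 :: real assume e0: "e0 > 0"
  \<comment> \<open>Once \<open>D z < e\<close>, the final estimate is
    \<open>2 * pi * (e + e) = e0 / 2\<close>.\<close>
  define e where "e = e0 / (8 * pi)"
  have e: "e > 0" using e0 by (simp add: e_def)
  obtain d where d: "d > 0" "\<And>z \<zeta>. z \<in> unit_disk \<Longrightarrow> \<zeta> \<in> sphere 0 1 \<Longrightarrow> dist z x < d \<Longrightarrow> dist \<zeta> x < d \<Longrightarrow> norm (G z \<zeta> - c) \<le> e"
    using lim[OF e] by blast
  define M' where "M' = \<bar>M\<bar> + norm c"
  define D where "D z = M' * ((1 - (norm z)\<^sup>2) / (d / 2)\<^sup>2)" for z :: complex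
  have "((\<lambda>z. D z) \<longlongrightarrow> M' * ((1 - (norm x)\<^sup>2) / (d / 2)\<^sup>2)) (at x within unit_disk)"
    unfolding D_def using d by (intro tendsto_intros) auto
  then have "(D \<longlongrightarrow> 0) (at x within unit_disk)" using x by simp
  then have "eventually (\<lambda>z. D z < e) (at x within unit_disk)" using e by (rule order_tendstoD(2))
  moreover have "eventually (\<lambda>z. dist z x < d / 2) (at x within unit_disk)"
    using d by (intro tendstoD[OF tendsto_ident_at]) auto
  moreover have "eventually (\<lambda>z. z \<in> unit_disk) (at x within unit_disk)"
    by (simp add: eventually_at_filter)
  ultimately show "eventually (\<lambda>z. dist (contour_integral unit_circle (\<lambda>\<zeta>. G z \<zeta> * (1 / (\<zeta> - z) + cnj z / (1 - cnj z * \<zeta>))))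
    (2 * of_real pi * \<i> * c) < e0) (at x within unit_disk)"
  proof eventually_elim
    case (elim z)
    then have z: "norm z < 1" by simp
    let ?K = "\<lambda>\<zeta>. 1 / (\<zeta> - z) + cnj z / (1 - cnj z * \<zeta>)"
    have nz: "1 - cnj z * u \<noteq> 0" "u - z \<noteq> 0" if "norm u = 1" for u
      using one_minus_cnj_mult_nonzero[OF z, of u] that z by auto
    have Kc: "continuous_on (sphere 0 1) ?K"
      by (intro continuous_intros) (use nz in auto)
    have Gc: "continuous_on (sphere 0 1) (\<lambda>\<zeta>. G z \<zeta> - c)"
      using G elim by (intro continuous_intros) auto
    have z1: "(norm z)\<^sup>2 \<le> 1" using z by (simp add: power_le_one)
    have M'0: "M' \<ge> 0" by (simp add: M'_def)
    have "norm (contour_integral unit_circle (\<lambda>\<zeta>. (G z \<zeta> - c) * ?K \<zeta>)) \<le> 2 * pi * (e + D z)"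
    proof (rule circle_integral_kernel_bound[OF z Gc])
      fix \<zeta> :: complex assume \<zeta>: "\<zeta> \<in> sphere 0 1"
      have P0: "poisson_kernel z \<zeta> \<ge> 0" using z1 by (simp add: poisson_kernel_def)
      have D0: "D z \<ge> 0" using M'0 z1 by (simp add: D_def)
      show "norm (G z \<zeta> - c) * poisson_kernel z \<zeta> \<le> e * poisson_kernel z \<zeta> + D z"
      proof (cases "dist \<zeta> x < d")
        case True
        then have "norm (G z \<zeta> - c) \<le> e" using d elim \<zeta> by auto
        then have "norm (G z \<zeta> - c) * poisson_kernel z \<zeta> \<le> e * poisson_kernel z \<zeta>"
          using P0 by (rule mult_right_mono)
        then show ?thesis using D0 by simp
      next
        case False
        then have "d / 2 \<le> norm (\<zeta> - z)"
          using elim(2) dist_triangle[of \<zeta> x z] by (simp add: dist_norm norm_minus_commute)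
        then have "(d / 2)\<^sup>2 \<le> (norm (\<zeta> - z))\<^sup>2" using d by (intro power_mono) auto
        then have "poisson_kernel z \<zeta> \<le> (1 - (norm z)\<^sup>2) / (d / 2)\<^sup>2"
          unfolding poisson_kernel_def using z1 d by (intro divide_left_mono mult_pos_pos) (auto intro: less_le_trans[of 0 "(d/2)\<^sup>2"])
        moreover have "norm (G z \<zeta> - c) \<le> M'"
          using norm_triangle_ineq4[of "G z \<zeta>" c] M[of z \<zeta>] elim \<zeta> by (simp add: M'_def)
        ultimately have "norm (G z \<zeta> - c) * poisson_kernel z \<zeta> \<le> D z"
          unfolding D_def using P0 M'0 by (intro mult_mono) auto
        then show ?thesis using e P0 by (simp add: add_increasing)
      qed
    qed
    also have "\<dots> < e0"
    proof -
      have "2 * pi * (e + D z) < 2 * pi * (e + e)" using elim by simp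
      also have "\<dots> = e0 / 2" by (simp add: e_def)
      finally show ?thesis using e0 by simp
    qed
    finally have "norm (contour_integral unit_circle (\<lambda>\<zeta>. (G z \<zeta> - c) * ?K \<zeta>)) < e0" .
    moreover have "contour_integral unit_circle (\<lambda>\<zeta>. (G z \<zeta> - c) * ?K \<zeta>)
      = contour_integral unit_circle (\<lambda>\<zeta>. G z \<zeta> * ?K \<zeta>) - 2 * of_real pi * \<i> * c"
    proof -
      have i1: "(\<lambda>\<zeta>. G z \<zeta> * ?K \<zeta>) contour_integrable_on unit_circle"
        using G elim by (intro circle_integrable continuous_on_mult[OF _ Kc]) auto
      have i2: "?K contour_integrable_on unit_circle" by (rule circle_integrable[OF Kc])
      have "contour_integral unit_circle (\<lambda>\<zeta>. (G z \<zeta> - c) * ?K \<zeta>)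
        = contour_integral unit_circle (\<lambda>\<zeta>. G z \<zeta> * ?K \<zeta> - c * ?K \<zeta>)"
        by (simp only: left_diff_distrib)
      also have "\<dots> = contour_integral unit_circle (\<lambda>\<zeta>. G z \<zeta> * ?K \<zeta>) - contour_integral unit_circle (\<lambda>\<zeta>. c * ?K \<zeta>)"
        by (rule contour_integral_diff[OF i1 contour_integrable_lmul[OF i2]])
      also have "contour_integral unit_circle (\<lambda>\<zeta>. c * ?K \<zeta>) = c * (2 * of_real pi * \<i>)"
        unfolding contour_integral_lmul[OF i2] circle_integral_kernel[OF z] ..
      finally show ?thesis by (simp add: mult_ac)
    qed
    ultimately show ?case by (simp add: dist_norm)
  qed
qed

text \<open>For continuous \<open>g\<close>, a polynomial in \<open>cnj z\<close> of degree at most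
  \<open>m\<close> with holomorphic coefficients on the disk; \<open>polyanalytic_part\<close> is a
  linear combination of such functions.\<close>

definition cauchy_poly :: "(complex \<Rightarrow> complex) \<Rightarrow> nat \<Rightarrow> complex \<Rightarrow> complex"
  where "cauchy_poly g m z = contour_integral unit_circle (\<lambda>\<zeta>. g \<zeta> * cnj (\<zeta> - z) ^ m / (\<zeta> - z)) / (2 * of_real pi * \<i>)"

section \<open>Cauchy integrals with powers of the conjugate\<close>

lemma wirtinger_C1_cong:
  assumes "wirtinger_C1 S f p q" "open S" "\<And>z. z \<in> S \<Longrightarrow> f z = g z" "\<And>z. z \<in> S \<Longrightarrow> q z = r z"
  shows "wirtinger_C1 S g p r"
  unfolding wirtinger_C1_def
proof (intro conjI ballI)
  show "continuous_on S p" using assms(1) by (simp add: wirtinger_C1_def)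
  show "continuous_on S r"
    using assms(1,4) by (auto simp: wirtinger_C1_def intro: continuous_on_eq)
  fix z assume z: "z \<in> S"
  then have "(f has_derivative (\<lambda>h. p z * h + q z * cnj h)) (at z)"
    using assms(1) by (auto simp: wirtinger_C1_def)
  then have "(g has_derivative (\<lambda>h. p z * h + q z * cnj h)) (at z)"
    by (rule has_derivative_transform_within_open[OF _ assms(2) z assms(3)])
  then show "(g has_derivative (\<lambda>h. p z * h + r z * cnj h)) (at z)" using assms(4)[OF z] by simp
qed

lemma wirtinger_C1_const: "wirtinger_C1 S (\<lambda>_. c) (\<lambda>_. 0) (\<lambda>_. 0)"
  by (simp add: wirtinger_C1_def)

lemma wirtinger_C1_cnj: "wirtinger_C1 S (\<lambda>z. cnj z - c) (\<lambda>_. 0) (\<lambda>_. 1)"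
  unfolding wirtinger_C1_def by (auto intro!: derivative_eq_intros)

lemma cauchy_poly_integrable:
  assumes "continuous_on (sphere 0 1) g" "z \<in> unit_disk"
  shows "(\<lambda>\<zeta>. g \<zeta> * cnj (\<zeta> - z) ^ m / (\<zeta> - z)) contour_integrable_on unit_circle"
  using assms by (intro circle_integrable continuous_intros) auto

text \<open>Induction over all \<open>g\<close> at once: as
  \<open>cnj (\<zeta> - z) = cnj \<zeta> - cnj z\<close>, degree \<open>Suc m\<close> for
  \<open>g\<close> is degree \<open>m\<close> for \<open>cnj \<zeta> * g \<zeta>\<close> minus
  \<open>cnj z\<close> times degree \<open>m\<close> for \<open>g\<close>. Degree 0 is a Cauchy
  integral, hence holomorphic. The truncated \<open>m - 1\<close> at \<open>m = 0\<close> is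
  harmless, being multiplied by \<open>0\<close>.\<close>

lemma cauchy_poly_C1:
  assumes "continuous_on (sphere 0 1) g"
  shows "\<exists>p. wirtinger_C1 unit_disk (cauchy_poly g m) p (\<lambda>z. - of_nat m * cauchy_poly g (m - 1) z)"
  using assms
proof (induction m arbitrary: g)
  case 0
  have "cauchy_poly g 0 holomorphic_on unit_disk"
  proof (subst holomorphic_on_open, simp, intro ballI)
    fix z :: complex assume z: "z \<in> unit_disk"
    have "((\<lambda>w. contour_integral unit_circle (\<lambda>u. g u / (u - w) ^ 1)) has_field_derivative
       (1 * contour_integral unit_circle (\<lambda>u. g u / (u - z) ^ (Suc 1)))) (at z)"
    proof (rule Cauchy_next_derivative_circlepath(2)[where k=1, simplified of_nat_1])
      show "continuous_on (path_image unit_circle) g" using 0 by (simp add: path_image_circlepath)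
      show "((\<lambda>u. g u / (u - w) ^ 1) has_contour_integral contour_integral unit_circle (\<lambda>u. g u / (u - w) ^ 1)) unit_circle"
        if "w \<in> ball 0 1" for w
        using cauchy_poly_integrable[OF 0 that, of 0] by (intro has_contour_integral_integral) simp
    qed (use z in auto)
    from DERIV_cdivide[OF this, of "2 * of_real pi * \<i>"]
    show "\<exists>f'. (cauchy_poly g 0 has_field_derivative f') (at z)"
      by (auto simp: cauchy_poly_def[abs_def])
  qed
  from wirtinger_C1_holomorphic[OF this] show ?case by auto
next
  case (Suc m)
  have g': "continuous_on (sphere 0 1) (\<lambda>\<zeta>. cnj \<zeta> * g \<zeta>)" using Suc.prems by (intro continuous_intros)
  have rec: "cauchy_poly g (Suc m) z = cauchy_poly (\<lambda>\<zeta>. cnj \<zeta> * g \<zeta>) m z + - (cnj z - 0) * cauchy_poly g m z"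
    if "z \<in> unit_disk" for m z
  proof -
    have "contour_integral unit_circle (\<lambda>\<zeta>. g \<zeta> * cnj (\<zeta> - z) ^ Suc m / (\<zeta> - z))
      = contour_integral unit_circle (\<lambda>\<zeta>. (cnj \<zeta> * g \<zeta>) * cnj (\<zeta> - z) ^ m / (\<zeta> - z) - cnj z * (g \<zeta> * cnj (\<zeta> - z) ^ m / (\<zeta> - z)))"
      by (intro arg_cong[of _ _ "contour_integral unit_circle"] ext) (simp add: algebra_simps diff_divide_distrib)
    also have "\<dots> = contour_integral unit_circle (\<lambda>\<zeta>. (cnj \<zeta> * g \<zeta>) * cnj (\<zeta> - z) ^ m / (\<zeta> - z))
      - cnj z * contour_integral unit_circle (\<lambda>\<zeta>. g \<zeta> * cnj (\<zeta> - z) ^ m / (\<zeta> - z))"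
      unfolding contour_integral_diff[OF cauchy_poly_integrable[OF g' that]
          contour_integrable_lmul[OF cauchy_poly_integrable[OF Suc.prems that]]]
        contour_integral_lmul[OF cauchy_poly_integrable[OF Suc.prems that]] ..
    finally show ?thesis by (simp add: cauchy_poly_def diff_divide_distrib)
  qed
  obtain p1 where p1: "wirtinger_C1 unit_disk (cauchy_poly (\<lambda>\<zeta>. cnj \<zeta> * g \<zeta>) m) p1
      (\<lambda>z. - of_nat m * cauchy_poly (\<lambda>\<zeta>. cnj \<zeta> * g \<zeta>) (m - 1) z)"
    using Suc.IH[OF g'] by blast
  obtain p2 where p2: "wirtinger_C1 unit_disk (cauchy_poly g m) p2 (\<lambda>z. - of_nat m * cauchy_poly g (m - 1) z)"
    using Suc.IH[OF Suc.prems] by blast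
  note w = wirtinger_C1_add[OF p1 wirtinger_C1_mult[OF wirtinger_C1_mult[OF wirtinger_C1_const[of _ "-1"] wirtinger_C1_cnj[of _ 0]] p2]]
  show ?case
  proof (rule exI, rule wirtinger_C1_cong[OF w])
    fix z :: complex assume z: "z \<in> unit_disk"
    show "cauchy_poly (\<lambda>\<zeta>. cnj \<zeta> * g \<zeta>) m z + - 1 * (cnj z - 0) * cauchy_poly g m z = cauchy_poly g (Suc m) z"
      using rec[OF z] by simp
    have r: "cauchy_poly (\<lambda>\<zeta>. cnj \<zeta> * g \<zeta>) (m - 1) z = cauchy_poly g m z + cnj z * cauchy_poly g (m - 1) z"
      if "m \<noteq> 0"
      using rec[OF z, of "m - 1"] that by simp
    show "- of_nat m * cauchy_poly (\<lambda>\<zeta>. cnj \<zeta> * g \<zeta>) (m - 1) z +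
         (- 1 * (cnj z - 0) * (- of_nat m * cauchy_poly g (m - 1) z) + (- 1 * 1 + 0 * (cnj z - 0)) * cauchy_poly g m z)
       = - of_nat (Suc m) * cauchy_poly g (Suc m - 1) z"
    proof (cases "m = 0")
      case False
      show ?thesis unfolding r[OF False] by (simp add: algebra_simps)
    qed simp
  qed simp
qed

section \<open>Polyanalytic functions\<close>

lemma weak_dbar_zero: "weak_dbar \<i> (\<lambda>_. 0) (\<lambda>_. 0)"
  by (rule weak_dbar_C1[OF wirtinger_C1_const])

lemma weak_dbar_cmult:
  assumes "weak_dbar \<i> u g"
  shows "weak_dbar \<i> (\<lambda>z. c * u z) (\<lambda>z. c * g z)"
  using weak_dbar_mult_C1[OF assms wirtinger_C1_const[of _ c]] by simp

lemma weak_dbar_sum: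
  assumes "finite I" "\<And>i. i \<in> I \<Longrightarrow> weak_dbar \<i> (u i) (g i)"
  shows "weak_dbar \<i> (\<lambda>z. \<Sum>i\<in>I. u i z) (\<lambda>z. \<Sum>i\<in>I. g i z)"
  using assms by (induction I) (auto intro: weak_dbar_zero weak_dbar_add)

text \<open>The integrand of the representation before division by \<open>\<zeta> - z\<close>.
  \<open>N\<close> and \<open>h\<close> are free because the problem for the \<open>k\<close>-th
  derivative has the same form, with \<open>n - k\<close> terms and the data shifted by
  \<open>k\<close>.\<close>

definition kernel_sum :: "nat \<Rightarrow> (nat \<Rightarrow> complex \<Rightarrow> complex) \<Rightarrow> complex \<Rightarrow> complex \<Rightarrow> complex"
  where "kernel_sum N h z \<zeta> = (\<Sum>m<N. (-1) ^ m / fact m * (h m \<zeta> * cnj (\<zeta> - z) ^ m))"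

definition cauchy_sum :: "nat \<Rightarrow> (nat \<Rightarrow> complex \<Rightarrow> complex) \<Rightarrow> complex \<Rightarrow> complex"
  where "cauchy_sum N h z = (\<Sum>m<N. (-1) ^ m / fact m * cauchy_poly (h m) m z)"

lemma kernel_sum_continuous:
  assumes "\<And>m. m < N \<Longrightarrow> continuous_on S (h m)"
  shows "continuous_on S (kernel_sum N h z)"
  unfolding kernel_sum_def using assms by (intro continuous_intros) auto

lemma cauchy_sum_eq:
  assumes "\<And>m. m < N \<Longrightarrow> continuous_on (sphere 0 1) (h m)" "z \<in> unit_disk"
  shows "cauchy_sum N h z = contour_integral unit_circle (\<lambda>\<zeta>. kernel_sum N h z \<zeta> / (\<zeta> - z)) / (2 * of_real pi * \<i>)"
proof -
  have "contour_integral unit_circle (\<lambda>\<zeta>. kernel_sum N h z \<zeta> / (\<zeta> - z))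
    = contour_integral unit_circle (\<lambda>\<zeta>. \<Sum>m<N. (-1) ^ m / fact m * (h m \<zeta> * cnj (\<zeta> - z) ^ m / (\<zeta> - z)))"
    by (simp add: kernel_sum_def sum_divide_distrib)
  also have "\<dots> = (\<Sum>m<N. contour_integral unit_circle (\<lambda>\<zeta>. (-1) ^ m / fact m * (h m \<zeta> * cnj (\<zeta> - z) ^ m / (\<zeta> - z))))"
    using assms by (intro contour_integral_sum contour_integrable_lmul cauchy_poly_integrable) auto
  also have "\<dots> = (\<Sum>m<N. (-1) ^ m / fact m * contour_integral unit_circle (\<lambda>\<zeta>. h m \<zeta> * cnj (\<zeta> - z) ^ m / (\<zeta> - z)))"
    using assms by (intro sum.cong refl contour_integral_lmul cauchy_poly_integrable) auto
  finally show ?thesis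
    by (simp add: cauchy_sum_def cauchy_poly_def sum_divide_distrib)
qed

lemma cauchy_sum_continuous:
  assumes "\<And>m. m < N \<Longrightarrow> continuous_on (sphere 0 1) (h m)"
  shows "continuous_on unit_disk (cauchy_sum N h)"
  unfolding cauchy_sum_def
  using cauchy_poly_C1[OF assms] wirtinger_C1_continuous by (intro continuous_intros) blast+

text \<open>The term with \<open>m = 0\<close> is holomorphic and drops out; the factor
  \<open>- of_nat m\<close> turns the coefficient of index \<open>m\<close> into that of index
  \<open>m - 1\<close>. Differentiation thus shifts the data.\<close>

lemma weak_dbar_cauchy_sum:
  assumes h: "\<And>m. m < Suc N \<Longrightarrow> continuous_on (sphere 0 1) (h m)"
  shows "weak_dbar \<i> (cauchy_sum (Suc N) h) (cauchy_sum N (\<lambda>m. h (Suc m)))"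
proof -
  have "weak_dbar \<i> (\<lambda>z. \<Sum>m<Suc N. (-1) ^ m / fact m * cauchy_poly (h m) m z)
    (\<lambda>z. \<Sum>m<Suc N. (-1) ^ m / fact m * (- of_nat m * cauchy_poly (h m) (m - 1) z))"
    using cauchy_poly_C1[OF h] weak_dbar_C1 by (intro weak_dbar_sum weak_dbar_cmult) blast+
  moreover have "(\<Sum>m<Suc N. (-1) ^ m / fact m * (- of_nat m * cauchy_poly (h m) (m - 1) z))
    = (\<Sum>m<N. (-1) ^ m / fact m * cauchy_poly (h (Suc m)) m z)" for z
  proof -
    have "(-1) ^ Suc m / fact (Suc m) * (- of_nat (Suc m) * cauchy_poly (h (Suc m)) (Suc m - 1) z)
      = (-1) ^ m / fact m * cauchy_poly (h (Suc m)) m z" for m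
      by (simp add: field_simps del: of_nat_Suc)
    then show ?thesis by (subst sum.lessThan_Suc_shift) simp
  qed
  ultimately show ?thesis by (simp add: cauchy_sum_def[abs_def])
qed

text \<open>Telescoping: the terms of $\sum_m (-1)^m \varphi_m (\zeta^* - c)^m / m!$ cancel under
  $\partial / \partial \zeta^*$ when $\varphi_{m+1}$ is the derivative of $\varphi_m$.\<close>

lemma weak_dbar_telescope:
  assumes "\<And>m. m < N \<Longrightarrow> weak_dbar \<i> (\<phi> m) (\<phi> (Suc m))"
  shows "weak_dbar \<i> (\<lambda>\<zeta>. \<Sum>m<N. (-1) ^ m / fact m * (\<phi> m \<zeta> * (cnj \<zeta> - c) ^ m))
    (\<lambda>\<zeta>. if N = 0 then 0 else (-1) ^ (N - 1) / fact (N - 1) * (\<phi> N \<zeta> * (cnj \<zeta> - c) ^ (N - 1)))"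
  using assms
proof (induction N)
  case 0
  then show ?case using weak_dbar_zero by simp
next
  case (Suc N)
  have pw: "wirtinger_C1 unit_disk (\<lambda>\<zeta>. (cnj \<zeta> - c) ^ N) (\<lambda>_. 0) (\<lambda>\<zeta>. of_nat N * (cnj \<zeta> - c) ^ (N - 1))"
    unfolding wirtinger_C1_def by (auto intro!: continuous_intros derivative_eq_intros)
  from weak_dbar_cmult[OF weak_dbar_mult_C1[OF Suc.prems pw], of N "(-1) ^ N / fact N"]
  have "weak_dbar \<i> (\<lambda>\<zeta>. (-1) ^ N / fact N * ((cnj \<zeta> - c) ^ N * \<phi> N \<zeta>))
    (\<lambda>\<zeta>. (-1) ^ N / fact N * ((cnj \<zeta> - c) ^ N * \<phi> (Suc N) \<zeta> + of_nat N * (cnj \<zeta> - c) ^ (N - 1) * \<phi> N \<zeta>))"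
    by simp
  from weak_dbar_add[OF Suc.IH this] Suc.prems
  have "weak_dbar \<i> (\<lambda>\<zeta>. (\<Sum>m<N. (-1) ^ m / fact m * (\<phi> m \<zeta> * (cnj \<zeta> - c) ^ m)) + (-1) ^ N / fact N * ((cnj \<zeta> - c) ^ N * \<phi> N \<zeta>))
    (\<lambda>\<zeta>. (if N = 0 then 0 else (-1) ^ (N - 1) / fact (N - 1) * (\<phi> N \<zeta> * (cnj \<zeta> - c) ^ (N - 1)))
      + (-1) ^ N / fact N * ((cnj \<zeta> - c) ^ N * \<phi> (Suc N) \<zeta> + of_nat N * (cnj \<zeta> - c) ^ (N - 1) * \<phi> N \<zeta>))"
    by simp
  moreover have "(if N = 0 then 0 else (-1) ^ (N - 1) / fact (N - 1) * (\<phi> N \<zeta> * (cnj \<zeta> - c) ^ (N - 1)))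
      + (-1) ^ N / fact N * ((cnj \<zeta> - c) ^ N * \<phi> (Suc N) \<zeta> + of_nat N * (cnj \<zeta> - c) ^ (N - 1) * \<phi> N \<zeta>)
    = (-1) ^ N / fact N * (\<phi> (Suc N) \<zeta> * (cnj \<zeta> - c) ^ N)" for \<zeta>
  \<comment> \<open>For positive \<open>N\<close> the derivative of the new power cancels the
    previous last term; for \<open>N = 0\<close> both are absent.\<close>
  proof (cases N)
    case (Suc M)
    have "(-1) ^ Suc M / fact (Suc M) * (of_nat (Suc M) * (cnj \<zeta> - c) ^ M * \<phi> (Suc M) \<zeta>)
      = - ((-1) ^ M / fact M * (\<phi> (Suc M) \<zeta> * (cnj \<zeta> - c) ^ M))"
      by (simp add: field_simps del: of_nat_Suc)
    then show ?thesis unfolding Suc by (simp add: distrib_left mult_ac)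
  qed simp
  ultimately show ?case by (simp add: mult_ac)
qed

text \<open>\<open>has_boundary_values\<close> concerns approach from inside the disk, continuity of
  \<open>g\<close> approach along the circle; the two filters together make up the one of the closed
  disk.\<close>

lemma continuous_on_boundary_extension:
  assumes v: "has_boundary_values v g" and g: "continuous_on (sphere 0 1) g"
  shows "continuous_on (cball 0 1) (\<lambda>\<zeta>. if \<zeta> \<in> unit_disk then v \<zeta> else g \<zeta>)"
  unfolding continuous_on_def
proof
  let ?e = "\<lambda>\<zeta>. if \<zeta> \<in> unit_disk then v \<zeta> else g \<zeta>"
  fix x :: complex assume x: "x \<in> cball 0 1"
  show "(?e \<longlongrightarrow> ?e x) (at x within cball 0 1)"
  proof (cases "x \<in> unit_disk")
    case True
    have "continuous_on unit_disk ?e"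
      by (rule continuous_on_eq[of _ v]) (use v in \<open>auto simp: has_boundary_values_def\<close>)
    then have "isCont ?e x" using True by (simp add: continuous_on_eq_continuous_at)
    then have "(?e \<longlongrightarrow> ?e x) (at x)" by (simp add: isCont_def)
    then show ?thesis by (rule tendsto_within_subset) simp
  next
    case False
    then have xs: "x \<in> sphere 0 1" using x by simp
    have eq: "cball 0 1 = unit_disk \<union> sphere (0::complex) 1" by auto
    have "(?e \<longlongrightarrow> g x) (at x within unit_disk)"
    proof (rule Lim_transform_eventually)
      show "(v \<longlongrightarrow> g x) (at x within unit_disk)" using v xs by (simp add: has_boundary_values_def)
      show "eventually (\<lambda>\<zeta>. v \<zeta> = ?e \<zeta>) (at x within unit_disk)" by (simp add: eventually_at_filter)
    qed
    moreover have "(?e \<longlongrightarrow> g x) (at x within sphere 0 1)"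
    proof (rule Lim_transform_eventually)
      show "(g \<longlongrightarrow> g x) (at x within sphere 0 1)" using g xs by (simp add: continuous_on_def)
      show "eventually (\<lambda>\<zeta>. g \<zeta> = ?e \<zeta>) (at x within sphere 0 1)" by (simp add: eventually_at_filter)
    qed
    ultimately show ?thesis
      using False unfolding eq at_within_union by (simp add: filterlim_sup)
  qed
qed

lemma polyanalytic_representation:
  assumes bv: "\<And>m. m < N \<Longrightarrow> has_boundary_values (\<phi> m) (h m)"
    and h: "\<And>m. m < N \<Longrightarrow> continuous_on (sphere 0 1) (h m)"
    and d: "\<And>m. m < N \<Longrightarrow> weak_dbar \<i> (\<phi> m) (\<phi> (Suc m))"
    and z0: "\<And>z. z \<in> unit_disk \<Longrightarrow> \<phi> N z = 0"
    and N: "N > 0" and z: "z \<in> unit_disk"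
  shows "\<phi> 0 z = cauchy_sum N h z"
    and "contour_integral unit_circle (\<lambda>\<zeta>. kernel_sum N h z \<zeta> * (cnj z / (1 - cnj z * \<zeta>))) = 0"
proof -
  \<comment> \<open>The boundary data replace \<open>\<phi> m\<close> on the circle, so
    \<open>F\<close> is continuous on the closed disk and equals \<open>kernel_sum N h z\<close> on
    the circle.\<close>
  define F where "F \<zeta> = (\<Sum>m<N. (-1) ^ m / fact m * ((if \<zeta> \<in> unit_disk then \<phi> m \<zeta> else h m \<zeta>) * (cnj \<zeta> - cnj z) ^ m))" for \<zeta>
  have Fc: "continuous_on (cball 0 1) F"
    unfolding F_def using continuous_on_boundary_extension[OF bv h] by (intro continuous_intros) auto
  have Fd: "F \<zeta> = (\<Sum>m<N. (-1) ^ m / fact m * (\<phi> m \<zeta> * (cnj \<zeta> - cnj z) ^ m))" if "\<zeta> \<in> unit_disk" for \<zeta>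
    using that by (simp add: F_def)
  have Fs: "F \<zeta> = kernel_sum N h z \<zeta>" if "\<zeta> \<in> sphere 0 1" for \<zeta>
    using that by (simp add: F_def kernel_sum_def)
  note t = weak_dbar_telescope[of N \<phi> "cnj z", OF d]
  \<comment> \<open>Telescoping leaves a multiple of \<open>\<phi> N\<close>, which vanishes on the
    disk.\<close>
  have "weak_dbar \<i> F (\<lambda>_. 0)"
    by (rule weak_dbar_cong_AE[OF t]) (use Fd z0 N in auto)
  then have hol: "F holomorphic_on unit_disk"
    by (intro weak_dbar_zero_imp_holomorphic continuous_on_subset[OF Fc]) auto
  have "((\<lambda>u. F u / (u - z)) has_contour_integral (2 * of_real pi * \<i> * F z)) unit_circle"
    using Fc hol z by (intro Cauchy_integral_circlepath) auto
  then have "contour_integral unit_circle (\<lambda>u. F u / (u - z)) = 2 * of_real pi * \<i> * F z"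
    by (rule contour_integral_unique)
  moreover have "contour_integral unit_circle (\<lambda>u. F u / (u - z)) = contour_integral unit_circle (\<lambda>u. kernel_sum N h z u / (u - z))"
    by (rule circle_integral_cong) (simp add: Fs)
  \<comment> \<open>At \<open>\<zeta> = z\<close> all terms with a positive power of
    \<open>cnj \<zeta> - cnj z\<close> are zero.\<close>
  moreover have "F z = \<phi> 0 z"
    unfolding Fd[OF z] using N by (cases N) (auto simp: sum.lessThan_Suc_shift simp del: sum.lessThan_Suc)
  ultimately show "\<phi> 0 z = cauchy_sum N h z"
    using cauchy_sum_eq[OF h z] by simp
  have nz: "1 - cnj z * \<zeta> \<noteq> 0" if "norm \<zeta> \<le> 1" for \<zeta>
    using one_minus_cnj_mult_nonzero[OF _ that, of z] z by simp
  have "contour_integral unit_circle (\<lambda>\<zeta>. F \<zeta> * (cnj z / (1 - cnj z * \<zeta>))) = 0"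
    by (intro circle_integral_holomorphic continuous_intros holomorphic_intros Fc hol) (use nz in auto)
  moreover have "contour_integral unit_circle (\<lambda>\<zeta>. F \<zeta> * (cnj z / (1 - cnj z * \<zeta>)))
    = contour_integral unit_circle (\<lambda>\<zeta>. kernel_sum N h z \<zeta> * (cnj z / (1 - cnj z * \<zeta>)))"
    by (rule circle_integral_cong) (simp add: Fs)
  ultimately show "contour_integral unit_circle (\<lambda>\<zeta>. kernel_sum N h z \<zeta> * (cnj z / (1 - cnj z * \<zeta>))) = 0"
    by simp
qed

text \<open>Adding the vanishing integral turns the Cauchy kernel into the Poisson kernel, under which
  the terms with a factor $(\zeta - z)^*$ disappear at the boundary.\<close>

lemma cauchy_sum_boundary:
  assumes h: "\<And>m. m < N \<Longrightarrow> continuous_on (sphere 0 1) (h m)" and N: "N > 0"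
    and v: "\<And>z. z \<in> unit_disk \<Longrightarrow> contour_integral unit_circle (\<lambda>\<zeta>. kernel_sum N h z \<zeta> * (cnj z / (1 - cnj z * \<zeta>))) = 0"
  shows "has_boundary_values (cauchy_sum N h) (h 0)"
  unfolding has_boundary_values_def
proof (intro conjI ballI cauchy_sum_continuous[OF h])
  fix x :: complex assume x: "x \<in> sphere 0 1"
  have eq: "contour_integral unit_circle (\<lambda>\<zeta>. kernel_sum N h z \<zeta> * (1 / (\<zeta> - z) + cnj z / (1 - cnj z * \<zeta>)))
     = 2 * of_real pi * \<i> * cauchy_sum N h z" if z: "z \<in> unit_disk" for z
  proof -
    have kc: "continuous_on (sphere 0 1) (kernel_sum N h z)" by (rule kernel_sum_continuous[OF h])
    have nz: "1 - cnj z * \<zeta> \<noteq> 0" "\<zeta> - z \<noteq> 0" if "norm \<zeta> = 1" for \<zeta>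
      using one_minus_cnj_mult_nonzero[of z \<zeta>] z that by auto
    have "(\<lambda>\<zeta>. kernel_sum N h z \<zeta> / (\<zeta> - z)) contour_integrable_on unit_circle"
      "(\<lambda>\<zeta>. kernel_sum N h z \<zeta> * (cnj z / (1 - cnj z * \<zeta>))) contour_integrable_on unit_circle"
      by (intro circle_integrable continuous_intros kc; use nz in force)+
    from contour_integral_add[OF this] v[OF z] cauchy_sum_eq[OF h z]
    show ?thesis by (simp add: distrib_left)
  qed
  have "\<forall>m. \<exists>B. m < N \<longrightarrow> (\<forall>\<zeta>\<in>sphere 0 1. norm (h m \<zeta>) \<le> B)"
    using compact_continuous_bounded[OF compact_sphere h] by metis
  then obtain B where B: "\<And>m \<zeta>. m < N \<Longrightarrow> \<zeta> \<in> sphere 0 1 \<Longrightarrow> norm (h m \<zeta>) \<le> B m"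
    by metis
  have "((\<lambda>z. contour_integral unit_circle (\<lambda>\<zeta>. kernel_sum N h z \<zeta> * (1 / (\<zeta> - z) + cnj z / (1 - cnj z * \<zeta>))))
    \<longlongrightarrow> 2 * of_real pi * \<i> * h 0 x) (at x within unit_disk)"
  proof (rule poisson_limit[OF kernel_sum_continuous[OF h] _ x])
    show "norm (kernel_sum N h z \<zeta>) \<le> (\<Sum>m<N. B m * 2 ^ m)" if "z \<in> unit_disk" "\<zeta> \<in> sphere 0 1" for z \<zeta>
      unfolding kernel_sum_def
    proof (rule order_trans[OF norm_sum], rule sum_mono)
      fix m assume "m \<in> {..<N}"
      then have m: "m < N" by simp
      have "norm (cnj (\<zeta> - z)) \<le> 2"
        using norm_triangle_ineq4[of \<zeta> z] that by (simp del: complex_cnj_diff)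
      then have "norm (cnj (\<zeta> - z)) ^ m \<le> 2 ^ m" by (intro power_mono) auto
      moreover have "norm ((-1) ^ m / fact m :: complex) \<le> 1"
        by (simp add: norm_divide norm_power fact_ge_1)
      ultimately have "norm ((-1) ^ m / fact m :: complex) * (norm (h m \<zeta>) * norm (cnj (\<zeta> - z)) ^ m)
        \<le> 1 * (B m * 2 ^ m)"
        using B[OF m that(2)] by (intro mult_mono) (auto intro: order_trans[OF norm_ge_zero])
      then show "norm ((-1) ^ m / fact m * (h m \<zeta> * cnj (\<zeta> - z) ^ m)) \<le> B m * 2 ^ m"
        by (simp only: norm_mult norm_power mult_1)
    qed
    fix e :: real assume e: "e > 0"
    \<comment> \<open>The kernel sum as a function of both arguments. Its continuity at
      \<open>(x, x)\<close>, where only the term with \<open>m = 0\<close> survives, gives the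
      estimate for \<open>z\<close> and \<open>\<zeta>\<close> near \<open>x\<close>
      simultaneously.\<close>
    define E where "E p = (\<Sum>m<N. (-1) ^ m / fact m * (h m (snd p) * cnj (snd p - fst p) ^ m))" for p :: "complex \<times> complex"
    have "continuous_on (UNIV \<times> sphere 0 1) E"
      unfolding E_def by (intro continuous_intros continuous_on_compose2[OF h continuous_on_snd]) auto
    moreover have "(x, x) \<in> UNIV \<times> sphere 0 1" using x by simp
    ultimately obtain d where d: "d > 0" "\<And>p. p \<in> UNIV \<times> sphere 0 1 \<Longrightarrow> dist p (x, x) < d \<Longrightarrow> dist (E p) (E (x, x)) < e"
      using e unfolding continuous_on_iff by metis
    have E0: "E (x, x) = h 0 x"
      unfolding E_def using N by (cases N) (auto simp: sum.lessThan_Suc_shift simp del: sum.lessThan_Suc)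
    show "\<exists>d>0. \<forall>z\<in>unit_disk. \<forall>\<zeta>\<in>sphere 0 1. dist z x < d \<longrightarrow> dist \<zeta> x < d \<longrightarrow> norm (kernel_sum N h z \<zeta> - h 0 x) \<le> e"
    proof (intro exI[of _ "d / 2"] conjI ballI impI)
      fix z \<zeta> :: complex assume zz: "\<zeta> \<in> sphere 0 1" "dist z x < d / 2" "dist \<zeta> x < d / 2"
      have "dist (z, \<zeta>) (x, x) \<le> dist z x + dist \<zeta> x"
        unfolding dist_Pair_Pair by (rule sqrt_sum_squares_le_sum) auto
      then have "dist (E (z, \<zeta>)) (E (x, x)) < e" using zz by (intro d) auto
      then show "norm (kernel_sum N h z \<zeta> - h 0 x) \<le> e"
        unfolding E0 by (simp add: E_def kernel_sum_def dist_norm)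
    qed (use d in auto)
  qed
  then have "((\<lambda>z. 2 * of_real pi * \<i> * cauchy_sum N h z) \<longlongrightarrow> 2 * of_real pi * \<i> * h 0 x) (at x within unit_disk)"
    by (rule Lim_transform_eventually) (auto simp: eventually_at_filter eq)
  from tendsto_mult_left[OF this, of "1 / (2 * of_real pi * \<i>)"]
  show "(cauchy_sum N h \<longlongrightarrow> h 0 x) (at x within unit_disk)" by simp
qed

section \<open>The complex Dirichlet problem\<close>

text \<open>The disk has finite measure, and \<open>norm (a z) \<le> 1 + norm (a z) powr q\<close>
  on it.\<close>

lemma Lq_disk_integrable:
  fixes a :: "complex \<Rightarrow> complex"
  assumes a: "Lq_disk q a" and q: "q > 2"
  shows "integrable lebesgue (\<lambda>z. indicator unit_disk z *\<^sub>R a z)"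
    "integrable lebesgue (\<lambda>z. norm (indicator unit_disk z *\<^sub>R a z) powr q)"
proof -
  let ?a = "\<lambda>z. indicator unit_disk z *\<^sub>R a z"
  have m: "?a \<in> borel_measurable lebesgue"
    using a borel_measurable_restrict_space_iff[of unit_disk lebesgue a] by (simp add: Lq_disk_def)
  have "(\<lambda>z. norm (?a z) powr q) = (\<lambda>z. indicator unit_disk z *\<^sub>R (norm (a z) powr q))"
    using q by (auto simp: fun_eq_iff indicator_def)
  then show i: "integrable lebesgue (\<lambda>z. norm (?a z) powr q)"
    using a by (simp add: Lq_disk_def set_integrable_def)
  show "integrable lebesgue ?a"
  proof (rule Bochner_Integration.integrable_bound[OF _ m])
    have "integrable lebesgue (indicator unit_disk :: complex \<Rightarrow> real)"
      using lmeasurable_ball[of "0::complex" 1] by (simp only: lmeasurable_iff_integrable)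
    then show "integrable lebesgue (\<lambda>z. indicator unit_disk z + norm (?a z) powr q)" using i by (rule Bochner_Integration.integrable_add)
    show "AE z in lebesgue. norm (?a z) \<le> norm (indicator unit_disk z + norm (?a z) powr q)"
    proof (rule AE_I2)
      fix z
      show "norm (?a z) \<le> norm (indicator unit_disk z + norm (?a z) powr q)"
      proof (cases "norm (?a z) \<le> 1")
        case True
        then show ?thesis by (cases "z \<in> unit_disk") (auto intro: add_increasing2)
      next
        case False
        then have "norm (?a z) powr 1 \<le> norm (?a z) powr q" using q by (intro powr_mono) auto
        then show ?thesis using False by (simp add: add_increasing)
      qed
    qed
  qed
qed

section \<open>The operator \<open>T_disk\<close> and the relation \<open>vekua_op\<close> for
  complex functions\<close>

lemma T_disk_eq_cauchy_transform:
  "T_disk a z = cauchy_transform (\<lambda>z. indicator unit_disk z *\<^sub>R a z) z"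
proof -
  have "(LINT \<zeta>:unit_disk|lebesgue. a \<zeta> / (\<zeta> - z)) = (LINT \<zeta>|lebesgue. - (indicator unit_disk \<zeta> *\<^sub>R a \<zeta> / (z - \<zeta>)))"
    unfolding set_lebesgue_integral_def
    by (intro Bochner_Integration.integral_cong refl) (simp add: minus_divide_right scaleR_conv_of_real)
  then show ?thesis by (simp add: T_disk_def cauchy_transform_def)
qed

lemma T_disk_uminus: "T_disk (\<lambda>z. - a z) z = - T_disk a z"
  by (simp add: T_disk_def set_lebesgue_integral_def)

lemma T_disk_continuous:
  assumes "Lq_disk q a" "q > 2"
  shows "continuous_on UNIV (T_disk a)"
  unfolding T_disk_eq_cauchy_transform[abs_def]
  by (rule cauchy_transform_continuous[OF Lq_disk_integrable[OF assms] assms(2)])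

lemma weak_dbar_exp_T_disk:
  assumes a: "Lq_disk q a" "q > 2" and u: "continuous_on unit_disk u" "weak_dbar \<i> u g"
  shows "weak_dbar \<i> (\<lambda>z. exp (T_disk a z) * u z) (\<lambda>z. exp (T_disk a z) * (g z + a z * u z))"
  by (rule weak_dbar_cong_AE[OF weak_dbar_exp_mult[OF Lq_disk_integrable[OF a] a(2) u]])
    (auto simp: T_disk_eq_cauchy_transform)

text \<open>The existentially quantified derivative can be eliminated, since a weak derivative may
  be changed on a null set.\<close>

lemma vekua_op_iff: "vekua_op \<i> a w v \<longleftrightarrow> weak_dbar \<i> w (\<lambda>z. v z + a z * w z)"
proof
  assume "vekua_op \<i> a w v"
  then obtain g where g: "weak_dbar \<i> w g" "AE z in lebesgue. z \<in> unit_disk \<longrightarrow> v z = g z - a z * w z"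
    by (auto simp: vekua_op_def)
  show "weak_dbar \<i> w (\<lambda>z. v z + a z * w z)"
    by (rule weak_dbar_cong_AE[OF g(1)]) (simp, use g(2) in eventually_elim, simp)
next
  assume "weak_dbar \<i> w (\<lambda>z. v z + a z * w z)"
  then show "vekua_op \<i> a w v" unfolding vekua_op_def by (intro exI[of _ "\<lambda>z. v z + a z * w z"]) simp
qed

lemma vekua_op_cong_AE:
  assumes "vekua_op \<i> a w v" and e: "AE z in lebesgue. z \<in> unit_disk \<longrightarrow> w z = w' z"
  shows "vekua_op \<i> a w' v"
  unfolding vekua_op_iff
  by (rule weak_dbar_cong_AE[OF assms(1)[unfolded vekua_op_iff] e]) (use e in eventually_elim, simp)

lemma vekua_op_unique:
  assumes "vekua_op \<i> a w v" "vekua_op \<i> a w v'"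
  shows "AE z in lebesgue. z \<in> unit_disk \<longrightarrow> v z = v' z"
proof -
  have "AE z in lebesgue. z \<in> unit_disk \<longrightarrow> v z + a z * w z = v' z + a z * w z"
    using assms by (intro weak_dbar_unique[of w]) (simp_all add: vekua_op_iff)
  then show ?thesis by eventually_elim simp
qed

text \<open>A Dirichlet solution comes with a separate version of each iterate; this identifies them
  almost everywhere with the versions inside the relational power. Two chains may differ already in
  their intermediate functions, hence the appeal to congruence in the argument of the
  operator.\<close>

lemma vekua_power_unique:
  assumes "(vekua_op \<i> a ^^ k) w v" "(vekua_op \<i> a ^^ k) w v'"
  shows "AE z in lebesgue. z \<in> unit_disk \<longrightarrow> v z = v' z"
  using assms
proof (induction k arbitrary: v v')
  case (Suc k)
  obtain y where y: "(vekua_op \<i> a ^^ k) w y" "vekua_op \<i> a y v"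
    using Suc.prems(1) by (rule relpowp_Suc_E)
  obtain y' where y': "(vekua_op \<i> a ^^ k) w y'" "vekua_op \<i> a y' v'"
    using Suc.prems(2) by (rule relpowp_Suc_E)
  from Suc.IH[OF y(1) y'(1)] show ?case
    by (intro vekua_op_unique[OF vekua_op_cong_AE[OF y(2)] y'(2)])
qed simp

lemma polyanalytic_part_eq:
  assumes n: "n > 0" and g: "\<And>k. k < n \<Longrightarrow> continuous_on (sphere 0 1) (g k)"
    and T: "continuous_on UNIV (T_disk a)" and z: "z \<in> unit_disk"
  shows "polyanalytic_part n a g z = cauchy_sum n (\<lambda>k \<zeta>. g k \<zeta> * exp (- T_disk a \<zeta>)) z"
proof -
  \<comment> \<open>For \<open>n = 0\<close> the truncated \<open>n - 1\<close> would leave one term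
    on the left.\<close>
  have I: "{0..n - 1} = {..<n}" using n by auto
  show ?thesis
    unfolding polyanalytic_part_def cauchy_sum_def I
  proof (rule sum.cong[OF refl])
    fix k assume "k \<in> {..<n}"
    then have c: "continuous_on (sphere 0 1) (\<lambda>\<zeta>. g k \<zeta> * exp (- T_disk a \<zeta>))"
      using g by (intro continuous_intros continuous_on_subset[OF T]) auto
    have "contour_integral unit_circle (\<lambda>\<zeta>. g k \<zeta> * exp (- T_disk a \<zeta>) / fact k * (cnj (\<zeta> - z) ^ k / (\<zeta> - z)))
      = contour_integral unit_circle (\<lambda>\<zeta>. 1 / fact k * (g k \<zeta> * exp (- T_disk a \<zeta>) * cnj (\<zeta> - z) ^ k / (\<zeta> - z)))"
      by simp
    also have "\<dots> = 1 / fact k * contour_integral unit_circle (\<lambda>\<zeta>. g k \<zeta> * exp (- T_disk a \<zeta>) * cnj (\<zeta> - z) ^ k / (\<zeta> - z))"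
      by (rule contour_integral_lmul[OF cauchy_poly_integrable[OF c z]])
    finally show "(- 1) ^ k / (2 * complex_of_real pi * \<i>) *
         contour_integral unit_circle (\<lambda>\<zeta>. g k \<zeta> * exp (- T_disk a \<zeta>) / fact k * (cnj (\<zeta> - z) ^ k / (\<zeta> - z)))
       = (- 1) ^ k / fact k * cauchy_poly (\<lambda>\<zeta>. g k \<zeta> * exp (- T_disk a \<zeta>)) k z"
      by (simp add: cauchy_poly_def)
  qed
qed

text \<open>Shifting the index by \<open>k\<close> shows that the condition at level
  \<open>k\<close> is the one for the problem that starts with the \<open>k\<close>-th
  derivative.\<close>

lemma solvability_sum_eq:
  assumes k: "k < n" and g: "\<And>k. k < n \<Longrightarrow> continuous_on (sphere 0 1) (g k)"
    and T: "continuous_on UNIV (T_disk a)" and z: "z \<in> unit_disk"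
  shows "solvability_sum n a g k z =
    contour_integral unit_circle (\<lambda>\<zeta>. kernel_sum (n - k) (\<lambda>m \<zeta>. g (k + m) \<zeta> * exp (- T_disk a \<zeta>)) z \<zeta>
      * (cnj z / (1 - cnj z * \<zeta>))) / (2 * of_real pi * \<i>)"
proof -
  let ?t = "\<lambda>m \<zeta>. (-1) ^ m / fact m * (g (k + m) \<zeta> * exp (- T_disk a \<zeta>) * cnj (\<zeta> - z) ^ m) * (cnj z / (1 - cnj z * \<zeta>))"
  have nz: "1 - cnj z * \<zeta> \<noteq> 0" if "norm \<zeta> = 1" for \<zeta>
    using one_minus_cnj_mult_nonzero[of z \<zeta>] z that by auto
  have I: "{k..n - 1} = {k..<n}" using k by auto
  have i: "(\<lambda>\<zeta>. (-1) ^ m * (g (k + m) \<zeta> * exp (- T_disk a \<zeta>) / (1 - cnj z * \<zeta>)) * (cnj (\<zeta> - z) ^ m / fact m)) contour_integrable_on unit_circle"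
    "?t m contour_integrable_on unit_circle"
    if "m < n - k" for m
    using that g nz by (intro circle_integrable continuous_intros continuous_on_subset[OF T]; force)+
  have "solvability_sum n a g k z = (\<Sum>m<n - k. cnj z / (2 * of_real pi * \<i>) *
      contour_integral unit_circle (\<lambda>\<zeta>. (-1) ^ m * (g (k + m) \<zeta> * exp (- T_disk a \<zeta>) / (1 - cnj z * \<zeta>)) * (cnj (\<zeta> - z) ^ m / fact m)))"
    unfolding solvability_sum_def I by (subst sum.atLeastLessThan_shift_0) (simp add: lessThan_atLeast0)
  also have "\<dots> = (\<Sum>m<n - k. contour_integral unit_circle (?t m) / (2 * of_real pi * \<i>))"
  proof (rule sum.cong[OF refl])
    fix m assume "m \<in> {..<n - k}"
    then have "cnj z * contour_integral unit_circle (\<lambda>\<zeta>. (-1) ^ m * (g (k + m) \<zeta> * exp (- T_disk a \<zeta>) / (1 - cnj z * \<zeta>)) * (cnj (\<zeta> - z) ^ m / fact m))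
      = contour_integral unit_circle (\<lambda>\<zeta>. cnj z * ((-1) ^ m * (g (k + m) \<zeta> * exp (- T_disk a \<zeta>) / (1 - cnj z * \<zeta>)) * (cnj (\<zeta> - z) ^ m / fact m)))"
      using i by (intro contour_integral_lmul[symmetric]) auto
    also have "\<dots> = contour_integral unit_circle (?t m)"
      by (rule arg_cong[of _ _ "contour_integral unit_circle"]) (simp add: fun_eq_iff mult_ac)
    finally show "cnj z / (2 * of_real pi * \<i>) *
      contour_integral unit_circle (\<lambda>\<zeta>. (-1) ^ m * (g (k + m) \<zeta> * exp (- T_disk a \<zeta>) / (1 - cnj z * \<zeta>)) * (cnj (\<zeta> - z) ^ m / fact m))
      = contour_integral unit_circle (?t m) / (2 * of_real pi * \<i>)" by (simp only: times_divide_eq_left)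
  qed
  also have "\<dots> = contour_integral unit_circle (\<lambda>\<zeta>. \<Sum>m<n - k. ?t m \<zeta>) / (2 * of_real pi * \<i>)"
    using i(2) by (subst contour_integral_sum) (auto simp: sum_divide_distrib)
  also have "(\<lambda>\<zeta>. \<Sum>m<n - k. ?t m \<zeta>) = (\<lambda>\<zeta>. kernel_sum (n - k) (\<lambda>m \<zeta>. g (k + m) \<zeta> * exp (- T_disk a \<zeta>)) z \<zeta> * (cnj z / (1 - cnj z * \<zeta>)))"
    by (simp only: kernel_sum_def sum_distrib_right)
  finally show ?thesis .
qed

lemma has_boundary_values_mult:
  fixes v :: "complex \<Rightarrow> complex"
  assumes "has_boundary_values v g" "continuous_on UNIV s"
  shows "has_boundary_values (\<lambda>z. s z * v z) (\<lambda>z. s z * g z)"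
proof -
  have "(s \<longlongrightarrow> s x) (at x within unit_disk)" for x
    using assms(2) by (meson UNIV_I continuous_on_def tendsto_within_subset top_greatest)
  then show ?thesis
    using assms continuous_on_subset[OF assms(2)]
    unfolding has_boundary_values_def by (auto intro!: continuous_intros tendsto_mult)
qed

lemma dirichlet_solution_representation:
  assumes a: "Lq_disk q a" "q > 2" and n: "n > 0" and g: "\<And>k. k < n \<Longrightarrow> continuous_on (sphere 0 1) (g k)"
    and w: "dirichlet_solution \<i> n a g w" and z: "z \<in> unit_disk"
  shows "w z = exp (T_disk a z) * polyanalytic_part n a g z"
    and "k < n \<Longrightarrow> solvability_sum n a g k z = 0"
proof -
  note T = T_disk_continuous[OF a]
  obtain v' where v': "\<And>k. k < n \<Longrightarrow> (vekua_op \<i> a ^^ k) w (v' k)" "\<And>k. k < n \<Longrightarrow> has_boundary_values (v' k) (g k)"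
    using w unfolding dirichlet_solution_def by metis
  \<comment> \<open>Below level \<open>n\<close> the versions that carry the boundary values; at
    level \<open>n\<close> the zero function from the equation itself.\<close>
  define v where "v k = (if k < n then v' k else (\<lambda>_. 0))" for k
  have vp: "(vekua_op \<i> a ^^ k) w (v k)" if "k \<le> n" for k
    using v'(1)[of k] w that by (cases "k < n") (auto simp: v_def dirichlet_solution_def)
  have vb: "has_boundary_values (v k) (g k)" if "k < n" for k
    using v'(2) that by (simp add: v_def)
  \<comment> \<open>The relational power passes through some version \<open>y\<close> of the
    \<open>k\<close>-th iterate. It agrees almost everywhere with \<open>v k\<close>, which may
    therefore take its place.\<close>
  have vd: "weak_dbar \<i> (v k) (\<lambda>z. v (Suc k) z + a z * v k z)" if k: "k < n" for k
  proof -
    have "(vekua_op \<i> a ^^ Suc k) w (v (Suc k))" using vp[of "Suc k"] k by simp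
    then obtain y where y: "(vekua_op \<i> a ^^ k) w y" "vekua_op \<i> a y (v (Suc k))"
      by (rule relpowp_Suc_E)
    have "vekua_op \<i> a (v k) (v (Suc k))"
      using vekua_op_cong_AE[OF y(2) vekua_power_unique[OF y(1) vp]] k by simp
    then show ?thesis by (simp add: vekua_op_iff)
  qed
  define \<phi> where "\<phi> k z = exp (- T_disk a z) * v k z" for k z
  define h where "h k \<zeta> = g k \<zeta> * exp (- T_disk a \<zeta>)" for k \<zeta>
  \<comment> \<open>\<open>exp (- T_disk a z)\<close> is the exponential for the coefficient
    \<open>- a\<close>, so the product rule contributes \<open>- a z * v k z\<close>, which cancels
    the coefficient term.\<close>
  have a': "Lq_disk q (\<lambda>z. - a z)" using a by (simp add: Lq_disk_def)
  have ec: "continuous_on S (\<lambda>z. exp (- T_disk a z))" for S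
    using continuous_on_subset[OF T] by (intro continuous_intros) auto
  have hc: "continuous_on (sphere 0 1) (h k)" if "k < n" for k
    unfolding h_def by (rule continuous_on_mult[OF g[OF that] ec])
  have \<phi>b: "has_boundary_values (\<phi> k) (h k)" if "k < n" for k
    using has_boundary_values_mult[OF vb[OF that] ec] by (simp add: \<phi>_def[abs_def] h_def[abs_def] mult.commute)
  have \<phi>d: "weak_dbar \<i> (\<phi> k) (\<phi> (Suc k))" if "k < n" for k
  proof -
    have "continuous_on unit_disk (v k)" using vb[OF that] by (simp add: has_boundary_values_def)
    from weak_dbar_exp_T_disk[OF a' a(2) this vd[OF that]]
    show ?thesis by (simp add: T_disk_uminus \<phi>_def[abs_def])
  qed
  have \<phi>n: "\<phi> n z = 0" for z by (simp add: \<phi>_def v_def)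
  have v0: "v 0 = w" using vp[of 0] by simp
  have "\<phi> 0 z = cauchy_sum n h z"
    by (rule polyanalytic_representation(1)[OF \<phi>b hc \<phi>d \<phi>n n z])
  then have "exp (- T_disk a z) * w z = polyanalytic_part n a g z"
    using polyanalytic_part_eq[OF n g T z] by (simp add: \<phi>_def v0 h_def[abs_def])
  then have "exp (T_disk a z) * (exp (- T_disk a z) * w z) = exp (T_disk a z) * polyanalytic_part n a g z"
    by simp
  then show "w z = exp (T_disk a z) * polyanalytic_part n a g z"
    by (simp add: mult.assoc[symmetric] exp_add[symmetric])
  show "solvability_sum n a g k z = 0" if k: "k < n"
  proof -
    \<comment> \<open>The chain is entered at level \<open>k\<close> and has \<open>n - k\<close>
      steps left.\<close>
    have "contour_integral unit_circle (\<lambda>\<zeta>. kernel_sum (n - k) (\<lambda>m. h (k + m)) z \<zeta> * (cnj z / (1 - cnj z * \<zeta>))) = 0"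
      by (rule polyanalytic_representation(2)[where \<phi>="\<lambda>m. \<phi> (k + m)"])
        (use \<phi>b hc \<phi>d \<phi>n k z in auto)
    then show ?thesis using solvability_sum_eq[OF k g T z] by (simp add: h_def[abs_def])
  qed
qed

text \<open>\<open>\<Phi> k\<close> is built from the data of levels \<open>k\<close> to
  \<open>n - 1\<close>. Differentiation leads from \<open>\<Phi> k\<close> to
  \<open>\<Phi> (Suc k)\<close>, the condition at level \<open>k\<close> yields the boundary values
  of \<open>\<Phi> k\<close>, and \<open>\<Phi> n\<close> is an empty sum, so the chain ends in
  zero.\<close>

lemma dirichlet_solution_exists:
  assumes a: "Lq_disk q a" "q > 2" and n: "n > 0" and g: "\<And>k. k < n \<Longrightarrow> continuous_on (sphere 0 1) (g k)"
    and s: "\<And>z k. z \<in> unit_disk \<Longrightarrow> k < n \<Longrightarrow> solvability_sum n a g k z = 0"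
  shows "\<exists>w. dirichlet_solution \<i> n a g w"
proof -
  note T = T_disk_continuous[OF a]
  define h where "h k \<zeta> = g k \<zeta> * exp (- T_disk a \<zeta>)" for k \<zeta>
  have ec: "continuous_on UNIV (\<lambda>z. exp (T_disk a z))" "continuous_on S (\<lambda>z. exp (- T_disk a z))" for S
    using continuous_on_subset[OF T] by (intro continuous_intros; auto)+
  have hc: "continuous_on (sphere 0 1) (h k)" if "k < n" for k
    unfolding h_def by (rule continuous_on_mult[OF g[OF that] ec(2)])
  define \<Phi> where "\<Phi> k = cauchy_sum (n - k) (\<lambda>m. h (k + m))" for k
  define W where "W k z = exp (T_disk a z) * \<Phi> k z" for k z
  have \<Phi>b: "has_boundary_values (\<Phi> k) (h k)" if k: "k < n" for k
  proof -
    have "has_boundary_values (cauchy_sum (n - k) (\<lambda>m. h (k + m))) (h (k + 0))"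
    proof (rule cauchy_sum_boundary)
      fix z :: complex assume z: "z \<in> unit_disk"
      show "contour_integral unit_circle (\<lambda>\<zeta>. kernel_sum (n - k) (\<lambda>m. h (k + m)) z \<zeta> * (cnj z / (1 - cnj z * \<zeta>))) = 0"
        using s[OF z k] solvability_sum_eq[OF k g T z] by (simp add: h_def[abs_def])
    qed (use hc k in auto)
    then show ?thesis by (simp add: \<Phi>_def)
  qed
  have \<Phi>d: "weak_dbar \<i> (\<Phi> k) (\<Phi> (Suc k))" if k: "k < n" for k
  proof -
    have e: "n - k = Suc (n - Suc k)" using k by simp
    have "weak_dbar \<i> (cauchy_sum (Suc (n - Suc k)) (\<lambda>m. h (k + m))) (cauchy_sum (n - Suc k) (\<lambda>m. h (k + Suc m)))"
      by (rule weak_dbar_cauchy_sum) (use hc k in auto)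
    then show ?thesis unfolding \<Phi>_def e by simp
  qed
  have Wv: "vekua_op \<i> a (W k) (W (Suc k))" if k: "k < n" for k
  proof -
    have "continuous_on unit_disk (\<Phi> k)" using \<Phi>b[OF k] by (simp add: has_boundary_values_def)
    from weak_dbar_exp_T_disk[OF a this \<Phi>d[OF k]]
    have "weak_dbar \<i> (W k) (\<lambda>z. W (Suc k) z + a z * W k z)"
      by (simp add: W_def[abs_def] distrib_left mult_ac)
    then show ?thesis by (simp only: vekua_op_iff)
  qed
  have Wp: "(vekua_op \<i> a ^^ k) (W 0) (W k)" if "k \<le> n" for k
    using that
  proof (induction k)
    case (Suc k)
    then have 1: "(vekua_op \<i> a ^^ k) (W 0) (W k)" and 2: "vekua_op \<i> a (W k) (W (Suc k))"
      using Wv by auto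
    show ?case by (rule relpowp_Suc_I[where P="vekua_op \<i> a", OF 1 2])
  qed simp
  have "W n = (\<lambda>_. 0)" by (simp add: W_def[abs_def] \<Phi>_def cauchy_sum_def)
  then have "(vekua_op \<i> a ^^ n) (W 0) (\<lambda>_. 0)" using Wp[of n] by simp
  moreover have "has_boundary_values (W k) (g k)" if "k < n" for k
  proof -
    have "exp (T_disk a z) * h k z = g k z" for z by (simp add: h_def exp_minus)
    then show ?thesis
      using has_boundary_values_mult[OF \<Phi>b[OF that] ec(1)] by (simp add: W_def[abs_def])
  qed
  ultimately show ?thesis
    unfolding dirichlet_solution_def using Wp less_imp_le by blast
qed

section \<open>Bicomplex functions and their components\<close>

text \<open>The plus part satisfies an equation with the derivative in \<open>z\<close>; after
  conjugation it is one with d-bar, of the same kind as for the minus part.\<close>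

definition plus_conj :: "bicomplex \<Rightarrow> complex"
  where "plus_conj w = cnj (plus_part w)"

definition assemble :: "complex \<Rightarrow> complex \<Rightarrow> bicomplex"
  where "assemble a b = p_plus * bicomplex_of (cnj a) + p_minus * bicomplex_of b"

lemma parts_assemble [simp]: "plus_conj (assemble a b) = a" "minus_part (assemble a b) = b"
  by (simp_all add: assemble_def plus_conj_def idempotent_parts)

lemma assemble_parts [simp]: "assemble (plus_conj w) (minus_part w) = w"
  unfolding assemble_def plus_conj_def complex_cnj_cnj
  using idempotent_decomposition[of w "plus_part w" "minus_part w"] by simp

lemma bicomplex_eq_iff_parts: "w = v \<longleftrightarrow> plus_conj w = plus_conj v \<and> minus_part w = minus_part v"
  by (metis assemble_parts)

lemma bounded_linear_parts: "bounded_linear plus_conj" "bounded_linear minus_part"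
  by (auto intro!: linearI simp: linear_conv_bounded_linear[symmetric] plus_conj_def plus_part_def
      minus_part_def complex_eq_iff algebra_simps)

lemma bounded_linear_assemble: "bounded_linear (\<lambda>p. assemble (fst p) (snd p))"
  by (auto intro!: linearI simp: linear_conv_bounded_linear[symmetric] bicomplex_eq_iff_parts
      bounded_linear.linear[OF bounded_linear_parts(1), THEN linear_add]
      bounded_linear.linear[OF bounded_linear_parts(2), THEN linear_add]
      bounded_linear.linear[OF bounded_linear_parts(1), THEN linear_cmul]
      bounded_linear.linear[OF bounded_linear_parts(2), THEN linear_cmul])

text \<open>Being multiplicative and mapping \<open>bj\<close> to \<open>\<i>\<close>, both
  components carry the bicomplex operator to d-bar minus the corresponding component of the
  coefficient.\<close>

lemma parts_mult:
  "plus_conj (w * v) = plus_conj w * plus_conj v" "minus_part (w * v) = minus_part w * minus_part v"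
  "plus_conj bj = \<i>" "minus_part bj = \<i>"
  by (simp_all add: plus_conj_def plus_part_def minus_part_def bj_def complex_eq_iff algebra_simps)

lemma integrable_parts_iff:
  fixes f :: "complex \<Rightarrow> bicomplex"
  shows "integrable M f \<longleftrightarrow> integrable M (\<lambda>z. plus_conj (f z)) \<and> integrable M (\<lambda>z. minus_part (f z))"
proof safe
  assume "integrable M f"
  then show "integrable M (\<lambda>z. plus_conj (f z))" "integrable M (\<lambda>z. minus_part (f z))"
    using integrable_bounded_linear bounded_linear_parts by blast+
next
  assume "integrable M (\<lambda>z. plus_conj (f z))" "integrable M (\<lambda>z. minus_part (f z))"
  then have "integrable M (\<lambda>z. assemble (fst (plus_conj (f z), 0 :: complex)) (snd (0 :: complex, 0)))"
    "integrable M (\<lambda>z. assemble 0 (minus_part (f z)))"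
    using integrable_bounded_linear[OF bounded_linear_compose[OF bounded_linear_assemble bounded_linear_Pair[OF bounded_linear_ident bounded_linear_zero]]]
      integrable_bounded_linear[OF bounded_linear_compose[OF bounded_linear_assemble bounded_linear_Pair[OF bounded_linear_zero bounded_linear_ident]]]
    by fastforce+
  then have "integrable M (\<lambda>z. assemble (plus_conj (f z)) 0 + assemble 0 (minus_part (f z)))"
    by auto
  moreover have "assemble (plus_conj (f z)) 0 + assemble 0 (minus_part (f z)) = f z" for z
    by (simp add: bicomplex_eq_iff_parts bounded_linear.linear[OF bounded_linear_parts(1), THEN linear_add]
      bounded_linear.linear[OF bounded_linear_parts(2), THEN linear_add])
  ultimately show "integrable M f" by simp
qed

lemma parts_scaleR: "plus_conj (r *\<^sub>R w) = r *\<^sub>R plus_conj w" "minus_part (r *\<^sub>R w) = r *\<^sub>R minus_part w"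
  using bounded_linear_parts by (auto simp: bounded_linear.linear linear_cmul)

lemma parts_add:
  "plus_conj (w + v) = plus_conj w + plus_conj v" "minus_part (w + v) = minus_part w + minus_part v"
  "plus_conj (w - v) = plus_conj w - plus_conj v" "minus_part (w - v) = minus_part w - minus_part v"
  "plus_conj (- w) = - plus_conj w" "minus_part (- w) = - minus_part w"
  by (simp_all add: plus_conj_def plus_part_def minus_part_def algebra_simps)

lemma set_integrable_parts_iff:
  fixes f :: "complex \<Rightarrow> bicomplex"
  shows "set_integrable M K f \<longleftrightarrow> set_integrable M K (\<lambda>z. plus_conj (f z)) \<and> set_integrable M K (\<lambda>z. minus_part (f z))"
  unfolding set_integrable_def by (subst integrable_parts_iff) (simp add: parts_scaleR)

lemma locally_integrable_parts_iff:
  "locally_integrable f \<longleftrightarrow> locally_integrable (\<lambda>z. plus_conj (f z)) \<and> locally_integrable (\<lambda>z. minus_part (f z))"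
  unfolding locally_integrable_def set_integrable_parts_iff[of _ _ f] by blast

lemma set_integral_parts:
  fixes f :: "complex \<Rightarrow> bicomplex"
  assumes "set_integrable M K f"
  shows "plus_conj (LINT z:K|M. f z) = (LINT z:K|M. plus_conj (f z))"
    "minus_part (LINT z:K|M. f z) = (LINT z:K|M. minus_part (f z))"
proof -
  have i: "integrable M (\<lambda>z. indicator K z *\<^sub>R f z)" using assms by (simp add: set_integrable_def)
  show "plus_conj (LINT z:K|M. f z) = (LINT z:K|M. plus_conj (f z))"
    using integral_bounded_linear[OF bounded_linear_parts(1) i] by (simp add: set_lebesgue_integral_def parts_scaleR)
  show "minus_part (LINT z:K|M. f z) = (LINT z:K|M. minus_part (f z))"
    using integral_bounded_linear[OF bounded_linear_parts(2) i] by (simp add: set_lebesgue_integral_def parts_scaleR)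
qed

text \<open>The components are bounded real-linear maps and hence commute with integrals of
  integrable functions. If local integrability fails for \<open>w\<close> or \<open>g\<close>, it
  fails for one of its components, and both sides are false.\<close>

lemma weak_dbar_parts_iff:
  "weak_dbar bj w g \<longleftrightarrow> weak_dbar \<i> (\<lambda>z. plus_conj (w z)) (\<lambda>z. plus_conj (g z)) \<and>
    weak_dbar \<i> (\<lambda>z. minus_part (w z)) (\<lambda>z. minus_part (g z))"
proof (cases "locally_integrable w \<and> locally_integrable g")
  case False
  then show ?thesis unfolding weak_dbar_def using locally_integrable_parts_iff[of w] locally_integrable_parts_iff[of g] by blast
next
  case True
  then have li: "locally_integrable (\<lambda>z. plus_conj (w z))" "locally_integrable (\<lambda>z. minus_part (w z))"
    "locally_integrable (\<lambda>z. plus_conj (g z))" "locally_integrable (\<lambda>z. minus_part (g z))"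
    using locally_integrable_parts_iff by blast+
  have eq: "(LINT z:unit_disk|lebesgue.
          (1 / 2) *\<^sub>R (frechet_derivative \<phi> (at z) 1 *\<^sub>R w z + bj * (frechet_derivative \<phi> (at z) \<i> *\<^sub>R w z)))
        = - (LINT z:unit_disk|lebesgue. \<phi> z *\<^sub>R g z) \<longleftrightarrow>
    (LINT z:unit_disk|lebesgue. (1 / 2) *\<^sub>R (frechet_derivative \<phi> (at z) 1 *\<^sub>R plus_conj (w z)
       + \<i> * (frechet_derivative \<phi> (at z) \<i> *\<^sub>R plus_conj (w z))))
        = - (LINT z:unit_disk|lebesgue. \<phi> z *\<^sub>R plus_conj (g z)) \<and>
    (LINT z:unit_disk|lebesgue. (1 / 2) *\<^sub>R (frechet_derivative \<phi> (at z) 1 *\<^sub>R minus_part (w z)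
       + \<i> * (frechet_derivative \<phi> (at z) \<i> *\<^sub>R minus_part (w z))))
        = - (LINT z:unit_disk|lebesgue. \<phi> z *\<^sub>R minus_part (g z))"
    if \<phi>: "test_function \<phi>" for \<phi>
  proof -
    let ?F = "\<lambda>z. (1 / 2) *\<^sub>R (frechet_derivative \<phi> (at z) 1 *\<^sub>R w z + bj * (frechet_derivative \<phi> (at z) \<i> *\<^sub>R w z))"
    have e: "(of_real (frechet_derivative \<phi> (at z) 1) + \<i> * of_real (frechet_derivative \<phi> (at z) \<i>)) / 2 * u
      = (1 / 2) *\<^sub>R (frechet_derivative \<phi> (at z) 1 *\<^sub>R u + \<i> * (frechet_derivative \<phi> (at z) \<i> *\<^sub>R u))" for z u
      by (simp add: scaleR_conv_of_real algebra_simps add_divide_distrib)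
    note i = li(1,2)[THEN complex_test_integrable(2), OF complex_test_real[OF \<phi>], unfolded e]
      li(3,4)[THEN complex_test_integrable(1), OF complex_test_real[OF \<phi>], folded scaleR_conv_of_real]
    have F: "set_integrable lebesgue unit_disk ?F"
      using i(1,2) by (subst set_integrable_parts_iff) (simp only: parts_scaleR parts_add parts_mult simp_thms)
    have H: "set_integrable lebesgue unit_disk (\<lambda>z. \<phi> z *\<^sub>R g z)"
      using i(3,4) by (subst set_integrable_parts_iff) (simp only: parts_scaleR simp_thms)
    show ?thesis
      unfolding bicomplex_eq_iff_parts[of "LINT z:unit_disk|lebesgue. ?F z"] parts_add
        set_integral_parts[OF F] set_integral_parts[OF H] parts_scaleR parts_mult ..
  qed
  show ?thesis unfolding weak_dbar_def using True li eq by (simp only: simp_thms) blast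
qed

lemma vekua_op_parts_iff:
  "vekua_op bj A w v \<longleftrightarrow> vekua_op \<i> (\<lambda>z. plus_conj (A z)) (\<lambda>z. plus_conj (w z)) (\<lambda>z. plus_conj (v z)) \<and>
    vekua_op \<i> (\<lambda>z. minus_part (A z)) (\<lambda>z. minus_part (w z)) (\<lambda>z. minus_part (v z))"
proof (intro iffI conjI)
  assume "vekua_op bj A w v"
  then obtain g where g: "weak_dbar bj w g" "AE z in lebesgue. z \<in> unit_disk \<longrightarrow> v z = g z - A z * w z"
    by (auto simp: vekua_op_def)
  have "AE z in lebesgue. z \<in> unit_disk \<longrightarrow> plus_conj (v z) = plus_conj (g z) - plus_conj (A z) * plus_conj (w z)"
    using g(2) by eventually_elim (simp add: parts_add parts_mult)
  then show "vekua_op \<i> (\<lambda>z. plus_conj (A z)) (\<lambda>z. plus_conj (w z)) (\<lambda>z. plus_conj (v z))"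
    using g(1) by (auto simp: vekua_op_def weak_dbar_parts_iff)
  have "AE z in lebesgue. z \<in> unit_disk \<longrightarrow> minus_part (v z) = minus_part (g z) - minus_part (A z) * minus_part (w z)"
    using g(2) by eventually_elim (simp add: parts_add parts_mult)
  then show "vekua_op \<i> (\<lambda>z. minus_part (A z)) (\<lambda>z. minus_part (w z)) (\<lambda>z. minus_part (v z))"
    using g(1) by (auto simp: vekua_op_def weak_dbar_parts_iff)
next
  assume "vekua_op \<i> (\<lambda>z. plus_conj (A z)) (\<lambda>z. plus_conj (w z)) (\<lambda>z. plus_conj (v z)) \<and>
    vekua_op \<i> (\<lambda>z. minus_part (A z)) (\<lambda>z. minus_part (w z)) (\<lambda>z. minus_part (v z))"
  then obtain g h where g: "weak_dbar \<i> (\<lambda>z. plus_conj (w z)) g"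
      "AE z in lebesgue. z \<in> unit_disk \<longrightarrow> plus_conj (v z) = g z - plus_conj (A z) * plus_conj (w z)"
    and h: "weak_dbar \<i> (\<lambda>z. minus_part (w z)) h"
      "AE z in lebesgue. z \<in> unit_disk \<longrightarrow> minus_part (v z) = h z - minus_part (A z) * minus_part (w z)"
    by (auto simp: vekua_op_def)
  have "weak_dbar bj w (\<lambda>z. assemble (g z) (h z))" using g(1) h(1) by (simp add: weak_dbar_parts_iff)
  moreover have "AE z in lebesgue. z \<in> unit_disk \<longrightarrow> v z = assemble (g z) (h z) - A z * w z"
    using g(2) h(2) by eventually_elim (simp add: bicomplex_eq_iff_parts parts_add parts_mult)
  ultimately show "vekua_op bj A w v" unfolding vekua_op_def by blast
qed

text \<open>The intermediate functions of the two complex chains are found independently;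
  \<open>assemble\<close> joins them pointwise into a bicomplex chain.\<close>

lemma vekua_power_parts_iff:
  "(vekua_op bj A ^^ k) w v \<longleftrightarrow>
    (vekua_op \<i> (\<lambda>z. plus_conj (A z)) ^^ k) (\<lambda>z. plus_conj (w z)) (\<lambda>z. plus_conj (v z)) \<and>
    (vekua_op \<i> (\<lambda>z. minus_part (A z)) ^^ k) (\<lambda>z. minus_part (w z)) (\<lambda>z. minus_part (v z))"
proof (induction k arbitrary: v)
  case 0
  then show ?case by (auto simp: fun_eq_iff bicomplex_eq_iff_parts)
next
  case (Suc k)
  let ?P = "vekua_op \<i> (\<lambda>z. plus_conj (A z))" and ?M = "vekua_op \<i> (\<lambda>z. minus_part (A z))"
  show ?case
  proof
    assume "(vekua_op bj A ^^ Suc k) w v"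
    then obtain y where "(vekua_op bj A ^^ k) w y" "vekua_op bj A y v" by (rule relpowp_Suc_E)
    then show "(?P ^^ Suc k) (\<lambda>z. plus_conj (w z)) (\<lambda>z. plus_conj (v z)) \<and>
      (?M ^^ Suc k) (\<lambda>z. minus_part (w z)) (\<lambda>z. minus_part (v z))"
      unfolding Suc.IH vekua_op_parts_iff[of A y v] by (blast intro: relpowp_Suc_I)
  next
    assume a: "(?P ^^ Suc k) (\<lambda>z. plus_conj (w z)) (\<lambda>z. plus_conj (v z)) \<and>
      (?M ^^ Suc k) (\<lambda>z. minus_part (w z)) (\<lambda>z. minus_part (v z))"
    obtain y1 where y1: "(?P ^^ k) (\<lambda>z. plus_conj (w z)) y1" "?P y1 (\<lambda>z. plus_conj (v z))"
      using conjunct1[OF a] by (rule relpowp_Suc_E)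
    obtain y2 where y2: "(?M ^^ k) (\<lambda>z. minus_part (w z)) y2" "?M y2 (\<lambda>z. minus_part (v z))"
      using conjunct2[OF a] by (rule relpowp_Suc_E)
    have 1: "(vekua_op bj A ^^ k) w (\<lambda>z. assemble (y1 z) (y2 z))" using y1 y2 by (simp add: Suc.IH)
    have 2: "vekua_op bj A (\<lambda>z. assemble (y1 z) (y2 z)) v" using y1 y2 by (simp add: vekua_op_parts_iff)
    show "(vekua_op bj A ^^ Suc k) w v" by (rule relpowp_Suc_I[where P="vekua_op bj A", OF 1 2])
  qed
qed

lemma tendsto_parts_iff:
  "(v \<longlongrightarrow> c) F \<longleftrightarrow> ((\<lambda>z. plus_conj (v z)) \<longlongrightarrow> plus_conj c) F \<and> ((\<lambda>z. minus_part (v z)) \<longlongrightarrow> minus_part c) F"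
proof safe
  assume "(v \<longlongrightarrow> c) F"
  then show "((\<lambda>z. plus_conj (v z)) \<longlongrightarrow> plus_conj c) F" "((\<lambda>z. minus_part (v z)) \<longlongrightarrow> minus_part c) F"
    using bounded_linear.tendsto bounded_linear_parts by blast+
next
  assume "((\<lambda>z. plus_conj (v z)) \<longlongrightarrow> plus_conj c) F" "((\<lambda>z. minus_part (v z)) \<longlongrightarrow> minus_part c) F"
  then have "((\<lambda>z. (plus_conj (v z), minus_part (v z))) \<longlongrightarrow> (plus_conj c, minus_part c)) F" by (rule tendsto_Pair)
  from bounded_linear.tendsto[OF bounded_linear_assemble this] show "(v \<longlongrightarrow> c) F" by simp
qed

lemma has_boundary_values_parts_iff:
  "has_boundary_values v g \<longleftrightarrow> has_boundary_values (\<lambda>z. plus_conj (v z)) (\<lambda>z. plus_conj (g z)) \<and>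
    has_boundary_values (\<lambda>z. minus_part (v z)) (\<lambda>z. minus_part (g z))"
  unfolding has_boundary_values_def continuous_on_def
  by (subst (1 2) tendsto_parts_iff) blast

lemma dirichlet_solution_parts_iff:
  "dirichlet_solution bj n A g w \<longleftrightarrow>
    dirichlet_solution \<i> n (\<lambda>z. plus_conj (A z)) (\<lambda>k z. plus_conj (g k z)) (\<lambda>z. plus_conj (w z)) \<and>
    dirichlet_solution \<i> n (\<lambda>z. minus_part (A z)) (\<lambda>k z. minus_part (g k z)) (\<lambda>z. minus_part (w z))"
  (is "?L \<longleftrightarrow> ?P \<and> ?M")
proof (intro iffI conjI)
  assume L: ?L
  have z: "plus_conj 0 = 0" "minus_part 0 = 0" by (simp_all add: plus_conj_def plus_part_def minus_part_def)
  from L show ?P ?M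
    unfolding dirichlet_solution_def vekua_power_parts_iff has_boundary_values_parts_iff z by blast+
next
  assume PM: "?P \<and> ?M"
  have z: "plus_conj 0 = 0" "minus_part 0 = 0" by (simp_all add: plus_conj_def plus_part_def minus_part_def)
  have "\<exists>v. (vekua_op bj A ^^ k) w v \<and> has_boundary_values v (g k)" if k: "k < n" for k
  proof -
    obtain v1 where v1: "(vekua_op \<i> (\<lambda>z. plus_conj (A z)) ^^ k) (\<lambda>z. plus_conj (w z)) v1"
        "has_boundary_values v1 (\<lambda>z. plus_conj (g k z))"
      using PM k unfolding dirichlet_solution_def by blast
    obtain v2 where v2: "(vekua_op \<i> (\<lambda>z. minus_part (A z)) ^^ k) (\<lambda>z. minus_part (w z)) v2"
        "has_boundary_values v2 (\<lambda>z. minus_part (g k z))"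
      using PM k unfolding dirichlet_solution_def by blast
    show ?thesis
      \<comment> \<open>The two components may use unrelated versions \<open>v1\<close> and
        \<open>v2\<close>; their pointwise combination is a version with the bicomplex boundary
        values.\<close>
      using v1 v2 by (intro exI[of _ "\<lambda>z. assemble (v1 z) (v2 z)"])
        (simp add: vekua_power_parts_iff has_boundary_values_parts_iff)
  qed
  moreover have "(vekua_op bj A ^^ n) w (\<lambda>_. 0)"
    using PM unfolding dirichlet_solution_def vekua_power_parts_iff z by blast
  ultimately show ?L unfolding dirichlet_solution_def by blast
qed

text \<open>A bounded linear map enlarges the norm by at most a constant \<open>K\<close>, hence the
  integrand by at most \<open>K powr q\<close>.\<close>

lemma Lq_disk_parts:
  assumes A: "Lq_disk q A" and q: "q > 2" and T: "T = plus_conj \<or> T = minus_part"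
  shows "Lq_disk q (\<lambda>z. T (A z))"
proof -
  have T: "bounded_linear T" using T bounded_linear_parts by auto
  then obtain K where K: "\<And>w. norm (T w) \<le> norm w * K" "K > 0"
    using bounded_linear.pos_bounded by blast
  have Tm: "T \<in> borel_measurable borel"
    using bounded_linear.continuous_on[OF T continuous_on_id, of UNIV] by (intro borel_measurable_continuous_onI) simp
  have Am: "A \<in> borel_measurable (lebesgue_on unit_disk)" using A by (simp add: Lq_disk_def)
  have m: "(\<lambda>z. T (A z)) \<in> borel_measurable (lebesgue_on unit_disk)" by (rule measurable_compose[OF Am Tm])
  have i: "integrable lebesgue (\<lambda>z. indicator unit_disk z *\<^sub>R (norm (A z) powr q))"
    using A by (simp add: Lq_disk_def set_integrable_def)
  have "(\<lambda>z. norm (T (A z)) powr q) \<in> borel_measurable (lebesgue_on unit_disk)"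
    using m by (intro powr_real_measurable borel_measurable_norm) auto
  then have m': "(\<lambda>z. indicator unit_disk z *\<^sub>R (norm (T (A z)) powr q)) \<in> borel_measurable lebesgue"
    using borel_measurable_restrict_space_iff[of unit_disk lebesgue "\<lambda>z. norm (T (A z)) powr q"] by simp
  have "integrable lebesgue (\<lambda>z. indicator unit_disk z *\<^sub>R (norm (T (A z)) powr q))"
  proof (rule Bochner_Integration.integrable_bound[OF _ m'])
    show "integrable lebesgue (\<lambda>z. K powr q * (indicator unit_disk z *\<^sub>R (norm (A z) powr q)))"
      using i by (rule integrable_mult_right)
    show "AE z in lebesgue. norm (indicator unit_disk z *\<^sub>R (norm (T (A z)) powr q))
      \<le> norm (K powr q * (indicator unit_disk z *\<^sub>R (norm (A z) powr q)))"
    proof (rule AE_I2)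
      fix z
      have "norm (T (A z)) powr q \<le> (norm (A z) * K) powr q" using K q by (intro powr_mono2) auto
      also have "\<dots> = K powr q * norm (A z) powr q" using K by (simp add: powr_mult)
      finally show "norm (indicator unit_disk z *\<^sub>R (norm (T (A z)) powr q))
        \<le> norm (K powr q * (indicator unit_disk z *\<^sub>R (norm (A z) powr q)))"
        by (auto simp: indicator_def)
    qed
  qed
  then show ?thesis using m by (simp add: Lq_disk_def set_integrable_def)
qed

text \<open>The first conjunct speaks of arbitrary solutions \<open>u\<close> and \<open>v\<close>;
  the third ties them to \<open>w\<close>, which expresses that one function serves in both (1) and
  (2). The formula is asserted on the disk because the problem does not constrain \<open>w\<close>
  elsewhere.\<close>

theorem theorem3p17:
  fixes n :: nat and q :: real
    and A :: "complex \<Rightarrow> bicomplex" and \<gamma> :: "nat \<Rightarrow> complex \<Rightarrow> bicomplex"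
    and Ap Am :: "complex \<Rightarrow> complex" and \<gamma>p \<gamma>m :: "nat \<Rightarrow> complex \<Rightarrow> complex"
  defines "Ap \<equiv> \<lambda>z. cnj (plus_part (A z))"
    and "Am \<equiv> \<lambda>z. minus_part (A z)"
    and "\<gamma>p \<equiv> \<lambda>k \<zeta>. cnj (plus_part (\<gamma> k \<zeta>))"
    and "\<gamma>m \<equiv> \<lambda>k \<zeta>. minus_part (\<gamma> k \<zeta>)"
  assumes "n \<ge> 1" and "q > 2"
    and "sobolev (n - 1) q A"
    and "\<And>k. k < n \<Longrightarrow> continuous_on (sphere 0 1) (\<gamma> k)"
  shows
    "((\<exists>w. dirichlet_solution bj n A \<gamma> w) \<longleftrightarrow>
        (\<exists>u. dirichlet_solution \<i> n Ap \<gamma>p u) \<and> (\<exists>v. dirichlet_solution \<i> n Am \<gamma>m v)) \<and>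
     ((\<exists>w. dirichlet_solution bj n A \<gamma> w) \<longleftrightarrow>
        (\<forall>z k. cmod z < 1 \<longrightarrow> k < n \<longrightarrow>
          solvability_sum n Ap \<gamma>p k z = 0 \<and> solvability_sum n Am \<gamma>m k z = 0)) \<and>
     (\<forall>w. dirichlet_solution bj n A \<gamma> w \<longleftrightarrow>
        dirichlet_solution \<i> n Ap \<gamma>p (\<lambda>z. cnj (plus_part (w z))) \<and>
        dirichlet_solution \<i> n Am \<gamma>m (\<lambda>z. minus_part (w z))) \<and>
     (\<forall>w. dirichlet_solution bj n A \<gamma> w \<longrightarrow>
        (\<forall>z\<in>unit_disk. w z =
          p_plus * bicomplex_of (cnj (exp (T_disk Ap z) * polyanalytic_part n Ap \<gamma>p z))
          + p_minus * bicomplex_of (exp (T_disk Am z) * polyanalytic_part n Am \<gamma>m z)))"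
proof -
  have e: "Ap = (\<lambda>z. plus_conj (A z))" "Am = (\<lambda>z. minus_part (A z))"
    "\<gamma>p = (\<lambda>k z. plus_conj (\<gamma> k z))" "\<gamma>m = (\<lambda>k z. minus_part (\<gamma> k z))"
    by (simp_all add: Ap_def Am_def \<gamma>p_def \<gamma>m_def plus_conj_def)
  \<comment> \<open>Both clauses of \<open>sobolev\<close> contain membership in
    \<open>L\<^sup>q\<close>.\<close>
  have "Lq_disk q A" using assms(7) by (cases "n - 1") auto
  then have Lq: "Lq_disk q Ap" "Lq_disk q Am" unfolding e using Lq_disk_parts \<open>q > 2\<close> by blast+
  have c: "continuous_on (sphere 0 1) (\<gamma>p k)" "continuous_on (sphere 0 1) (\<gamma>m k)" if "k < n" for k
    unfolding e using assms(8)[OF that] bounded_linear_parts bounded_linear.continuous_on by blast+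
  have n: "n > 0" using assms(5) by simp
  have parts: "dirichlet_solution bj n A \<gamma> w \<longleftrightarrow>
        dirichlet_solution \<i> n Ap \<gamma>p (\<lambda>z. plus_conj (w z)) \<and>
        dirichlet_solution \<i> n Am \<gamma>m (\<lambda>z. minus_part (w z))" for w
    unfolding e by (rule dirichlet_solution_parts_iff)
  have ex: "(\<exists>w. dirichlet_solution bj n A \<gamma> w) \<longleftrightarrow>
        (\<exists>u. dirichlet_solution \<i> n Ap \<gamma>p u) \<and> (\<exists>v. dirichlet_solution \<i> n Am \<gamma>m v)"
  proof (intro iffI; elim exE conjE)
    fix u v assume "dirichlet_solution \<i> n Ap \<gamma>p u" "dirichlet_solution \<i> n Am \<gamma>m v"
    then have "dirichlet_solution bj n A \<gamma> (\<lambda>z. assemble (u z) (v z))" by (simp add: parts)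
    then show "\<exists>w. dirichlet_solution bj n A \<gamma> w" by blast
  qed (use parts in blast)
  have solv: "(\<exists>u. dirichlet_solution \<i> n a g u) \<longleftrightarrow> (\<forall>z k. cmod z < 1 \<longrightarrow> k < n \<longrightarrow> solvability_sum n a g k z = 0)"
    if "Lq_disk q a" "\<And>k. k < n \<Longrightarrow> continuous_on (sphere 0 1) (g k)" for a g
    using dirichlet_solution_representation(2)[where g=g, OF that(1) \<open>q > 2\<close> n that(2)]
      dirichlet_solution_exists[where g=g, OF that(1) \<open>q > 2\<close> n that(2)] by auto
  have formula: "w z = assemble (exp (T_disk Ap z) * polyanalytic_part n Ap \<gamma>p z)
      (exp (T_disk Am z) * polyanalytic_part n Am \<gamma>m z)"
    if "dirichlet_solution bj n A \<gamma> w" "z \<in> unit_disk" for w z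
  proof -
    have "dirichlet_solution \<i> n Ap \<gamma>p (\<lambda>z. plus_conj (w z))" "dirichlet_solution \<i> n Am \<gamma>m (\<lambda>z. minus_part (w z))"
      using that(1) parts by blast+
    then have "plus_conj (w z) = exp (T_disk Ap z) * polyanalytic_part n Ap \<gamma>p z"
      "minus_part (w z) = exp (T_disk Am z) * polyanalytic_part n Am \<gamma>m z"
      using dirichlet_solution_representation(1)[where g=\<gamma>p, OF Lq(1) \<open>q > 2\<close> n c(1) _ that(2)]
        dirichlet_solution_representation(1)[where g=\<gamma>m, OF Lq(2) \<open>q > 2\<close> n c(2) _ that(2)] by fast+
    then show ?thesis by (simp add: bicomplex_eq_iff_parts)
  qed
  show ?thesis
  proof (intro conjI ex allI ballI impI)
    show "(\<exists>w. dirichlet_solution bj n A \<gamma> w) \<longleftrightarrow>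
        (\<forall>z k. cmod z < 1 \<longrightarrow> k < n \<longrightarrow>
          solvability_sum n Ap \<gamma>p k z = 0 \<and> solvability_sum n Am \<gamma>m k z = 0)"
    proof -
      have "(\<exists>u. dirichlet_solution \<i> n Ap \<gamma>p u) \<longleftrightarrow> (\<forall>z k. cmod z < 1 \<longrightarrow> k < n \<longrightarrow> solvability_sum n Ap \<gamma>p k z = 0)"
        by (rule solv[OF Lq(1) c(1)])
      moreover have "(\<exists>u. dirichlet_solution \<i> n Am \<gamma>m u) \<longleftrightarrow> (\<forall>z k. cmod z < 1 \<longrightarrow> k < n \<longrightarrow> solvability_sum n Am \<gamma>m k z = 0)"
        by (rule solv[OF Lq(2) c(2)])
      ultimately show ?thesis using ex by meson
    qed
    show "dirichlet_solution bj n A \<gamma> w \<longleftrightarrow>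
        dirichlet_solution \<i> n Ap \<gamma>p (\<lambda>z. cnj (plus_part (w z))) \<and>
        dirichlet_solution \<i> n Am \<gamma>m (\<lambda>z. minus_part (w z))" for w
      using parts[of w] by (simp only: plus_conj_def)
    show "w z = p_plus * bicomplex_of (cnj (exp (T_disk Ap z) * polyanalytic_part n Ap \<gamma>p z))
          + p_minus * bicomplex_of (exp (T_disk Am z) * polyanalytic_part n Am \<gamma>m z)"
      if "dirichlet_solution bj n A \<gamma> w" "z \<in> unit_disk" for w z
      using formula[OF that] by (simp only: assemble_def)
  qed
qed

end
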